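(* Let $p$ be an odd prime, let $\mathbb{S}_1=\mathbb{Z}_p^\times$, and let $(E_1)_*=\mathbb{Z}_p[u^{\pm1}]$ with $u$ in degree $-2$ and with $g\in\mathbb{Z}_p^\times$ acting by the graded $\mathbb{Z}_p$-algebra automorphism determined by $u\mapsto g u$. Then $$H^s(\mathbb{S}_1,(E_1)_t)\cong\begin{cases}\mathbb{Z}_p & t=0,\ s=0,1\\ \mathbb{Z}/p^{\nu_p(t')+1} & t=2(p-1)t' \text{ with } t'\neq 0 \text{ an integer},\ s=1\\ 0 & \text{otherwise.}\end{cases}$$
   Context: $(E_1)_t$ denotes the degree $t$ part of $(E_1)_*$. $\nu_p$ is the $p$-adic valuation of integers. Cohomology is continuous cohomology of profinite groups: $H^s(G,M)=\mathrm{Ext}^s_{\mathbb{Z}_p[[G]]}(\mathbb{Z}_p,M)$, computed in the category of profinite modules over the completed group algebra $\mathbb{Z}_p[[G]]$. *)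

theory Defs
  imports
    "HOL-Analysis.Abstract_Limits"
    "HOL-Analysis.T1_Spaces"
    "HOL-Computational_Algebra.Primes"
    "HOL-Algebra.Module"
    "HOL-Algebra.AbelCoset"
begin

section \<open>Topological groups, rings and modules as records\<close>

record 'g topgroup = "'g monoid" +
  gtop :: "'g topology"

record 'r topring = "'r ring" +
  rtop :: "'r topology"

record ('r, 'm) topmod = "('r, 'm) module" +
  mtop :: "'m topology"

definition ring_as_topmod :: "'r topring \<Rightarrow> ('r, 'r) topmod" where
  "ring_as_topmod R =
     \<lparr>carrier = carrier R, monoid.mult = mult R, one = one R, zero = zero R, add = add R,
      smult = mult R, mtop = rtop R\<rparr>"


section \<open>The p-adic integers and their group of units\<close>

text \<open>\<open>x n\<close> is the residue of \<open>x\<close> modulo \<open>p ^ n\<close>, so this is the inverse limit of the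
  rings of integers modulo \<open>p ^ n\<close>, with the inverse limit topology.\<close>

definition Zp :: "nat \<Rightarrow> (nat \<Rightarrow> int) topring" where
  "Zp p =
    (let C = {x. \<forall>n. 0 \<le> x n \<and> x n < int p ^ n \<and> x (Suc n) mod int p ^ n = x n} in
     \<lparr>carrier = C,
      monoid.mult = (\<lambda>x y n. (x n * y n) mod int p ^ n),
      one = (\<lambda>n. 1 mod int p ^ n),
      zero = (\<lambda>n. 0),
      add = (\<lambda>x y n. (x n + y n) mod int p ^ n),
      rtop = subtopology (product_topology (\<lambda>_. discrete_topology UNIV) UNIV) C\<rparr>)"

definition Zp_units :: "nat \<Rightarrow> (nat \<Rightarrow> int) topgroup" where
  "Zp_units p =
     monoid.extend (units_of (Zp p))
       (topgroup.fields (subtopology (rtop (Zp p)) (carrier (units_of (Zp p)))))"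

text \<open>The cyclic group of order \<open>p ^ n\<close> as a module over the p-adic integers.\<close>

definition Zmod :: "nat \<Rightarrow> nat \<Rightarrow> (nat \<Rightarrow> int, int) module" where
  "Zmod p n =
     \<lparr>carrier = {0..<int p ^ n},
      monoid.mult = (\<lambda>a b. (a * b) mod int p ^ n),
      one = 1 mod int p ^ n,
      zero = 0,
      add = (\<lambda>a b. (a + b) mod int p ^ n),
      smult = (\<lambda>c a. (c n * a) mod int p ^ n)\<rparr>"


section \<open>The completed group algebra\<close>

text \<open>The group ring of a finite group; elements are extensional functions on the group.\<close>

definition group_ring :: "('r, 'b) ring_scheme \<Rightarrow> ('g, 'c) monoid_scheme \<Rightarrow> ('g \<Rightarrow> 'r) ring" where
  "group_ring R H =
     \<lparr>carrier = carrier H \<rightarrow>\<^sub>E carrier R,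
      monoid.mult = (\<lambda>f h. \<lambda>x\<in>carrier H.
        \<Oplus>\<^bsub>R\<^esub>y\<in>carrier H. f y \<otimes>\<^bsub>R\<^esub> h (inv\<^bsub>H\<^esub> y \<otimes>\<^bsub>H\<^esub> x)),
      one = (\<lambda>x\<in>carrier H. if x = \<one>\<^bsub>H\<^esub> then \<one>\<^bsub>R\<^esub> else \<zero>\<^bsub>R\<^esub>),
      zero = (\<lambda>x\<in>carrier H. \<zero>\<^bsub>R\<^esub>),
      add = (\<lambda>f h. \<lambda>x\<in>carrier H. f x \<oplus>\<^bsub>R\<^esub> h x)\<rparr>"

definition open_normal_subgroups :: "'g topgroup \<Rightarrow> 'g set set" where
  "open_normal_subgroups G = {U. normal U G \<and> openin (gtop G) U}"

text \<open>The inverse limit of the group rings \<open>R[G/U]\<close> over the open normal subgroups \<open>U\<close>.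
  The transition map \<open>R[G/U] \<rightarrow> R[G/V]\<close>, for \<open>U \<subseteq> V\<close>, sums the coefficients of the
  \<open>U\<close>-cosets contained in a given \<open>V\<close>-coset.\<close>

definition completed_group_algebra ::
    "'r topring \<Rightarrow> 'g topgroup \<Rightarrow> ('g set \<Rightarrow> 'g set \<Rightarrow> 'r) topring" where
  "completed_group_algebra R G =
    (let N = open_normal_subgroups G;
         A = (\<lambda>U. group_ring R (G Mod U));
         C = {x \<in> \<Pi>\<^sub>E U\<in>N. carrier (A U).
               \<forall>U\<in>N. \<forall>V\<in>N. U \<subseteq> V \<longrightarrow>
                 (\<forall>c\<in>carrier (G Mod V).
                    x V c = (\<Oplus>\<^bsub>R\<^esub>b\<in>{b\<in>carrier (G Mod U). b \<subseteq> c}. x U b))}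
     in \<lparr>carrier = C,
         monoid.mult = (\<lambda>x y. \<lambda>U\<in>N. x U \<otimes>\<^bsub>A U\<^esub> y U),
         one = (\<lambda>U\<in>N. \<one>\<^bsub>A U\<^esub>),
         zero = (\<lambda>U\<in>N. \<zero>\<^bsub>A U\<^esub>),
         add = (\<lambda>x y. \<lambda>U\<in>N. x U \<oplus>\<^bsub>A U\<^esub> y U),
         rtop = subtopology
           (product_topology
             (\<lambda>U. product_topology (\<lambda>_. rtop R) (carrier (G Mod U))) N) C\<rparr>)"

definition scalar_embedding ::
    "'r topring \<Rightarrow> 'g topgroup \<Rightarrow> 'r \<Rightarrow> 'g set \<Rightarrow> 'g set \<Rightarrow> 'r" where
  "scalar_embedding R G c =
     (\<lambda>U\<in>open_normal_subgroups G. \<lambda>b\<in>carrier (G Mod U). if b = U then c else \<zero>\<^bsub>R\<^esub>)"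

text \<open>A profinite \<open>R\<close>-module \<open>M\<close> with a continuous linear action of \<open>G\<close> is a module over the
  completed group algebra: \<open>x\<close> acts on \<open>m\<close> as the limit, along the open normal
  subgroups \<open>U\<close> ordered by reverse inclusion, of the sums of \<open>x U b \<odot> (g\<^sub>b m)\<close> over the cosets
  \<open>b\<close> of \<open>U\<close>, where \<open>g\<^sub>b\<close> is any representative of \<open>b\<close>.\<close>

definition completed_smult ::
    "'g topgroup \<Rightarrow> ('r, 'm) topmod \<Rightarrow> ('g \<Rightarrow> 'm \<Rightarrow> 'm) \<Rightarrow> ('g set \<Rightarrow> 'g set \<Rightarrow> 'r) \<Rightarrow> 'm \<Rightarrow> 'm" where
  "completed_smult G M act x m =
     (THE y. limitin (mtop M)
        (\<lambda>U. \<Oplus>\<^bsub>M\<^esub>b\<in>carrier (G Mod U). x U b \<odot>\<^bsub>M\<^esub> act (SOME g. g \<in> b) m) y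
        (INF V\<in>open_normal_subgroups G. principal {U \<in> open_normal_subgroups G. U \<subseteq> V}))"

definition completed_module ::
    "'g topgroup \<Rightarrow> ('r, 'm) topmod \<Rightarrow> ('g \<Rightarrow> 'm \<Rightarrow> 'm) \<Rightarrow> ('g set \<Rightarrow> 'g set \<Rightarrow> 'r, 'm) topmod" where
  "completed_module G M act =
     \<lparr>carrier = carrier M, monoid.mult = mult M, one = one M, zero = zero M, add = add M,
      smult = completed_smult G M act, mtop = mtop M\<rparr>"


section \<open>Profinite modules and Ext\<close>

text \<open>Here \<open>R\<close> is a profinite commutative ring. (The completed group algebra of an abelian
  profinite group is commutative.)\<close>

definition totally_disconnected_space :: "'a topology \<Rightarrow> bool" where
  "totally_disconnected_space X \<longleftrightarrow> (\<forall>S. connectedin X S \<longrightarrow> (\<exists>x. S \<subseteq> {x}))"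

definition profinite_module :: "'r topring \<Rightarrow> ('r, 'm) topmod \<Rightarrow> bool" where
  "profinite_module R M \<longleftrightarrow>
     Module.module R M \<and>
     topspace (mtop M) = carrier M \<and>
     compact_space (mtop M) \<and> Hausdorff_space (mtop M) \<and> totally_disconnected_space (mtop M) \<and>
     continuous_map (prod_topology (mtop M) (mtop M)) (mtop M) (\<lambda>(x, y). x \<oplus>\<^bsub>M\<^esub> y) \<and>
     continuous_map (prod_topology (rtop R) (mtop M)) (mtop M) (\<lambda>(a, x). a \<odot>\<^bsub>M\<^esub> x)"

definition cont_hom :: "'r topring \<Rightarrow> ('r, 'm) topmod \<Rightarrow> ('r, 'n) topmod \<Rightarrow> ('m \<Rightarrow> 'n) set" where
  "cont_hom R M N =
     {f \<in> carrier M \<rightarrow>\<^sub>E carrier N.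
        continuous_map (mtop M) (mtop N) f \<and>
        (\<forall>x\<in>carrier M. \<forall>y\<in>carrier M. f (x \<oplus>\<^bsub>M\<^esub> y) = f x \<oplus>\<^bsub>N\<^esub> f y) \<and>
        (\<forall>a\<in>carrier R. \<forall>x\<in>carrier M. f (a \<odot>\<^bsub>M\<^esub> x) = a \<odot>\<^bsub>N\<^esub> f x)}"

text \<open>Projectivity in the category of profinite modules whose elements come from the
  type \<open>'u\<close>; epimorphisms of profinite modules are the surjective ones.\<close>

definition profinite_projective :: "'u itself \<Rightarrow> 'r topring \<Rightarrow> ('r, 'm) topmod \<Rightarrow> bool" where
  "profinite_projective _ R P \<longleftrightarrow>
     profinite_module R P \<and>
     (\<forall>(M :: ('r, 'u) topmod) (N :: ('r, 'u) topmod) f g.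
        profinite_module R M \<and> profinite_module R N \<and>
        f \<in> cont_hom R M N \<and> f ` carrier M = carrier N \<and> g \<in> cont_hom R P N \<longrightarrow>
        (\<exists>h\<in>cont_hom R P M. \<forall>x\<in>carrier P. f (h x) = g x))"

text \<open>\<open>\<cdots> \<rightarrow> P 2 \<rightarrow> P 1 \<rightarrow> P 0 \<rightarrow> A \<rightarrow> 0\<close> with \<open>d n : P (n + 1) \<rightarrow> P n\<close> and
  augmentation \<open>\<epsilon> : P 0 \<rightarrow> A\<close>.\<close>

definition projective_resolution ::
    "'u itself \<Rightarrow> 'r topring \<Rightarrow> ('r, 'a) topmod \<Rightarrow>
     (nat \<Rightarrow> ('r, 'm) topmod) \<Rightarrow> (nat \<Rightarrow> 'm \<Rightarrow> 'm) \<Rightarrow> ('m \<Rightarrow> 'a) \<Rightarrow> bool" where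
  "projective_resolution u R A P d \<epsilon> \<longleftrightarrow>
     profinite_module R A \<and>
     (\<forall>n. profinite_projective u R (P n)) \<and>
     (\<forall>n. d n \<in> cont_hom R (P (Suc n)) (P n)) \<and>
     \<epsilon> \<in> cont_hom R (P 0) A \<and>
     \<epsilon> ` carrier (P 0) = carrier A \<and>
     d 0 ` carrier (P 1) = a_kernel (P 0) A \<epsilon> \<and>
     (\<forall>n. d (Suc n) ` carrier (P (Suc (Suc n))) = a_kernel (P (Suc n)) (P n) (d n))"

text \<open>Only the additive group and \<open>smult\<close> of a module record matter below.\<close>

definition hom_module ::
    "'r topring \<Rightarrow> ('r, 'm) topmod \<Rightarrow> ('r, 'n) topmod \<Rightarrow> ('r, 'm \<Rightarrow> 'n) module" where
  "hom_module R M N =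
     \<lparr>carrier = cont_hom R M N, monoid.mult = undefined, one = undefined,
      zero = (\<lambda>x\<in>carrier M. \<zero>\<^bsub>N\<^esub>),
      add = (\<lambda>f g. \<lambda>x\<in>carrier M. f x \<oplus>\<^bsub>N\<^esub> g x),
      smult = (\<lambda>a f. \<lambda>x\<in>carrier M. a \<odot>\<^bsub>N\<^esub> f x)\<rparr>"

definition quotient_module :: "('r, 'm) module \<Rightarrow> 'm set \<Rightarrow> ('r, 'm set) module" where
  "quotient_module M B =
     \<lparr>carrier = a_rcosets\<^bsub>M\<^esub> B, monoid.mult = undefined, one = undefined,
      zero = B,
      add = set_add M,
      smult = (\<lambda>a X. \<Union>x\<in>X. B +>\<^bsub>M\<^esub> (a \<odot>\<^bsub>M\<^esub> x))\<rparr>"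

definition precomp ::
    "('r, 'm) topmod \<Rightarrow> ('m \<Rightarrow> 'k) \<Rightarrow> ('k \<Rightarrow> 'n) \<Rightarrow> 'm \<Rightarrow> 'n" where
  "precomp M e f = (\<lambda>x\<in>carrier M. f (e x))"

definition ext_cocycles ::
    "'r topring \<Rightarrow> (nat \<Rightarrow> ('r, 'm) topmod) \<Rightarrow> (nat \<Rightarrow> 'm \<Rightarrow> 'm) \<Rightarrow> ('r, 'n) topmod \<Rightarrow> nat \<Rightarrow> ('m \<Rightarrow> 'n) set" where
  "ext_cocycles R P d B s =
     a_kernel (hom_module R (P s) B) (hom_module R (P (Suc s)) B) (precomp (P (Suc s)) (d s))"

definition ext_coboundaries ::
    "'r topring \<Rightarrow> (nat \<Rightarrow> ('r, 'm) topmod) \<Rightarrow> (nat \<Rightarrow> 'm \<Rightarrow> 'm) \<Rightarrow> ('r, 'n) topmod \<Rightarrow> nat \<Rightarrow> ('m \<Rightarrow> 'n) set" where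
  "ext_coboundaries R P d B s =
     (case s of
        0 \<Rightarrow> {\<zero>\<^bsub>hom_module R (P 0) B\<^esub>}
      | Suc r \<Rightarrow> precomp (P (Suc r)) (d r) ` cont_hom R (P r) B)"

text \<open>\<open>Ext\<^sup>s(A, B)\<close> computed from a projective resolution \<open>(P, d)\<close> of \<open>A\<close>.\<close>

definition ext ::
    "'r topring \<Rightarrow> (nat \<Rightarrow> ('r, 'm) topmod) \<Rightarrow> (nat \<Rightarrow> 'm \<Rightarrow> 'm) \<Rightarrow> ('r, 'n) topmod \<Rightarrow> nat
      \<Rightarrow> ('r, ('m \<Rightarrow> 'n) set) module" where
  "ext R P d B s =
     quotient_module ((hom_module R (P s) B)\<lparr>carrier := ext_cocycles R P d B s\<rparr>)
       (ext_coboundaries R P d B s)"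

definition restrict_scalars :: "('q \<Rightarrow> 'r) \<Rightarrow> ('r, 'm) module \<Rightarrow> ('q, 'm) module" where
  "restrict_scalars \<phi> M =
     \<lparr>carrier = carrier M, monoid.mult = mult M, one = one M, zero = zero M, add = add M,
      smult = (\<lambda>c. smult M (\<phi> c))\<rparr>"

definition module_iso ::
    "('r, 'b) ring_scheme \<Rightarrow> ('r, 'm, 'c) module_scheme \<Rightarrow> ('r, 'n, 'd) module_scheme \<Rightarrow> bool" where
  "module_iso R M N \<longleftrightarrow>
     (\<exists>h. bij_betw h (carrier M) (carrier N) \<and>
        (\<forall>x\<in>carrier M. \<forall>y\<in>carrier M. h (x \<oplus>\<^bsub>M\<^esub> y) = h x \<oplus>\<^bsub>N\<^esub> h y) \<and>
        (\<forall>a\<in>carrier R. \<forall>x\<in>carrier M. h (a \<odot>\<^bsub>M\<^esub> x) = a \<odot>\<^bsub>N\<^esub> h x))"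


section \<open>Continuous cohomology of an abelian profinite group\<close>

definition trivial_module ::
    "'r topring \<Rightarrow> 'g topgroup \<Rightarrow> ('g set \<Rightarrow> 'g set \<Rightarrow> 'r, 'r) topmod" where
  "trivial_module R G = completed_module G (ring_as_topmod R) (\<lambda>g a. a)"

text \<open>\<open>H\<^sup>s(G, M) = Ext\<^sup>s(R, M)\<close> over the completed group algebra, as an \<open>R\<close>-module, computed
  from a projective resolution \<open>(P, d)\<close> of the trivial module \<open>R\<close>.\<close>

definition cohomology ::
    "'r topring \<Rightarrow> 'g topgroup \<Rightarrow>
     (nat \<Rightarrow> ('g set \<Rightarrow> 'g set \<Rightarrow> 'r, 'k) topmod) \<Rightarrow> (nat \<Rightarrow> 'k \<Rightarrow> 'k) \<Rightarrow>
     ('r, 'm) topmod \<Rightarrow> ('g \<Rightarrow> 'm \<Rightarrow> 'm) \<Rightarrow> nat \<Rightarrow> ('r, ('k \<Rightarrow> 'm) set) module" where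
  "cohomology R G P d M act s =
     restrict_scalars (scalar_embedding R G)
       (ext (completed_group_algebra R G) P d (completed_module G M act) s)"


section \<open>The graded ring \<open>\<int>\<^sub>p[u, u\<^sup>-\<^sup>1]\<close>\<close>

text \<open>\<open>f k\<close> is the coefficient of \<open>u\<^sup>k\<close>.\<close>

definition E1 :: "nat \<Rightarrow> (nat \<Rightarrow> int, int \<Rightarrow> nat \<Rightarrow> int) module" where
  "E1 p =
     \<lparr>carrier = {f. (\<forall>k. f k \<in> carrier (Zp p)) \<and> finite {k. f k \<noteq> \<zero>\<^bsub>Zp p\<^esub>}},
      monoid.mult = (\<lambda>f h k. \<Oplus>\<^bsub>Zp p\<^esub>i\<in>{i. f i \<noteq> \<zero>\<^bsub>Zp p\<^esub>}. f i \<otimes>\<^bsub>Zp p\<^esub> h (k - i)),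
      one = (\<lambda>k. if k = 0 then \<one>\<^bsub>Zp p\<^esub> else \<zero>\<^bsub>Zp p\<^esub>),
      zero = (\<lambda>k. \<zero>\<^bsub>Zp p\<^esub>),
      add = (\<lambda>f h k. f k \<oplus>\<^bsub>Zp p\<^esub> h k),
      smult = (\<lambda>c f k. c \<otimes>\<^bsub>Zp p\<^esub> f k)\<rparr>"

definition E1_u :: "nat \<Rightarrow> int \<Rightarrow> nat \<Rightarrow> int" where
  "E1_u p = (\<lambda>k. if k = 1 then \<one>\<^bsub>Zp p\<^esub> else \<zero>\<^bsub>Zp p\<^esub>)"

text \<open>The automorphism \<open>u \<mapsto> g u\<close>, which sends \<open>\<Sum> a\<^sub>k u\<^sup>k\<close> to \<open>\<Sum> a\<^sub>k g\<^sup>k u\<^sup>k\<close>.\<close>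

definition E1_act :: "nat \<Rightarrow> (nat \<Rightarrow> int) \<Rightarrow> (int \<Rightarrow> nat \<Rightarrow> int) \<Rightarrow> int \<Rightarrow> nat \<Rightarrow> int" where
  "E1_act p g f = (\<lambda>k. (g [^]\<^bsub>Zp_units p\<^esub> k) \<otimes>\<^bsub>Zp p\<^esub> f k)"

text \<open>The degree \<open>t\<close> part, where \<open>u\<^sup>k\<close> has degree \<open>-2k\<close>, with its p-adic topology.\<close>

definition E1_part :: "nat \<Rightarrow> int \<Rightarrow> (nat \<Rightarrow> int, int \<Rightarrow> nat \<Rightarrow> int) topmod" where
  "E1_part p t =
    (let C = {f \<in> carrier (E1 p). \<forall>k. f k \<noteq> \<zero>\<^bsub>Zp p\<^esub> \<longrightarrow> - 2 * k = t} in
     \<lparr>carrier = C, monoid.mult = mult (E1 p), one = one (E1 p), zero = zero (E1 p),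
      add = add (E1 p), smult = smult (E1 p),
      mtop = subtopology (product_topology (\<lambda>_. rtop (Zp p)) UNIV) C\<rparr>)"

end

theory Submission
  imports
    Defs
    "HOL-Algebra.Generated_Groups"
    "HOL-Analysis.Abstract_Topological_Spaces"
    "HOL-Number_Theory.Residue_Primitive_Roots"
begin

text \<open>For odd \<open>p\<close> the group \<open>\<int>\<^sub>p\<^sup>\<times>\<close> is topologically generated by an integer \<open>g\<close> that is a primitive
  root modulo all powers of \<open>p\<close>. Then \<open>\<gamma> = [g] - 1\<close> is a non-zero-divisor of the completed group
  algebra \<open>\<Lambda>\<close> and generates the augmentation ideal, so \<open>\<gamma> : \<Lambda> \<rightarrow> \<Lambda>\<close> resolves the trivial
  module. Given any projective resolution \<open>P\<close>, lift its augmentation to \<open>\<psi> : P\<^sub>0 \<rightarrow> \<Lambda>\<close> and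
  divide \<open>\<psi> \<circ> d\<^sub>0\<close> by \<open>\<gamma>\<close>: this compares \<open>P\<close> with the short resolution and identifies \<open>H\<^sup>0\<close> with the
  kernel of \<open>\<gamma>\<close> on \<open>M\<close>, \<open>H\<^sup>1\<close> with \<open>M / \<gamma> M\<close>, and shows \<open>H\<^sup>s = 0\<close> for \<open>s \<ge> 2\<close>. On the part of
  degree \<open>-2k\<close>, \<open>\<gamma>\<close> is multiplication by \<open>g\<^sup>k - 1\<close>, whose valuation is determined by the order
  \<open>(p - 1) p\<^sup>n\<^sup>-\<^sup>1\<close> of \<open>g\<close> modulo \<open>p\<^sup>n\<close>.\<close>

section \<open>Profinite modules\<close>

text \<open>Two obstacles shape the development. First, \<open>profinite_projective\<close> tests
  projectivity only against modules with elements in \<open>'u\<close>, so a lifting problem with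
  target \<open>\<Lambda>\<close> becomes solvable only once \<open>\<Lambda>\<close> has been
  copied into \<open>'u\<close>. The room for the copy comes from the resolution itself: its
  augmentation maps \<open>P 0\<close> onto the p-adic integers, so \<open>'u\<close> is at least as
  large as these, and \<open>\<Lambda>\<close> embeds into them because each of its elements is
  countable data. Second, \<open>\<Lambda>\<close> is not an integral domain, for the group has
  elements of order p - 1; regularity of \<open>\<gamma>\<close> has to come from the growing p-part
  of the finite quotients. Oddness of p provides a single primitive root for all powers of p. The
  maps between the two resolutions are built explicitly, in both directions and with a homotopy, so
  that no uniqueness theorem for Ext is invoked. Since u has degree -2, the weight k and the degree
  t have opposite signs; this is harmless because \<open>g^(-k) - 1\<close> is a unit multiple of
  \<open>g^k - 1\<close>.\<close>

lemma continuous_map_binary: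
  assumes "continuous_map Z X f" "continuous_map Z Y g"
    and "continuous_map (prod_topology X Y) W (\<lambda>(x, y). F x y)"
  shows "continuous_map Z W (\<lambda>z. F (f z) (g z))"
proof -
  have "continuous_map Z (prod_topology X Y) (\<lambda>z. (f z, g z))"
    using assms(1,2) by (simp add: continuous_map_pairwise o_def)
  from continuous_map_compose[OF this assms(3)] show ?thesis by (simp add: o_def)
qed

text \<open>The image of a connected set has at most one point, so by injectivity the set itself
  does. Serves subspaces as well as modules copied into another type.\<close>

lemma totally_disconnected_space_inj:
  assumes f: "continuous_map X Y f" "inj_on f (topspace X)" and Y: "totally_disconnected_space Y"
  shows "totally_disconnected_space X"
  unfolding totally_disconnected_space_def
proof (intro allI impI)
  fix S assume S: "connectedin X S"
  then have "connectedin Y (f ` S)" using f(1) connectedin_continuous_map_image by blast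
  then obtain y where y: "f ` S \<subseteq> {y}" using Y unfolding totally_disconnected_space_def by blast
  have "S \<subseteq> topspace X" using S connectedin_subset_topspace by blast
  then show "\<exists>x. S \<subseteq> {x}" using y f(2) unfolding inj_on_def by (cases "S = {}") blast+
qed

lemma totally_disconnected_space_subtopology:
  "totally_disconnected_space X \<Longrightarrow> totally_disconnected_space (subtopology X S)"
  by (rule totally_disconnected_space_inj[of _ X id]) auto

text \<open>Each coordinate projection of a connected set has at most one point, and extensional
  functions are determined by their coordinates.\<close>

lemma totally_disconnected_space_product:
  assumes "\<And>i. i \<in> I \<Longrightarrow> totally_disconnected_space (X i)"
  shows "totally_disconnected_space (product_topology X I)"
  unfolding totally_disconnected_space_def
proof (intro allI impI)
  fix S assume S: "connectedin (product_topology X I) S"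
  have 1: "\<exists>y. (\<lambda>x. x i) ` S \<subseteq> {y}" if "i \<in> I" for i
    using connectedin_continuous_map_image[OF continuous_map_product_projection[OF that] S] assms[OF that]
    unfolding totally_disconnected_space_def by blast
  have 2: "S \<subseteq> extensional I" using connectedin_subset_topspace[OF S] by (auto simp: PiE_def)
  have "x = y" if "x \<in> S" "y \<in> S" for x y
  proof (rule extensionalityI[of _ I])
    fix i assume "i \<in> I" then show "x i = y i" using 1[of i] that by blast
  qed (use that 2 in auto)
  then show "\<exists>x. S \<subseteq> {x}" by blast
qed

lemma totally_disconnected_space_discrete: "totally_disconnected_space (discrete_topology S)"
  unfolding totally_disconnected_space_def by (simp add: connectedin_discrete_topology)

section \<open>Continuous homomorphisms of profinite modules\<close>

lemma ring_as_topmod_simps [simp]: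
  "carrier (ring_as_topmod R) = carrier R" "mult (ring_as_topmod R) = mult R"
  "one (ring_as_topmod R) = one R" "zero (ring_as_topmod R) = zero R"
  "add (ring_as_topmod R) = add R" "smult (ring_as_topmod R) = mult R"
  "mtop (ring_as_topmod R) = rtop R"
  by (simp_all add: ring_as_topmod_def)

lemma cont_homI:
  assumes "f \<in> extensional (carrier M)"
    "continuous_map (mtop M) (mtop N) f"
    "\<And>x. x \<in> carrier M \<Longrightarrow> f x \<in> carrier N"
    "\<And>x y. x \<in> carrier M \<Longrightarrow> y \<in> carrier M \<Longrightarrow> f (x \<oplus>\<^bsub>M\<^esub> y) = f x \<oplus>\<^bsub>N\<^esub> f y"
    "\<And>a x. a \<in> carrier R \<Longrightarrow> x \<in> carrier M \<Longrightarrow> f (a \<odot>\<^bsub>M\<^esub> x) = a \<odot>\<^bsub>N\<^esub> f x"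
  shows "f \<in> cont_hom R M N"
  using assms unfolding cont_hom_def by (auto simp: PiE_def)

lemma cont_homD:
  assumes "f \<in> cont_hom R M N"
  shows "f \<in> extensional (carrier M)"
    "continuous_map (mtop M) (mtop N) f"
    "\<And>x. x \<in> carrier M \<Longrightarrow> f x \<in> carrier N"
    "\<And>x y. x \<in> carrier M \<Longrightarrow> y \<in> carrier M \<Longrightarrow> f (x \<oplus>\<^bsub>M\<^esub> y) = f x \<oplus>\<^bsub>N\<^esub> f y"
    "\<And>a x. a \<in> carrier R \<Longrightarrow> x \<in> carrier M \<Longrightarrow> f (a \<odot>\<^bsub>M\<^esub> x) = a \<odot>\<^bsub>N\<^esub> f x"
  using assms unfolding cont_hom_def by (auto simp: PiE_def)

text \<open>Members of \<open>cont_hom\<close> are extensional, so that equality of homomorphisms is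
  equality on the carrier; hence the maps below are restricted. Continuity survives because the
  carrier is the whole space.\<close>

lemma cont_homI_restrict:
  assumes "topspace (mtop M) = carrier M" "module R M"
    "continuous_map (mtop M) (mtop N) f"
    "\<And>x. x \<in> carrier M \<Longrightarrow> f x \<in> carrier N"
    "\<And>x y. x \<in> carrier M \<Longrightarrow> y \<in> carrier M \<Longrightarrow> f (x \<oplus>\<^bsub>M\<^esub> y) = f x \<oplus>\<^bsub>N\<^esub> f y"
    "\<And>a x. a \<in> carrier R \<Longrightarrow> x \<in> carrier M \<Longrightarrow> f (a \<odot>\<^bsub>M\<^esub> x) = a \<odot>\<^bsub>N\<^esub> f x"
  shows "restrict f (carrier M) \<in> cont_hom R M N"
proof (rule cont_homI)
  interpret module R M by fact
  show "continuous_map (mtop M) (mtop N) (restrict f (carrier M))"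
    using continuous_map_eq[OF assms(3)] assms(1) by auto
qed (use assms in \<open>auto simp: module.smult_closed[OF assms(2)] abelian_groupE(1)[OF module.axioms(2)[OF assms(2)]]\<close>)

lemma module_hom_zero:
  assumes "module R M" "module R N" "f \<in> cont_hom R M N"
  shows "f \<zero>\<^bsub>M\<^esub> = \<zero>\<^bsub>N\<^esub>"
proof -
  interpret M: module R M by fact
  interpret N: module R N by fact
  have "f (\<zero>\<^bsub>R\<^esub> \<odot>\<^bsub>M\<^esub> \<zero>\<^bsub>M\<^esub>) = \<zero>\<^bsub>R\<^esub> \<odot>\<^bsub>N\<^esub> f \<zero>\<^bsub>M\<^esub>" 
    by (rule cont_homD(5)[OF assms(3)]) auto
  then show ?thesis using cont_homD(3)[OF assms(3)] by simp
qed

text \<open>Subtraction is written \<open>x \<oplus> (\<ominus>\<one>) \<odot> y\<close>, which makes its continuity an instance of that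
  of the module operations.\<close>

definition mdiff :: "('r, 'c) ring_scheme \<Rightarrow> ('r, 'm, 'd) module_scheme \<Rightarrow> 'm \<Rightarrow> 'm \<Rightarrow> 'm" where
  "mdiff R M x y = x \<oplus>\<^bsub>M\<^esub> ((\<ominus>\<^bsub>R\<^esub> \<one>\<^bsub>R\<^esub>) \<odot>\<^bsub>M\<^esub> y)"

context module begin

lemma mdiff_eq: "x \<in> carrier M \<Longrightarrow> y \<in> carrier M \<Longrightarrow> mdiff R M x y = x \<ominus>\<^bsub>M\<^esub> y"
  by (simp add: mdiff_def smult_l_minus a_minus_def)

lemma mdiff_closed [simp]: "x \<in> carrier M \<Longrightarrow> y \<in> carrier M \<Longrightarrow> mdiff R M x y \<in> carrier M"
  by (simp add: mdiff_def)

lemma mdiff_self [simp]: "x \<in> carrier M \<Longrightarrow> mdiff R M x x = \<zero>\<^bsub>M\<^esub>"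
  by (simp add: mdiff_eq a_minus_def M.r_neg)

lemma mdiff_zero [simp]: "x \<in> carrier M \<Longrightarrow> mdiff R M x \<zero>\<^bsub>M\<^esub> = x"
  by (simp add: mdiff_def)

lemma mdiff_add_cancel [simp]:
  "x \<in> carrier M \<Longrightarrow> y \<in> carrier M \<Longrightarrow> mdiff R M x y \<oplus>\<^bsub>M\<^esub> y = x"
  by (simp add: mdiff_eq a_minus_def M.add.m_assoc M.l_neg)

lemma mdiff_eq_zero_iff:
  "x \<in> carrier M \<Longrightarrow> y \<in> carrier M \<Longrightarrow> mdiff R M x y = \<zero>\<^bsub>M\<^esub> \<longleftrightarrow> x = y"
  by (metis M.l_zero mdiff_add_cancel mdiff_self)

lemma mdiff_smult:
  "a \<in> carrier R \<Longrightarrow> x \<in> carrier M \<Longrightarrow> y \<in> carrier M \<Longrightarrow>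
    mdiff R M (a \<odot>\<^bsub>M\<^esub> x) (a \<odot>\<^bsub>M\<^esub> y) = a \<odot>\<^bsub>M\<^esub> mdiff R M x y"
  by (simp add: mdiff_def smult_r_distr smult_assoc1[symmetric] R.m_comm)

lemma mdiff_add:
  "x \<in> carrier M \<Longrightarrow> y \<in> carrier M \<Longrightarrow> x' \<in> carrier M \<Longrightarrow> y' \<in> carrier M \<Longrightarrow>
    mdiff R M (x \<oplus>\<^bsub>M\<^esub> x') (y \<oplus>\<^bsub>M\<^esub> y') = mdiff R M x y \<oplus>\<^bsub>M\<^esub> mdiff R M x' y'"
  by (simp add: mdiff_def smult_r_distr M.a_ac)

lemma mdiff_smult_left:
  "a \<in> carrier R \<Longrightarrow> b \<in> carrier R \<Longrightarrow> x \<in> carrier M \<Longrightarrow>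
    (a \<ominus>\<^bsub>R\<^esub> b) \<odot>\<^bsub>M\<^esub> x = mdiff R M (a \<odot>\<^bsub>M\<^esub> x) (b \<odot>\<^bsub>M\<^esub> x)"
  by (simp add: mdiff_def a_minus_def smult_l_distr smult_l_minus)

end

lemma cont_hom_mdiff:
  assumes "module R M" "module R N" "f \<in> cont_hom R M N" "x \<in> carrier M" "y \<in> carrier M"
  shows "f (mdiff R M x y) = mdiff R N (f x) (f y)"
proof -
  interpret M: module R M by fact
  show ?thesis using assms(3-) by (simp add: mdiff_def cont_homD)
qed

lemma profinite_moduleD:
  assumes "profinite_module R M"
  shows "module R M" "topspace (mtop M) = carrier M" "compact_space (mtop M)"
    "Hausdorff_space (mtop M)" "totally_disconnected_space (mtop M)"
    "continuous_map (prod_topology (mtop M) (mtop M)) (mtop M) (\<lambda>(x, y). x \<oplus>\<^bsub>M\<^esub> y)"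
    "continuous_map (prod_topology (rtop R) (mtop M)) (mtop M) (\<lambda>(a, x). a \<odot>\<^bsub>M\<^esub> x)"
  using assms unfolding profinite_module_def by auto

text \<open>The ring is a profinite module over itself. As \<open>module\<close> presupposes a
  commutative ring, commutativity is built in, which fits the completed group algebra of an abelian
  group.\<close>

locale profinite_ring =
  fixes R :: "'r topring"
  assumes profinite: "profinite_module R (ring_as_topmod R)"
begin

lemma cring: "cring R" using profinite_moduleD(1)[OF profinite] by (rule module.axioms(1))

sublocale cring R by (rule cring)

lemmas top_facts = profinite_moduleD[OF profinite, simplified]

lemma topspace_rtop [simp]: "topspace (rtop R) = carrier R"
  using top_facts by simp

lemma continuous_smult:
  assumes "profinite_module R M" "continuous_map Z (rtop R) f" "continuous_map Z (mtop M) g"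
  shows "continuous_map Z (mtop M) (\<lambda>z. f z \<odot>\<^bsub>M\<^esub> g z)"
  by (rule continuous_map_binary[OF assms(2,3) profinite_moduleD(7)[OF assms(1)]])

lemma continuous_add:
  assumes "profinite_module R M" "continuous_map Z (mtop M) f" "continuous_map Z (mtop M) g"
  shows "continuous_map Z (mtop M) (\<lambda>z. f z \<oplus>\<^bsub>M\<^esub> g z)"
  by (rule continuous_map_binary[OF assms(2,3) profinite_moduleD(6)[OF assms(1)]])

lemma continuous_mdiff:
  assumes "profinite_module R M" "continuous_map Z (mtop M) f" "continuous_map Z (mtop M) g"
  shows "continuous_map Z (mtop M) (\<lambda>z. mdiff R M (f z) (g z))"
  unfolding mdiff_def
  by (intro continuous_add continuous_smult assms) auto

lemma cont_hom_add:
  assumes M: "profinite_module R M" and N: "profinite_module R N"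
    and f: "f \<in> cont_hom R M N" and g: "g \<in> cont_hom R M N"
  shows "(\<lambda>x\<in>carrier M. f x \<oplus>\<^bsub>N\<^esub> g x) \<in> cont_hom R M N"
proof -
  interpret N: module R N by (rule profinite_moduleD[OF N])
  note F = cont_homD[OF f] and G = cont_homD[OF g]
  show ?thesis
    by (rule cont_homI_restrict)
      (auto simp: profinite_moduleD[OF M] F G N.M.a_ac N.smult_r_distr intro!: continuous_add[OF N])
qed

lemma cont_hom_mdiff_fun:
  assumes M: "profinite_module R M" and N: "profinite_module R N"
    and f: "f \<in> cont_hom R M N" and g: "g \<in> cont_hom R M N"
  shows "(\<lambda>x\<in>carrier M. mdiff R N (f x) (g x)) \<in> cont_hom R M N"
proof -
  interpret N: module R N by (rule profinite_moduleD[OF N])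
  note F = cont_homD[OF f] and G = cont_homD[OF g]
  show ?thesis
    by (rule cont_homI_restrict)
      (auto simp: profinite_moduleD[OF M] F G N.mdiff_add N.mdiff_smult intro!: continuous_mdiff[OF N])
qed

lemma cont_hom_comp:
  assumes M: "profinite_module R M" and f: "f \<in> cont_hom R M N" and g: "g \<in> cont_hom R N K"
  shows "(\<lambda>x\<in>carrier M. g (f x)) \<in> cont_hom R M K"
proof -
  note F = cont_homD[OF f] and G = cont_homD[OF g]
  have "continuous_map (mtop M) (mtop K) (g \<circ> f)" by (rule continuous_map_compose[OF F(2) G(2)])
  then show ?thesis
    by (intro cont_homI_restrict) (auto simp: profinite_moduleD[OF M] F G o_def)
qed

lemma cont_hom_id:
  assumes M: "profinite_module R M"
  shows "(\<lambda>x\<in>carrier M. x) \<in> cont_hom R M M"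
  by (rule cont_homI_restrict) (auto simp: profinite_moduleD[OF M])

lemma cont_hom_zero:
  assumes M: "profinite_module R M" and N: "profinite_module R N"
  shows "(\<lambda>x\<in>carrier M. \<zero>\<^bsub>N\<^esub>) \<in> cont_hom R M N"
proof -
  interpret N: module R N by (rule profinite_moduleD[OF N])
  show ?thesis
    by (rule cont_homI_restrict) (auto simp: profinite_moduleD[OF M] profinite_moduleD(2)[OF N])
qed

text \<open>The composite of \<open>f\<close> with the orbit map r |-> r b. This is how maps into
  the ring are turned into maps into other modules below.\<close>

lemma cont_hom_smult_elem:
  assumes M: "profinite_module R M" and N: "profinite_module R N"
    and f: "f \<in> cont_hom R M (ring_as_topmod R)" and b: "b \<in> carrier N"
  shows "(\<lambda>x\<in>carrier M. f x \<odot>\<^bsub>N\<^esub> b) \<in> cont_hom R M N"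
proof -
  interpret N: module R N by (rule profinite_moduleD[OF N])
  note F = cont_homD[OF f, simplified]
  show ?thesis
    by (rule cont_homI_restrict)
      (use b in \<open>auto simp: profinite_moduleD[OF M] profinite_moduleD(2)[OF N] F N.smult_l_distr
        N.smult_assoc1 intro!: continuous_smult[OF N]\<close>)
qed

text \<open>Multiplication by \<open>a\<close> is linear because \<open>R\<close> is commutative.
  With \<open>f\<close> the identity of the ring this gives multiplication by
  \<open>\<gamma>\<close>.\<close>

lemma cont_hom_smult_const:
  assumes M: "profinite_module R M" and N: "profinite_module R N"
    and f: "f \<in> cont_hom R M N" and a: "a \<in> carrier R"
  shows "(\<lambda>x\<in>carrier M. a \<odot>\<^bsub>N\<^esub> f x) \<in> cont_hom R M N"
proof -
  interpret N: module R N by (rule profinite_moduleD[OF N])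
  note F = cont_homD[OF f, simplified]
  have "continuous_map (mtop M) (mtop N) (\<lambda>x. a \<odot>\<^bsub>N\<^esub> f x)"
    using a by (intro continuous_smult[OF N] F) auto
  with a show ?thesis
    by (intro cont_homI_restrict)
       (auto simp: profinite_moduleD[OF M] F N.smult_r_distr N.smult_assoc1[symmetric] m_comm)
qed

text \<open>The free module of rank one: a lift is determined by a preimage \<open>m\<close> of the
  value of \<open>g\<close> at one, and x |-> x m is automatically continuous.\<close>

lemma projective_ring: "profinite_projective TYPE('u) R (ring_as_topmod R)"
  unfolding profinite_projective_def
proof (intro conjI allI impI profinite, elim conjE)
  fix M N :: "('r, 'u) topmod" and f g
  assume M: "profinite_module R M" and N: "profinite_module R N" and f: "f \<in> cont_hom R M N"
    and surj: "f ` carrier M = carrier N" and g: "g \<in> cont_hom R (ring_as_topmod R) N"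
  have "g \<one>\<^bsub>R\<^esub> \<in> carrier N" using cont_homD(3)[OF g] by simp
  then obtain m where m: "m \<in> carrier M" "f m = g \<one>\<^bsub>R\<^esub>" using surj by (metis imageE)
  have h: "(\<lambda>x\<in>carrier R. x \<odot>\<^bsub>M\<^esub> m) \<in> cont_hom R (ring_as_topmod R) M"
    using cont_hom_smult_elem[OF profinite M cont_hom_id[OF profinite] m(1)]
    by (simp cong: restrict_cong)
  show "\<exists>h\<in>cont_hom R (ring_as_topmod R) M. \<forall>x\<in>carrier (ring_as_topmod R). f (h x) = g x"
  proof (rule bexI[OF _ h], intro ballI)
    fix x assume x: "x \<in> carrier (ring_as_topmod R)"
    then have "f (x \<odot>\<^bsub>M\<^esub> m) = x \<odot>\<^bsub>N\<^esub> g \<one>\<^bsub>R\<^esub>" using cont_homD(5)[OF f] m by simp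
    also have "\<dots> = g (x \<otimes>\<^bsub>R\<^esub> \<one>\<^bsub>R\<^esub>)" using cont_homD(5)[OF g, of x "\<one>\<^bsub>R\<^esub>"] x by simp
    finally show "f ((\<lambda>x\<in>carrier R. x \<odot>\<^bsub>M\<^esub> m) x) = g x" using x by simp
  qed
qed

end

text \<open>Projectivity only tests modules with elements in a fixed type, so modules have to be
  copied into that type.\<close>

definition transport_module :: "('m \<Rightarrow> 'u) \<Rightarrow> ('r, 'm) topmod \<Rightarrow> ('r, 'u) topmod" where
  "transport_module j M =
    (let i = inv_into (carrier M) j in
     \<lparr>carrier = j ` carrier M, monoid.mult = undefined, one = undefined, zero = j \<zero>\<^bsub>M\<^esub>,
      add = (\<lambda>x y. j (i x \<oplus>\<^bsub>M\<^esub> i y)), smult = (\<lambda>a x. j (a \<odot>\<^bsub>M\<^esub> i x)),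
      mtop = pullback_topology (j ` carrier M) i (mtop M)\<rparr>)"

text \<open>Giving the copy the topology pulled back along the inverse of \<open>j\<close> makes
  \<open>j\<close> a homeomorphism, so all topological properties carry over.\<close>

lemma transport_module:
  assumes R: "profinite_ring R" and M: "profinite_module R M" and j: "inj_on j (carrier M)"
  shows "profinite_module R (transport_module j M)"
    and "restrict j (carrier M) \<in> cont_hom R M (transport_module j M)"
    and "restrict (inv_into (carrier M) j) (j ` carrier M) \<in> cont_hom R (transport_module j M) M"
proof -
  interpret R: profinite_ring R by fact
  interpret M: module R M by (rule profinite_moduleD[OF M])
  define i where "i = inv_into (carrier M) j"
  define T where "T = transport_module j M"
  have ij [simp]: "i (j x) = x" if "x \<in> carrier M" for x unfolding i_def using j that by simp
  have T: "carrier T = j ` carrier M" "zero T = j \<zero>\<^bsub>M\<^esub>" "add T = (\<lambda>x y. j (i x \<oplus>\<^bsub>M\<^esub> i y))"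
    "smult T = (\<lambda>a x. j (a \<odot>\<^bsub>M\<^esub> i x))" "mtop T = pullback_topology (j ` carrier M) i (mtop M)"
    by (simp_all add: T_def transport_module_def i_def Let_def)
  note Mt = profinite_moduleD[OF M]
  have ts: "topspace (mtop T) = carrier T" by (auto simp: T topspace_pullback_topology Mt)
  have ci: "continuous_map (mtop T) (mtop M) i"
    unfolding T by (rule continuous_map_pullback[OF continuous_map_id, unfolded o_def, simplified])
  have cj: "continuous_map (mtop M) (mtop T) j"
    unfolding T
    by (rule continuous_map_pullback')
       (auto simp: Mt o_def intro!: continuous_map_eq[OF continuous_map_id])
  have hom: "homeomorphic_maps (mtop M) (mtop T) j i"
    unfolding homeomorphic_maps_def using cj ci ts by (auto simp: Mt T)
  then have hs: "mtop M homeomorphic_space mtop T" unfolding homeomorphic_space_def by blast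
  have ab: "abelian_group T"
  proof (rule abelian_groupI)
    fix x assume "x \<in> carrier T"
    then obtain a where a: "a \<in> carrier M" "x = j a" unfolding T by blast
    then show "\<exists>y\<in>carrier T. y \<oplus>\<^bsub>T\<^esub> x = \<zero>\<^bsub>T\<^esub>"
      by (intro bexI[of _ "j (\<ominus>\<^bsub>M\<^esub> a)"]) (auto simp: T M.M.l_neg)
  qed (auto simp: T M.M.a_ac)
  have mod: "module R T"
    by (rule moduleI) (use ab R.cring in \<open>auto simp: T M.smult_l_distr M.smult_r_distr M.smult_assoc1\<close>)
  have c1: "continuous_map (prod_topology (mtop T) (mtop T)) (mtop T) (\<lambda>z. j (i (fst z) \<oplus>\<^bsub>M\<^esub> i (snd z)))"
    by (rule continuous_map_compose[OF _ cj, unfolded o_def], rule R.continuous_add[OF M];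
        rule continuous_map_compose[OF _ ci, unfolded o_def]) (auto simp: continuous_map_fst continuous_map_snd)
  have c2: "continuous_map (prod_topology (rtop R) (mtop T)) (mtop T) (\<lambda>z. j (fst z \<odot>\<^bsub>M\<^esub> i (snd z)))"
    by (rule continuous_map_compose[OF _ cj, unfolded o_def], rule R.continuous_smult[OF M] continuous_map_fst,
        rule continuous_map_fst, rule continuous_map_compose[OF _ ci, unfolded o_def]) (auto simp: continuous_map_snd)
  show P: "profinite_module R T"
    unfolding profinite_module_def
  proof (intro conjI mod ts)
    show "compact_space (mtop T)" using hs Mt(3) homeomorphic_compact_space by blast
    show "Hausdorff_space (mtop T)" using hs Mt(4) homeomorphic_Hausdorff_space by blast
    show "totally_disconnected_space (mtop T)"
      by (rule totally_disconnected_space_inj[OF ci _ Mt(5)], unfold ts) (auto simp: T inj_on_def)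
  qed (use c1 c2 in \<open>simp_all add: T case_prod_unfold\<close>)
  show "restrict j (carrier M) \<in> cont_hom R M T"
    by (rule cont_homI_restrict) (use cj in \<open>auto simp: Mt T\<close>)
  have "restrict i (carrier T) \<in> cont_hom R T M"
    by (rule cont_homI_restrict) (use ci ts mod in \<open>auto simp: T\<close>)
  then show "restrict (inv_into (carrier M) j) (j ` carrier M) \<in> cont_hom R T M"
    by (simp add: T i_def)
qed

text \<open>Projectivity is phrased for surjections only; replacing the target by the image of
  \<open>f\<close> turns any homomorphism into one. The image is compact because the source
  is.\<close>

lemma image_module:
  assumes R: "profinite_ring R" and M: "profinite_module R M" and N: "profinite_module R N"
    and f: "f \<in> cont_hom R M N"
  shows "profinite_module R (N\<lparr>carrier := f ` carrier M, mtop := subtopology (mtop N) (f ` carrier M)\<rparr>)"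
    (is "profinite_module R ?K")
proof -
  interpret R: profinite_ring R by fact
  interpret M: module R M by (rule profinite_moduleD[OF M])
  interpret N: module R N by (rule profinite_moduleD[OF N])
  note F = cont_homD[OF f] and Mt = profinite_moduleD[OF M] and Nt = profinite_moduleD[OF N]
  let ?S = "f ` carrier M"
  have S: "?S \<subseteq> carrier N" using F by auto
  have sadd: "x \<oplus>\<^bsub>N\<^esub> y \<in> ?S" if "x \<in> ?S" "y \<in> ?S" for x y
    using that F(4) by (auto simp: image_iff) (metis M.M.a_closed)
  have ssm: "a \<odot>\<^bsub>N\<^esub> y \<in> ?S" if "a \<in> carrier R" "y \<in> ?S" for a y
    using that F(5) by (auto simp: image_iff) (metis M.smult_closed)
  have s0: "\<zero>\<^bsub>N\<^esub> \<in> ?S" using module_hom_zero[OF Mt(1) Nt(1) f] M.M.zero_closed by force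
  have ab: "abelian_group ?K"
  proof (rule abelian_groupI)
    \<comment> \<open>Negatives are multiples by minus one, so closure of the image under scalars
      suffices.\<close>
    fix x assume x: "x \<in> carrier ?K"
    then have "(\<ominus>\<^bsub>R\<^esub> \<one>\<^bsub>R\<^esub>) \<odot>\<^bsub>N\<^esub> x \<in> ?S" by (intro ssm) auto
    then show "\<exists>y\<in>carrier ?K. y \<oplus>\<^bsub>?K\<^esub> x = \<zero>\<^bsub>?K\<^esub>"
      using x S by (intro bexI[of _ "(\<ominus>\<^bsub>R\<^esub> \<one>\<^bsub>R\<^esub>) \<odot>\<^bsub>N\<^esub> x"]) (auto simp: N.smult_l_minus N.M.l_neg subset_iff)
  qed (use S in \<open>auto simp: sadd s0 subset_iff intro: N.M.a_ac\<close>)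
  have mod: "module R ?K"
    by (rule moduleI)
       (use ab R.cring S in \<open>auto simp: ssm sadd subset_iff N.smult_l_distr N.smult_r_distr N.smult_assoc1\<close>)
  have cK: "continuous_map (subtopology (mtop N) ?S) (mtop N) (\<lambda>x. x)"
    by (simp add: continuous_map_from_subtopology)
  have c1: "continuous_map (prod_topology (mtop ?K) (mtop ?K)) (mtop N) (\<lambda>z. fst z \<oplus>\<^bsub>N\<^esub> snd z)"
    by (rule R.continuous_add[OF N]; rule continuous_map_compose[OF _ cK, unfolded o_def])
       (auto simp: continuous_map_fst continuous_map_snd)
  have c2: "continuous_map (prod_topology (rtop R) (mtop ?K)) (mtop N) (\<lambda>z. fst z \<odot>\<^bsub>N\<^esub> snd z)"
    by (rule R.continuous_smult[OF N], rule continuous_map_fst, rule continuous_map_compose[OF _ cK, unfolded o_def])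
       (auto simp: continuous_map_snd)
  show ?thesis
    unfolding profinite_module_def
  proof (intro conjI mod)
    show ts: "topspace (mtop ?K) = carrier ?K" using S by (auto simp: Nt)
    have "compactin (mtop M) (carrier M)" using Mt(3) unfolding compact_space_def Mt by simp
    then have "compactin (mtop N) ?S" by (rule image_compactin[OF _ F(2)])
    then show "compact_space (mtop ?K)" using compact_space_subtopology by simp
    show "Hausdorff_space (mtop ?K)" using Nt by (simp add: Hausdorff_space_subtopology)
    show "totally_disconnected_space (mtop ?K)" using Nt by (simp add: totally_disconnected_space_subtopology)
    show "continuous_map (prod_topology (mtop ?K) (mtop ?K)) (mtop ?K) (\<lambda>(x, y). x \<oplus>\<^bsub>?K\<^esub> y)"
      using c1 S sadd by (auto simp: continuous_map_in_subtopology case_prod_unfold Nt)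
    show "continuous_map (prod_topology (rtop R) (mtop ?K)) (mtop ?K) (\<lambda>(a, x). a \<odot>\<^bsub>?K\<^esub> x)"
      using c2 S ssm by (auto simp: continuous_map_in_subtopology case_prod_unfold Nt)
  qed
qed

text \<open>Corestricting \<open>f\<close> and \<open>g\<close> to the image of \<open>f\<close>
  gives a surjection, to which the definition of projectivity applies. Combined with exactness, it
  lifts a map landing in a kernel along the next differential.\<close>

lemma projective_lift:
  fixes M N :: "('r, 'u) topmod"
  assumes R: "profinite_ring R" and P: "profinite_projective TYPE('u) R P"
    and M: "profinite_module R M" and N: "profinite_module R N"
    and f: "f \<in> cont_hom R M N" and g: "g \<in> cont_hom R P N"
    and im: "g ` carrier P \<subseteq> f ` carrier M"
  obtains h where "h \<in> cont_hom R P M" "\<And>x. x \<in> carrier P \<Longrightarrow> f (h x) = g x"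
proof -
  let ?K = "N\<lparr>carrier := f ` carrier M, mtop := subtopology (mtop N) (f ` carrier M)\<rparr>"
  have K: "profinite_module R ?K" by (rule image_module[OF R M N f])
  note F = cont_homD[OF f] and G = cont_homD[OF g]
  have Pp: "profinite_module R P" using P unfolding profinite_projective_def by blast
  have f': "f \<in> cont_hom R M ?K"
    using F by (intro cont_homI) (auto simp: continuous_map_in_subtopology profinite_moduleD[OF M])
  have g': "g \<in> cont_hom R P ?K"
    using G im by (intro cont_homI) (auto simp: continuous_map_in_subtopology profinite_moduleD[OF Pp])
  have "f ` carrier M = carrier ?K" by simp
  then have "\<exists>h\<in>cont_hom R P M. \<forall>x\<in>carrier P. f (h x) = g x"
    using P M K f' g' unfolding profinite_projective_def by blast
  then show ?thesis using that by blast
qed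

section \<open>Ext from a resolution by a non-zero-divisor\<close>

text \<open>For targets outside \<open>'u\<close> the problem is conjugated by the injections
  \<open>j\<close> and \<open>k\<close>: the lift is found between the copies and carried back. The
  ring and the module \<open>A\<close> that it resolves are such targets.\<close>

lemma projective_lift_transport:
  fixes M :: "('r, 'a) topmod" and N :: "('r, 'b) topmod" and j :: "'a \<Rightarrow> 'u" and k :: "'b \<Rightarrow> 'u"
  assumes R: "profinite_ring R" and P: "profinite_projective TYPE('u) R P"
    and M: "profinite_module R M" "inj_on j (carrier M)"
    and N: "profinite_module R N" "inj_on k (carrier N)"
    and f: "f \<in> cont_hom R M N" and g: "g \<in> cont_hom R P N"
    and im: "g ` carrier P \<subseteq> f ` carrier M"
  obtains h where "h \<in> cont_hom R P M" "\<And>x. x \<in> carrier P \<Longrightarrow> f (h x) = g x"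
proof -
  interpret R: profinite_ring R by fact
  let ?M = "transport_module j M" and ?N = "transport_module k N"
  note TM = transport_module[OF R M] and TN = transport_module[OF R N]
  have Pp: "profinite_module R P" using P unfolding profinite_projective_def by blast
  have cM: "carrier ?M = j ` carrier M" by (simp add: transport_module_def Let_def)
  note F = cont_homD[OF f] and G = cont_homD[OF g]
  define i where "i = restrict (inv_into (carrier M) j) (j ` carrier M)"
  have ij: "i (j x) = x" if "x \<in> carrier M" for x using that M(2) by (simp add: i_def)
  define f' where "f' = (\<lambda>x\<in>carrier ?M. restrict k (carrier N) ((\<lambda>x\<in>carrier ?M. f (i x)) x))"
  have f': "f' \<in> cont_hom R ?M ?N"
    using R.cont_hom_comp[OF TM(1) R.cont_hom_comp[OF TM(1) TM(3) f] TN(2)]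
    by (simp only: f'_def i_def)
  define g' where "g' = (\<lambda>x\<in>carrier P. restrict k (carrier N) (g x))"
  have g': "g' \<in> cont_hom R P ?N"
    using R.cont_hom_comp[OF Pp g TN(2)] by (simp only: g'_def)
  have f'j: "f' (j x) = k (f x)" if "x \<in> carrier M" for x
    using that F by (simp add: f'_def cM ij)
  have "g' ` carrier P \<subseteq> f' ` carrier ?M"
  proof safe
    fix x assume x: "x \<in> carrier P"
    then obtain y where y: "y \<in> carrier M" "g x = f y" using im by blast
    have "g' x = f' (j y)" using f'j[OF y(1)] y x G F by (simp add: g'_def)
    then show "g' x \<in> f' ` carrier ?M" using y by (auto simp: cM)
  qed
  then obtain h where h: "h \<in> cont_hom R P ?M" "\<And>x. x \<in> carrier P \<Longrightarrow> f' (h x) = g' x"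
    using projective_lift[OF R P TM(1) TN(1) f' g'] by metis
  have "(\<lambda>x\<in>carrier P. i (h x)) \<in> cont_hom R P M"
    using R.cont_hom_comp[OF Pp h(1) TM(3)] by (simp add: i_def)
  moreover have "f (i (h x)) = g x" if x: "x \<in> carrier P" for x
  proof -
    obtain y where y: "y \<in> carrier M" "h x = j y" using cont_homD(3)[OF h(1) x] unfolding cM by blast
    \<comment> \<open>The lifting equation is known between the copies; injectivity of
      \<open>k\<close> brings it back to \<open>N\<close>.\<close>
    have "k (f y) = k (g x)" using h(2)[OF x] f'j y x G by (simp add: g'_def)
    then show ?thesis using inj_onD[OF N(2)] F(3) G(3) x y by (simp add: ij)
  qed
  ultimately show ?thesis using that[of "\<lambda>x\<in>carrier P. i (h x)"] by simp
qed

text \<open>The first isomorphism theorem, with \<open>coset\<close> in the role of the statement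
  that \<open>B\<close> is the kernel: once the cosets are the fibres of \<open>\<Phi>\<close>, it
  descends to a bijection.\<close>

lemma quotient_module_iso:
  assumes add: "\<And>x y. x \<in> carrier Z \<Longrightarrow> y \<in> carrier Z \<Longrightarrow> \<Phi> (x \<oplus>\<^bsub>Z\<^esub> y) = \<Phi> x \<oplus>\<^bsub>T\<^esub> \<Phi> y"
    and smult: "\<And>a x. a \<in> carrier S \<Longrightarrow> x \<in> carrier Z \<Longrightarrow> \<phi> a \<odot>\<^bsub>Z\<^esub> x \<in> carrier Z"
      "\<And>a x. a \<in> carrier S \<Longrightarrow> x \<in> carrier Z \<Longrightarrow> \<Phi> (\<phi> a \<odot>\<^bsub>Z\<^esub> x) = a \<odot>\<^bsub>T\<^esub> \<Phi> x"
    and surj: "\<Phi> ` carrier Z = carrier T"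
    and coset: "\<And>y. y \<in> carrier Z \<Longrightarrow> B +>\<^bsub>Z\<^esub> y = {x \<in> carrier Z. \<Phi> x = \<Phi> y}"
  shows "module_iso S (restrict_scalars \<phi> (quotient_module Z B)) T"
proof -
  \<comment> \<open>\<open>\<Phi>\<close> is constant on each coset, so its image there is a
    singleton.\<close>
  define h where "h X = the_elem (\<Phi> ` X)" for X
  have carr: "carrier (quotient_module Z B) = (\<lambda>y. {x \<in> carrier Z. \<Phi> x = \<Phi> y}) ` carrier Z"
    using coset by (auto simp: quotient_module_def A_RCOSETS_def RCOSETS_def a_r_coset_def)
  have hI: "h X = c" if "X \<noteq> {}" "\<And>x. x \<in> X \<Longrightarrow> \<Phi> x = c" for X c
  proof -
    have "\<Phi> ` X = {c}" using that by blast
    then show ?thesis by (simp add: h_def)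
  qed
  have h: "h {x \<in> carrier Z. \<Phi> x = \<Phi> y} = \<Phi> y" if "y \<in> carrier Z" for y
    by (rule hI) (use that in auto)
  show ?thesis
    unfolding module_iso_def
  proof (intro exI[of _ h] conjI ballI)
    show "bij_betw h (carrier (restrict_scalars \<phi> (quotient_module Z B))) (carrier T)"
      unfolding bij_betw_def
    proof
      show "inj_on h (carrier (restrict_scalars \<phi> (quotient_module Z B)))"
        by (auto simp: restrict_scalars_def carr inj_on_def h)
      show "h ` carrier (restrict_scalars \<phi> (quotient_module Z B)) = carrier T"
        unfolding surj[symmetric] restrict_scalars_def carr by (auto simp: h image_image)
    qed
  next
    fix X Y assume "X \<in> carrier (restrict_scalars \<phi> (quotient_module Z B))"
      "Y \<in> carrier (restrict_scalars \<phi> (quotient_module Z B))"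
    then obtain x y where xy: "x \<in> carrier Z" "y \<in> carrier Z"
      "X = {z \<in> carrier Z. \<Phi> z = \<Phi> x}" "Y = {z \<in> carrier Z. \<Phi> z = \<Phi> y}"
      by (auto simp: restrict_scalars_def carr)
    have "h (X <+>\<^bsub>Z\<^esub> Y) = \<Phi> x \<oplus>\<^bsub>T\<^esub> \<Phi> y"
    proof (rule hI)
      show "X <+>\<^bsub>Z\<^esub> Y \<noteq> {}" using xy by (auto simp: set_add_def set_mult_def)
    qed (use xy in \<open>auto simp: set_add_def set_mult_def add\<close>)
    then show "h (X \<oplus>\<^bsub>restrict_scalars \<phi> (quotient_module Z B)\<^esub> Y) = h X \<oplus>\<^bsub>T\<^esub> h Y"
      using xy by (simp add: h restrict_scalars_def quotient_module_def)
  next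
    fix a X assume a: "a \<in> carrier S" and "X \<in> carrier (restrict_scalars \<phi> (quotient_module Z B))"
    then obtain x where x: "x \<in> carrier Z" "X = {z \<in> carrier Z. \<Phi> z = \<Phi> x}"
      by (auto simp: restrict_scalars_def carr)
    \<comment> \<open>A scalar acts on a coset by the union of the cosets of all products, and these
      products lie in a single fibre.\<close>
    have "h (\<Union>x\<in>X. B +>\<^bsub>Z\<^esub> (\<phi> a \<odot>\<^bsub>Z\<^esub> x)) = a \<odot>\<^bsub>T\<^esub> \<Phi> x"
    proof (rule hI)
      have "\<phi> a \<odot>\<^bsub>Z\<^esub> x \<in> (\<Union>x\<in>X. B +>\<^bsub>Z\<^esub> (\<phi> a \<odot>\<^bsub>Z\<^esub> x))"
        using x a by (auto simp: coset smult)
      then show "(\<Union>x\<in>X. B +>\<^bsub>Z\<^esub> (\<phi> a \<odot>\<^bsub>Z\<^esub> x)) \<noteq> {}" by blast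
    qed (use x a in \<open>auto simp: coset smult split: if_splits\<close>)
    then show "h (a \<odot>\<^bsub>restrict_scalars \<phi> (quotient_module Z B)\<^esub> X) = a \<odot>\<^bsub>T\<^esub> h X"
      using x by (simp add: h restrict_scalars_def quotient_module_def)
  qed
qed

section \<open>Resolutions of length one\<close>

locale cyclic_resolution = profinite_ring R for R :: "'r topring" +
  fixes \<gamma> :: 'r and A :: "('r, 'a) topmod" and q :: "'r \<Rightarrow> 'a"
  assumes A: "profinite_module R A"
    and gamma [simp]: "\<gamma> \<in> carrier R"
    and gamma_inj: "\<And>x. x \<in> carrier R \<Longrightarrow> \<gamma> \<otimes>\<^bsub>R\<^esub> x = \<zero>\<^bsub>R\<^esub> \<Longrightarrow> x = \<zero>\<^bsub>R\<^esub>"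
    and q: "q \<in> cont_hom R (ring_as_topmod R) A"
    and q_surj: "q ` carrier R = carrier A"
    and q_ker: "\<And>x. x \<in> carrier R \<Longrightarrow> q x = \<zero>\<^bsub>A\<^esub> \<longleftrightarrow> (\<exists>y\<in>carrier R. x = \<gamma> \<otimes>\<^bsub>R\<^esub> y)"
begin

lemma gamma_hom: "(\<lambda>x\<in>carrier R. \<gamma> \<otimes>\<^bsub>R\<^esub> x) \<in> cont_hom R (ring_as_topmod R) (ring_as_topmod R)"
  using cont_hom_smult_const[OF profinite profinite cont_hom_id[OF profinite] gamma]
  by (simp cong: restrict_cong)

text \<open>The short resolution is padded by zero modules from degree two on, since
  \<open>projective_resolution\<close> is indexed by all natural numbers.\<close>

lemma resolution_exists:
  "\<exists>(Q :: nat \<Rightarrow> ('r, 'r) topmod) \<delta> \<eta>. projective_resolution TYPE('u) R A Q \<delta> \<eta>"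
proof -
  let ?L = "ring_as_topmod R"
  let ?o = "\<lambda>x\<in>carrier R. \<zero>\<^bsub>R\<^esub>"
  \<comment> \<open>The zero module, obtained as the image of the zero endomorphism so that its
    profiniteness comes from \<open>image_module\<close>.\<close>
  define Z where "Z = ?L\<lparr>carrier := {\<zero>\<^bsub>R\<^esub>}, mtop := subtopology (rtop R) {\<zero>\<^bsub>R\<^esub>}\<rparr>"
  have o: "?o \<in> cont_hom R ?L ?L" using cont_hom_zero[OF profinite profinite] by simp
  have "?o ` carrier R = {\<zero>\<^bsub>R\<^esub>}" by auto
  then have Z: "profinite_module R Z"
    using image_module[OF profinite_ring_axioms profinite profinite o] by (simp add: Z_def)
  have Zs: "carrier Z = {\<zero>\<^bsub>R\<^esub>}" "zero Z = \<zero>\<^bsub>R\<^esub>" by (simp_all add: Z_def)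
  have ZP: "profinite_projective TYPE('u) R Z"
    unfolding profinite_projective_def
  proof (intro conjI allI impI Z, elim conjE)
    fix M N :: "('r, 'u) topmod" and f g
    assume M: "profinite_module R M" and N: "profinite_module R N" and f: "f \<in> cont_hom R M N"
      and g: "g \<in> cont_hom R Z N"
    note m = profinite_moduleD(1)
    show "\<exists>h\<in>cont_hom R Z M. \<forall>x\<in>carrier Z. f (h x) = g x"
      by (rule bexI[OF _ cont_hom_zero[OF Z M]])
         (use module_hom_zero[OF m[OF M] m[OF N] f] module_hom_zero[OF m[OF Z] m[OF N] g]
          in \<open>simp add: Zs\<close>)
  qed
  define Q where "Q n = (if n \<le> 1 then ?L else Z)" for n :: nat
  define \<delta> where "\<delta> n = (if n = 0 then (\<lambda>x\<in>carrier R. \<gamma> \<otimes>\<^bsub>R\<^esub> x)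
    else (\<lambda>x\<in>carrier (Q (Suc n)). \<zero>\<^bsub>Q n\<^esub>))" for n :: nat
  have Qp: "profinite_projective TYPE('u) R (Q n)" for n
    using ZP projective_ring[where 'u = 'u] by (simp add: Q_def)
  then have Qm: "profinite_module R (Q n)" for n unfolding profinite_projective_def by blast
  have "\<delta> n \<in> cont_hom R (Q (Suc n)) (Q n)" for n
    using cont_hom_zero[OF Qm[of "Suc n"] Qm[of n]] gamma_hom by (cases "n = 0") (simp_all add: \<delta>_def, simp add: Q_def)
  moreover have "\<delta> 0 ` carrier (Q 1) = a_kernel (Q 0) A q"
    by (auto simp: \<delta>_def Q_def a_kernel_def' q_ker)
  moreover have "\<delta> (Suc n) ` carrier (Q (Suc (Suc n))) = a_kernel (Q (Suc n)) (Q n) (\<delta> n)" for n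
  proof (cases n)
    case 0
    \<comment> \<open>The module in degree two being zero, exactness in degree one is the regularity
      of \<open>\<gamma>\<close>.\<close>
    have "{x \<in> carrier R. \<gamma> \<otimes>\<^bsub>R\<^esub> x = \<zero>\<^bsub>R\<^esub>} = {\<zero>\<^bsub>R\<^esub>}"
      using gamma_inj by (intro equalityI subsetI) auto
    then show ?thesis by (simp add: 0 \<delta>_def Q_def a_kernel_def' Zs cong: conj_cong)
  qed (auto simp: \<delta>_def Q_def a_kernel_def' Zs)
  ultimately have "projective_resolution TYPE('u) R A Q \<delta> q"
    unfolding projective_resolution_def using A Qp q q_surj by (simp add: Q_def)
  then show ?thesis by blast
qed

end

section \<open>Comparison of an arbitrary projective resolution with the short one\<close>

locale ext_computation = cyclic_resolution R \<gamma> A q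
  for R :: "'r topring" and \<gamma> and A :: "('r, 'a) topmod" and q +
  fixes P :: "nat \<Rightarrow> ('r, 'u) topmod" and d \<epsilon> and B :: "('r, 'b) topmod" and \<iota> :: "'r \<Rightarrow> 'u"
  assumes res: "projective_resolution TYPE('u) R A P d \<epsilon>"
    and B: "profinite_module R B"
    and \<iota>: "inj_on \<iota> (carrier R)"
begin

lemma PP: "profinite_projective TYPE('u) R (P n)"
  and P: "profinite_module R (P n)"
  and d: "d n \<in> cont_hom R (P (Suc n)) (P n)"
  and eps: "\<epsilon> \<in> cont_hom R (P 0) A"
  and eps_surj: "\<epsilon> ` carrier (P 0) = carrier A"
  and exact_0: "d 0 ` carrier (P 1) = {x \<in> carrier (P 0). \<epsilon> x = \<zero>\<^bsub>A\<^esub>}"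
  and exact_Suc: "d (Suc n) ` carrier (P (Suc (Suc n))) = {x \<in> carrier (P (Suc n)). d n x = \<zero>\<^bsub>P n\<^esub>}"
  using res unfolding projective_resolution_def profinite_projective_def a_kernel_def' by auto

sublocale P: module R "P n" for n by (rule profinite_moduleD[OF P])
sublocale B: module R B by (rule profinite_moduleD[OF B])

lemma A_module: "module R A" by (rule profinite_moduleD[OF A])
lemma R_module: "module R (ring_as_topmod R)" by (rule profinite_moduleD[OF profinite])

lemmas d_simps [simp] = cont_homD(3-)[OF d] module_hom_zero[OF P.module_axioms P.module_axioms d]
  cont_hom_mdiff[OF P.module_axioms P.module_axioms d]

lemma d_d: "x \<in> carrier (P (Suc (Suc n))) \<Longrightarrow> d n (d (Suc n) x) = \<zero>\<^bsub>P n\<^esub>"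
  using exact_Suc[of n] by blast

text \<open>\<open>\<iota>\<close> places \<open>R\<close> in the element type of \<open>P\<close>,
  and its quotient \<open>A\<close> follows by choosing preimages under \<open>q\<close>. With both
  copied, projectivity of \<open>P n\<close> can be applied to \<open>q\<close>.\<close>

lemma A_inj: obtains k :: "'a \<Rightarrow> 'u" where "inj_on k (carrier A)"
proof
  show "inj_on (\<iota> \<circ> inv_into (carrier R) q) (carrier A)"
    by (rule comp_inj_on) (auto simp: q_surj intro!: inj_on_inv_into inj_on_subset[OF \<iota>] inv_into_into)
qed

lemma eps_lift:
  obtains \<psi> where "\<psi> \<in> cont_hom R (P 0) (ring_as_topmod R)"
    "\<And>x. x \<in> carrier (P 0) \<Longrightarrow> q (\<psi> x) = \<epsilon> x"
proof -
  obtain k :: "'a \<Rightarrow> 'u" where k: "inj_on k (carrier A)" by (rule A_inj)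
  show ?thesis
    by (rule projective_lift_transport[OF profinite_ring_axioms PP profinite _ A k q eps])
       (use that \<iota> in \<open>auto simp: q_surj eps_surj\<close>)
qed

text \<open>Degree-zero part of a chain map from \<open>P\<close> to the short resolution;
  \<open>D\<close> is the degree-one part. Fixing the choice lets everything later refer to the same
  lift.\<close>

definition "\<psi> = (SOME \<psi>. \<psi> \<in> cont_hom R (P 0) (ring_as_topmod R) \<and>
  (\<forall>x\<in>carrier (P 0). q (\<psi> x) = \<epsilon> x))"

lemma psi_hom: "\<psi> \<in> cont_hom R (P 0) (ring_as_topmod R)"
  and q_psi: "x \<in> carrier (P 0) \<Longrightarrow> q (\<psi> x) = \<epsilon> x"
proof -
  have "\<exists>\<psi>. \<psi> \<in> cont_hom R (P 0) (ring_as_topmod R) \<and> (\<forall>x\<in>carrier (P 0). q (\<psi> x) = \<epsilon> x)"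
    by (rule eps_lift) blast
  from someI_ex[OF this]
  show "\<psi> \<in> cont_hom R (P 0) (ring_as_topmod R)" "x \<in> carrier (P 0) \<Longrightarrow> q (\<psi> x) = \<epsilon> x"
    unfolding \<psi>_def by blast+
qed

lemmas psi_simps [simp] = cont_homD(3-)[OF psi_hom, simplified]

lemma psi_d: "w \<in> carrier (P 1) \<Longrightarrow> \<exists>y\<in>carrier R. \<psi> (d 0 w) = \<gamma> \<otimes>\<^bsub>R\<^esub> y"
  using q_psi[of "d 0 w"] q_ker[of "\<psi> (d 0 w)"] exact_0 by auto

text \<open>Pointwise a quotient exists because \<open>q\<close> kills
  \<open>\<psi> (d 0 w)\<close>. That it is linear and continuous in \<open>w\<close> comes from
  lifting along multiplication by \<open>\<gamma>\<close>, using projectivity of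
  \<open>P 1\<close>.\<close>

lemma quotient_exists:
  obtains D where "D \<in> cont_hom R (P 1) (ring_as_topmod R)"
    "\<And>w. w \<in> carrier (P 1) \<Longrightarrow> \<gamma> \<otimes>\<^bsub>R\<^esub> D w = \<psi> (d 0 w)"
proof -
  have g: "(\<lambda>w\<in>carrier (P 1). \<psi> (d 0 w)) \<in> cont_hom R (P 1) (ring_as_topmod R)"
    using cont_hom_comp[OF P d[of 0] psi_hom] by simp
  have im: "(\<lambda>w\<in>carrier (P 1). \<psi> (d 0 w)) ` carrier (P 1) \<subseteq>
      (\<lambda>x\<in>carrier R. \<gamma> \<otimes>\<^bsub>R\<^esub> x) ` carrier (ring_as_topmod R)"
    using psi_d by fastforce
  have \<iota>': "inj_on \<iota> (carrier (ring_as_topmod R))" using \<iota> by simp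
  obtain h where h: "h \<in> cont_hom R (P 1) (ring_as_topmod R)"
     "\<And>x. x \<in> carrier (P 1) \<Longrightarrow> (\<lambda>x\<in>carrier R. \<gamma> \<otimes>\<^bsub>R\<^esub> x) (h x) = (\<lambda>w\<in>carrier (P 1). \<psi> (d 0 w)) x"
    by (rule projective_lift_transport[OF profinite_ring_axioms PP profinite \<iota>' profinite \<iota>' gamma_hom g im])
      blast
  show ?thesis using that[OF h(1)] h(2) cont_homD(3)[OF h(1)] by simp
qed

definition "D = (SOME D. D \<in> cont_hom R (P 1) (ring_as_topmod R) \<and>
  (\<forall>w\<in>carrier (P 1). \<gamma> \<otimes>\<^bsub>R\<^esub> D w = \<psi> (d 0 w)))"

lemma D_hom: "D \<in> cont_hom R (P 1) (ring_as_topmod R)"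
  and gamma_D: "w \<in> carrier (P 1) \<Longrightarrow> \<gamma> \<otimes>\<^bsub>R\<^esub> D w = \<psi> (d 0 w)"
proof -
  have "\<exists>D. D \<in> cont_hom R (P 1) (ring_as_topmod R) \<and> (\<forall>w\<in>carrier (P 1). \<gamma> \<otimes>\<^bsub>R\<^esub> D w = \<psi> (d 0 w))"
    by (rule quotient_exists) blast
  from someI_ex[OF this]
  show "D \<in> cont_hom R (P 1) (ring_as_topmod R)" "w \<in> carrier (P 1) \<Longrightarrow> \<gamma> \<otimes>\<^bsub>R\<^esub> D w = \<psi> (d 0 w)"
    unfolding D_def by blast+
qed

lemmas D_simps [simp] = cont_homD(3-)[OF D_hom, simplified]

lemma gamma_cancel:
  assumes "x \<in> carrier R" "y \<in> carrier R" "\<gamma> \<otimes>\<^bsub>R\<^esub> x = \<gamma> \<otimes>\<^bsub>R\<^esub> y" shows "x = y"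
proof -
  have "\<gamma> \<otimes>\<^bsub>R\<^esub> (x \<ominus>\<^bsub>R\<^esub> y) = \<zero>\<^bsub>R\<^esub>" using assms by (simp add: a_minus_def r_distr r_minus r_neg)
  then have "x \<ominus>\<^bsub>R\<^esub> y = \<zero>\<^bsub>R\<^esub>" using gamma_inj assms by simp
  then show ?thesis using assms by simp
qed

text \<open>\<open>e\<close> and \<open>z\<close> are the images of one under a chain map from the
  short resolution back to \<open>P\<close>, in degrees zero and one.\<close>

definition "e = (SOME e. e \<in> carrier (P 0) \<and> \<epsilon> e = q \<one>\<^bsub>R\<^esub>)"

lemma e [simp]: "e \<in> carrier (P 0)" and eps_e: "\<epsilon> e = q \<one>\<^bsub>R\<^esub>"
proof -
  have "q \<one>\<^bsub>R\<^esub> \<in> \<epsilon> ` carrier (P 0)" using eps_surj q_surj by auto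
  then have "\<exists>e. e \<in> carrier (P 0) \<and> \<epsilon> e = q \<one>\<^bsub>R\<^esub>" by auto
  from someI_ex[OF this] show "e \<in> carrier (P 0)" "\<epsilon> e = q \<one>\<^bsub>R\<^esub>" unfolding e_def by blast+
qed

lemma q_eq: "x \<in> carrier R \<Longrightarrow> q x = x \<odot>\<^bsub>A\<^esub> q \<one>\<^bsub>R\<^esub>"
  using cont_homD(5)[OF q, of x "\<one>\<^bsub>R\<^esub>"] by simp

text \<open>\<open>\<psi> e\<close> and one have the same image under \<open>q\<close>. Consequently
  \<open>\<psi> e\<close> acts as the identity on the \<open>\<gamma>\<close>-torsion of a module
  and on its quotient by \<open>\<gamma>\<close>, which is what evaluation at \<open>e\<close> and
  at \<open>z\<close> requires.\<close>

lemma psi_e: "\<exists>y\<in>carrier R. \<psi> e \<ominus>\<^bsub>R\<^esub> \<one>\<^bsub>R\<^esub> = \<gamma> \<otimes>\<^bsub>R\<^esub> y"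
proof -
  interpret L: module R "ring_as_topmod R" by (rule R_module)
  interpret A: module R A by (rule A_module)
  have "q (\<psi> e \<ominus>\<^bsub>R\<^esub> \<one>\<^bsub>R\<^esub>) = \<zero>\<^bsub>A\<^esub>"
    using cont_hom_mdiff[OF R_module A_module q, of "\<psi> e" "\<one>\<^bsub>R\<^esub>"]
      cont_homD(3)[OF q] q_psi[of e] eps_e
    by (simp add: a_minus_def mdiff_def[of R "ring_as_topmod R"])
  then show ?thesis using q_ker by simp
qed

definition "z = (SOME z. z \<in> carrier (P 1) \<and> d 0 z = \<gamma> \<odot>\<^bsub>P 0\<^esub> e)"

lemma z [simp]: "z \<in> carrier (P 1)" "z \<in> carrier (P (Suc 0))" and d_z: "d 0 z = \<gamma> \<odot>\<^bsub>P 0\<^esub> e"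
proof -
  have "\<epsilon> (\<gamma> \<odot>\<^bsub>P 0\<^esub> e) = q (\<gamma> \<otimes>\<^bsub>R\<^esub> \<one>\<^bsub>R\<^esub>)"
    using cont_homD(5)[OF eps] eps_e q_eq[of \<gamma>] by simp
  also have "\<dots> = \<zero>\<^bsub>A\<^esub>" using q_ker[of "\<gamma> \<otimes>\<^bsub>R\<^esub> \<one>\<^bsub>R\<^esub>"] by fastforce
  finally have "\<gamma> \<odot>\<^bsub>P 0\<^esub> e \<in> d 0 ` carrier (P 1)" using exact_0 by simp
  then have "\<exists>z. z \<in> carrier (P 1) \<and> d 0 z = \<gamma> \<odot>\<^bsub>P 0\<^esub> e" by auto
  from someI_ex[OF this] show "z \<in> carrier (P 1)" "z \<in> carrier (P (Suc 0))" "d 0 z = \<gamma> \<odot>\<^bsub>P 0\<^esub> e"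
    unfolding z_def by auto
qed

text \<open>Both chain maps respect the differentials: after multiplication by
  \<open>\<gamma>\<close> both sides become \<open>\<psi> (d 0 z)\<close>.\<close>

lemma D_z: "D z = \<psi> e"
proof (rule gamma_cancel)
  show "\<gamma> \<otimes>\<^bsub>R\<^esub> D z = \<gamma> \<otimes>\<^bsub>R\<^esub> \<psi> e" by (simp only: gamma_D z d_z) simp
qed auto

text \<open>\<open>x - \<psi>(x) e\<close> lies in the kernel of \<open>\<epsilon>\<close>, so it lifts along \<open>d 0\<close>.\<close>

lemma alpha_exists:
  obtains a where "a \<in> cont_hom R (P 0) (P 1)"
    "\<And>x. x \<in> carrier (P 0) \<Longrightarrow> d 0 (a x) = mdiff R (P 0) x (\<psi> x \<odot>\<^bsub>P 0\<^esub> e)"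
proof -
  interpret A: module R A by (rule A_module)
  let ?g = "\<lambda>x\<in>carrier (P 0). mdiff R (P 0) x (\<psi> x \<odot>\<^bsub>P 0\<^esub> e)"
  have g: "?g \<in> cont_hom R (P 0) (P 0)"
    using cont_hom_mdiff_fun[OF P P cont_hom_id[OF P] cont_hom_smult_elem[OF P P psi_hom e]]
    by (simp cong: restrict_cong)
  have "\<epsilon> (mdiff R (P 0) x (\<psi> x \<odot>\<^bsub>P 0\<^esub> e)) = \<zero>\<^bsub>A\<^esub>" if x: "x \<in> carrier (P 0)" for x
    using x cont_hom_mdiff[OF P.module_axioms A_module eps] cont_homD(3-)[OF eps] eps_e
      q_eq[of "\<psi> x"] q_psi[OF x] cont_homD(3)[OF q, of "\<one>\<^bsub>R\<^esub>"] by simp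
  then have "?g ` carrier (P 0) \<subseteq> d 0 ` carrier (P 1)" using exact_0 by auto
  then have im: "?g ` carrier (P 0) \<subseteq> d 0 ` carrier (P (Suc 0))" by simp
  obtain a where "a \<in> cont_hom R (P 0) (P (Suc 0))" "\<And>x. x \<in> carrier (P 0) \<Longrightarrow> d 0 (a x) = ?g x"
    by (rule projective_lift[OF profinite_ring_axioms PP P P d g im]) blast
  then show ?thesis using that[of a] by simp
qed

text \<open>Degree-zero part of a homotopy between the identity of \<open>P\<close> and the round
  trip through the short resolution.\<close>

definition "\<alpha> = (SOME a. a \<in> cont_hom R (P 0) (P 1) \<and>
  (\<forall>x\<in>carrier (P 0). d 0 (a x) = mdiff R (P 0) x (\<psi> x \<odot>\<^bsub>P 0\<^esub> e)))"

lemma alpha_hom: "\<alpha> \<in> cont_hom R (P 0) (P 1)"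
  and d_alpha: "x \<in> carrier (P 0) \<Longrightarrow> d 0 (\<alpha> x) = mdiff R (P 0) x (\<psi> x \<odot>\<^bsub>P 0\<^esub> e)"
proof -
  have "\<exists>a. a \<in> cont_hom R (P 0) (P 1) \<and>
      (\<forall>x\<in>carrier (P 0). d 0 (a x) = mdiff R (P 0) x (\<psi> x \<odot>\<^bsub>P 0\<^esub> e))"
    by (rule alpha_exists) blast
  from someI_ex[OF this]
  show "\<alpha> \<in> cont_hom R (P 0) (P 1)" 
    "x \<in> carrier (P 0) \<Longrightarrow> d 0 (\<alpha> x) = mdiff R (P 0) x (\<psi> x \<odot>\<^bsub>P 0\<^esub> e)"
    unfolding \<alpha>_def by blast+
qed

lemmas alpha_simps [simp] = cont_homD(3-)[OF alpha_hom] cont_homD(3)[OF alpha_hom, simplified]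

text \<open>\<open>x \<mapsto> \<alpha>(x) + (\<psi>(x) / \<gamma>) z\<close> is a section of \<open>d 0\<close> over the kernel of \<open>\<epsilon>\<close>.\<close>

lemma d_section:
  assumes "w \<in> carrier (P 1)"
  shows "d 0 (\<alpha> (d 0 w) \<oplus>\<^bsub>P 1\<^esub> D w \<odot>\<^bsub>P 1\<^esub> z) = d 0 w"
proof -
  have "d 0 (D w \<odot>\<^bsub>P 1\<^esub> z) = \<psi> (d 0 w) \<odot>\<^bsub>P 0\<^esub> e"
    using assms by (simp add: d_z P.smult_assoc1[symmetric] gamma_D[symmetric] m_comm)
  then show ?thesis using assms by (simp add: d_alpha)
qed

text \<open>The kernel of every differential is a direct summand, reflecting that \<open>A\<close>
  has projective dimension at most one. Subtracting from \<open>w\<close> a section applied to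
  \<open>d n w\<close> projects onto the kernel; for n = 0 the section is that of
  \<open>d_section\<close>, afterwards it is a lift of the previous projection along the next
  differential.\<close>

lemma retraction:
  "\<exists>r\<in>cont_hom R (P (Suc n)) (P (Suc n)).
     (\<forall>w\<in>carrier (P (Suc n)). d n (r w) = \<zero>\<^bsub>P n\<^esub>) \<and>
     (\<forall>w\<in>carrier (P (Suc n)). d n w = \<zero>\<^bsub>P n\<^esub> \<longrightarrow> r w = w)"
proof (induction n)
  case 0
  let ?s = "\<lambda>w\<in>carrier (P 1). (\<lambda>w\<in>carrier (P 1). \<alpha> (d 0 w)) w \<oplus>\<^bsub>P 1\<^esub> (\<lambda>w\<in>carrier (P 1). D w \<odot>\<^bsub>P 1\<^esub> z) w"
  have s: "?s \<in> cont_hom R (P 1) (P 1)"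
    by (intro cont_hom_add[OF P P] cont_hom_comp[OF P _ alpha_hom] cont_hom_smult_elem[OF P P D_hom])
       (use d[of 0] in auto)
  let ?r = "\<lambda>w\<in>carrier (P 1). mdiff R (P 1) ((\<lambda>w\<in>carrier (P 1). w) w) (?s w)"
  have r: "?r \<in> cont_hom R (P 1) (P 1)"
    by (intro cont_hom_mdiff_fun[OF P P] cont_hom_id[OF P] s)
  have 1: "d 0 (?r w) = \<zero>\<^bsub>P 0\<^esub>" if w: "w \<in> carrier (P 1)" for w
  proof -
    have "d 0 (?r w) = mdiff R (P 0) (d 0 w) (d 0 (\<alpha> (d 0 w) \<oplus>\<^bsub>P 1\<^esub> D w \<odot>\<^bsub>P 1\<^esub> z))"
      using w by (simp del: d_simps(2))
    also have "\<dots> = \<zero>\<^bsub>P 0\<^esub>" unfolding d_section[OF w] using w by simp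
    finally show ?thesis .
  qed
  have 2: "?r w = w" if w: "w \<in> carrier (P 1)" "d 0 w = \<zero>\<^bsub>P 0\<^esub>" for w
  proof -
    have p0: "\<psi> \<zero>\<^bsub>P 0\<^esub> = \<zero>\<^bsub>R\<^esub>" using module_hom_zero[OF P.module_axioms R_module psi_hom] by simp
    \<comment> \<open>\<open>\<gamma>\<close> times \<open>D w\<close> is \<open>\<psi>\<close> of
      zero, so \<open>D w\<close> vanishes and the correction term disappears on the kernel.\<close>
    have "D w = \<zero>\<^bsub>R\<^esub>" using w gamma_D[OF w(1)] p0 by (auto intro: gamma_inj[of "D w"])
    moreover have "\<alpha> \<zero>\<^bsub>P 0\<^esub> = \<zero>\<^bsub>P 1\<^esub>" by (rule module_hom_zero[OF P.module_axioms P.module_axioms alpha_hom])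
    ultimately show ?thesis using w by simp
  qed
  show ?case by (intro bexI[of _ ?r]) (use r 1 2 in auto)
next
  case (Suc n)
  then obtain r where r: "r \<in> cont_hom R (P (Suc n)) (P (Suc n))"
    "\<And>w. w \<in> carrier (P (Suc n)) \<Longrightarrow> d n (r w) = \<zero>\<^bsub>P n\<^esub>"
    "\<And>w. w \<in> carrier (P (Suc n)) \<Longrightarrow> d n w = \<zero>\<^bsub>P n\<^esub> \<Longrightarrow> r w = w" by blast
  note rr = cont_homD[OF r(1)]
  have "r ` carrier (P (Suc n)) \<subseteq> d (Suc n) ` carrier (P (Suc (Suc n)))"
    using r rr unfolding exact_Suc by auto
  \<comment> \<open>\<open>r\<close> has values in the kernel of \<open>d n\<close>, which is the
    image of \<open>d (Suc n)\<close>, so it lifts.\<close>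
  then obtain a where a: "a \<in> cont_hom R (P (Suc n)) (P (Suc (Suc n)))"
    "\<And>x. x \<in> carrier (P (Suc n)) \<Longrightarrow> d (Suc n) (a x) = r x"
    by (rule projective_lift[OF profinite_ring_axioms PP P P d r(1)]) blast
  note aa = cont_homD[OF a(1)]
  let ?P = "P (Suc (Suc n))"
  let ?r = "\<lambda>w\<in>carrier ?P. mdiff R ?P ((\<lambda>w\<in>carrier ?P. w) w) ((\<lambda>w\<in>carrier ?P. a (d (Suc n) w)) w)"
  have r': "?r \<in> cont_hom R ?P ?P"
    by (intro cont_hom_mdiff_fun[OF P P] cont_hom_id[OF P] cont_hom_comp[OF P d a(1)])
  have 1: "d (Suc n) (?r w) = \<zero>\<^bsub>P (Suc n)\<^esub>" if w: "w \<in> carrier ?P" for w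
    using w aa by (simp add: a r d_d)
  have 2: "?r w = w" if w: "w \<in> carrier ?P" "d (Suc n) w = \<zero>\<^bsub>P (Suc n)\<^esub>" for w
    using w module_hom_zero[OF P.module_axioms P.module_axioms a(1)] by simp
  show ?case by (intro bexI[of _ ?r]) (use r' 1 2 in auto)
qed

section \<open>Cocycles, coboundaries and the value of Ext\<close>

lemma cocycles_iff:
  "f \<in> ext_cocycles R P d B s \<longleftrightarrow>
    f \<in> cont_hom R (P s) B \<and> (\<forall>x\<in>carrier (P (Suc s)). f (d s x) = \<zero>\<^bsub>B\<^esub>)"
  unfolding ext_cocycles_def a_kernel_def' hom_module_def precomp_def
  by (auto simp: restrict_def fun_eq_iff)

text \<open>The difference between \<open>w\<close> and its section value is killed by
  \<open>d 0\<close>, hence is a boundary and is killed by \<open>f\<close>. A 1-cocycle is thus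
  governed by its value at \<open>z\<close> and its composite with \<open>\<alpha>\<close>.\<close>

lemma cocycle_section:
  assumes "f \<in> ext_cocycles R P d B 1" "w \<in> carrier (P 1)"
  shows "f w = f (\<alpha> (d 0 w)) \<oplus>\<^bsub>B\<^esub> D w \<odot>\<^bsub>B\<^esub> f z"
proof -
  have f: "f \<in> cont_hom R (P 1) B" "\<And>x. x \<in> carrier (P 2) \<Longrightarrow> f (d 1 x) = \<zero>\<^bsub>B\<^esub>"
    using assms by (auto simp: cocycles_iff numeral_2_eq_2)
  note ff = cont_homD[OF f(1)]
  let ?y = "\<alpha> (d 0 w) \<oplus>\<^bsub>P 1\<^esub> D w \<odot>\<^bsub>P 1\<^esub> z"
  have y: "?y \<in> carrier (P 1)" using assms by simp
  have "d 0 (mdiff R (P 1) w ?y) = mdiff R (P 0) (d 0 w) (d 0 ?y)"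
    using cont_hom_mdiff[OF P.module_axioms P.module_axioms d, of w 0 ?y] assms y by simp
  then have "mdiff R (P 1) w ?y \<in> d 1 ` carrier (P 2)"
    using exact_Suc[of 0] assms y d_section[OF assms(2)] by (simp add: numeral_2_eq_2)
  then have "f (mdiff R (P 1) w ?y) = \<zero>\<^bsub>B\<^esub>" using f(2) by auto
  then have "mdiff R B (f w) (f ?y) = \<zero>\<^bsub>B\<^esub>"
    using cont_hom_mdiff[OF P.module_axioms B.module_axioms f(1) assms(2) y] by simp
  then have "f w = f ?y"
    using B.mdiff_eq_zero_iff[OF ff(3)[OF assms(2)] ff(3)[OF y]] by simp
  then show ?thesis using ff assms by simp
qed

text \<open>\<open>x\<close> differs from \<open>\<psi> x\<close> times \<open>e\<close> by the
  boundary \<open>d 0 (\<alpha> x)\<close>, on which a 0-cocycle vanishes.\<close>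

lemma hom_generator:
  assumes f: "f \<in> ext_cocycles R P d B 0" and x: "x \<in> carrier (P 0)"
  shows "f x = \<psi> x \<odot>\<^bsub>B\<^esub> f e"
proof -
  have f: "f \<in> cont_hom R (P 0) B" "\<And>x. x \<in> carrier (P 1) \<Longrightarrow> f (d 0 x) = \<zero>\<^bsub>B\<^esub>"
    using assms by (auto simp: cocycles_iff)
  have "f (mdiff R (P 0) x (\<psi> x \<odot>\<^bsub>P 0\<^esub> e)) = \<zero>\<^bsub>B\<^esub>"
    unfolding d_alpha[OF x, symmetric] using x by (intro f) auto
  then show ?thesis
    using cont_hom_mdiff[OF P.module_axioms B.module_axioms f(1)] x cont_homD(3-)[OF f(1)]
    by (simp add: B.mdiff_eq_zero_iff)
qed

abbreviation "cocycle_module s \<equiv> (hom_module R (P s) B)\<lparr>carrier := ext_cocycles R P d B s\<rparr>"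

lemma cocycle_add:
  assumes "f \<in> ext_cocycles R P d B s" "g \<in> ext_cocycles R P d B s"
  shows "(\<lambda>x\<in>carrier (P s). f x \<oplus>\<^bsub>B\<^esub> g x) \<in> ext_cocycles R P d B s"
  using assms cont_hom_add[OF P B] by (auto simp: cocycles_iff)

lemma cocycle_mdiff:
  assumes "f \<in> ext_cocycles R P d B s" "g \<in> ext_cocycles R P d B s"
  shows "(\<lambda>x\<in>carrier (P s). mdiff R B (f x) (g x)) \<in> ext_cocycles R P d B s"
  using assms cont_hom_mdiff_fun[OF P B] by (auto simp: cocycles_iff)

lemma cocycle_smult:
  assumes "f \<in> ext_cocycles R P d B s" "a \<in> carrier R"
  shows "(\<lambda>x\<in>carrier (P s). a \<odot>\<^bsub>B\<^esub> f x) \<in> ext_cocycles R P d B s"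
  using assms cont_hom_smult_const[OF P B] by (auto simp: cocycles_iff)

lemma cocycle_mdiff_add:
  assumes "f \<in> ext_cocycles R P d B s" "g \<in> ext_cocycles R P d B s"
  shows "f = (\<lambda>x\<in>carrier (P s). (\<lambda>x\<in>carrier (P s). mdiff R B (f x) (g x)) x \<oplus>\<^bsub>B\<^esub> g x)"
proof -
  have *: "f \<in> cont_hom R (P s) B" "g \<in> cont_hom R (P s) B" using assms by (auto simp: cocycles_iff)
  show ?thesis
    by (rule extensionalityI[OF cont_homD(1)[OF *(1)]])
       (auto simp: cont_homD(3)[OF *(1)] cont_homD(3)[OF *(2)])
qed

text \<open>The isomorphism is evaluation at one element \<open>c\<close>, followed by
  \<open>\<pi>\<close>; below \<open>c\<close> is \<open>e\<close> in degree zero and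
  \<open>z\<close> in degree one. The assumption \<open>ker\<close> says that the fibres are the
  cosets of the coboundaries.\<close>

lemma ext_iso:
  assumes add: "\<And>x y. x \<in> carrier B \<Longrightarrow> y \<in> carrier B \<Longrightarrow> \<pi> (x \<oplus>\<^bsub>B\<^esub> y) = \<pi> x \<oplus>\<^bsub>T\<^esub> \<pi> y"
    and smult: "\<And>a. a \<in> carrier S \<Longrightarrow> \<phi> a \<in> carrier R"
      "\<And>a x. a \<in> carrier S \<Longrightarrow> x \<in> carrier B \<Longrightarrow> \<pi> (\<phi> a \<odot>\<^bsub>B\<^esub> x) = a \<odot>\<^bsub>T\<^esub> \<pi> x"
    and c: "c \<in> carrier (P s)"
    and surj: "(\<lambda>f. \<pi> (f c)) ` ext_cocycles R P d B s = carrier T"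
    and cob: "ext_coboundaries R P d B s \<subseteq> ext_cocycles R P d B s"
    and ker: "\<And>f g. f \<in> ext_cocycles R P d B s \<Longrightarrow> g \<in> ext_cocycles R P d B s \<Longrightarrow> \<pi> (f c) = \<pi> (g c)
       \<longleftrightarrow> (\<lambda>x\<in>carrier (P s). mdiff R B (f x) (g x)) \<in> ext_coboundaries R P d B s"
  shows "module_iso S (restrict_scalars \<phi> (ext R P d B s)) T"
  unfolding ext_def
proof (rule quotient_module_iso[where \<Phi> = "\<lambda>f. \<pi> (f c)"])
  have C: "f c \<in> carrier B" if "f \<in> ext_cocycles R P d B s" for f
    using that c by (auto simp: cocycles_iff cont_homD)
  fix f g assume "f \<in> carrier (cocycle_module s)" "g \<in> carrier (cocycle_module s)"
  then show "\<pi> ((f \<oplus>\<^bsub>cocycle_module s\<^esub> g) c) = \<pi> (f c) \<oplus>\<^bsub>T\<^esub> \<pi> (g c)"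
    using c C by (simp add: hom_module_def add)
next
  have C: "f c \<in> carrier B" if "f \<in> ext_cocycles R P d B s" for f
    using that c by (auto simp: cocycles_iff cont_homD)
  fix a f assume "a \<in> carrier S" "f \<in> carrier (cocycle_module s)"
  then show "\<phi> a \<odot>\<^bsub>cocycle_module s\<^esub> f \<in> carrier (cocycle_module s)"
    "\<pi> ((\<phi> a \<odot>\<^bsub>cocycle_module s\<^esub> f) c) = a \<odot>\<^bsub>T\<^esub> \<pi> (f c)"
    using c C by (simp_all add: hom_module_def smult cocycle_smult[unfolded restrict_def])
      (metis cocycle_smult restrict_def smult(1))
next
  show "(\<lambda>f. \<pi> (f c)) ` carrier (cocycle_module s) = carrier T" using surj by simp
next
  fix g assume "g \<in> carrier (cocycle_module s)"
  then have g: "g \<in> ext_cocycles R P d B s" by simp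
  have C: "f x \<in> carrier B" if "f \<in> ext_cocycles R P d B s" "x \<in> carrier (P s)" for f x
    using that by (auto simp: cocycles_iff cont_homD)
  have E: "f \<in> extensional (carrier (P s))" if "f \<in> ext_cocycles R P d B s" for f
    using that by (auto simp: cocycles_iff cont_homD)
  have "ext_coboundaries R P d B s +>\<^bsub>cocycle_module s\<^esub> g =
      (\<lambda>b. \<lambda>x\<in>carrier (P s). b x \<oplus>\<^bsub>B\<^esub> g x) ` ext_coboundaries R P d B s"
    by (auto simp: a_r_coset_def r_coset_def hom_module_def)
  also have "\<dots> = {f \<in> ext_cocycles R P d B s. \<pi> (f c) = \<pi> (g c)}" (is "?l = ?r")
  proof (intro equalityI subsetI)
    fix f assume "f \<in> ?l"
    then obtain b where b: "b \<in> ext_coboundaries R P d B s" "f = (\<lambda>x\<in>carrier (P s). b x \<oplus>\<^bsub>B\<^esub> g x)"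
      by blast
    then have b': "b \<in> ext_cocycles R P d B s" using cob by blast
    then have f: "f \<in> ext_cocycles R P d B s" using cocycle_add[OF b' g] b by simp
    have "(\<lambda>x\<in>carrier (P s). mdiff R B (f x) (g x)) = b"
      by (rule extensionalityI[OF _ E[OF b']])
         (use b C[OF b'] C[OF g] in \<open>auto simp: B.mdiff_eq a_minus_def B.M.a_assoc B.M.r_neg\<close>)
    then show "f \<in> ?r" using ker[OF f g] b f by simp
  next
    fix f assume f: "f \<in> ?r"
    then have "(\<lambda>x\<in>carrier (P s). mdiff R B (f x) (g x)) \<in> ext_coboundaries R P d B s"
      using ker[of f g] g by simp
    then show "f \<in> ?l"
      using cocycle_mdiff_add[of f s g] f g by (intro image_eqI[where x = "\<lambda>x\<in>carrier (P s). mdiff R B (f x) (g x)"]) auto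
  qed
  finally show "ext_coboundaries R P d B s +>\<^bsub>cocycle_module s\<^esub> g =
      {f \<in> carrier (cocycle_module s). \<pi> (f c) = \<pi> (g c)}" by simp
qed

text \<open>The zero of \<open>quotient_module\<close> is the subgroup divided out, so the point is
  that the only coset is the full set of cocycles.\<close>

lemma ext_trivial:
  assumes "ext_coboundaries R P d B s = ext_cocycles R P d B s"
  shows "carrier (restrict_scalars \<phi> (ext R P d B s)) = {\<zero>\<^bsub>restrict_scalars \<phi> (ext R P d B s)\<^esub>}"
proof -
  let ?Z = "ext_cocycles R P d B s"
  have "?Z +>\<^bsub>cocycle_module s\<^esub> g = ?Z" if g: "g \<in> ?Z" for g
  proof -
    have 1: "?Z +>\<^bsub>cocycle_module s\<^esub> g = (\<lambda>b. \<lambda>x\<in>carrier (P s). b x \<oplus>\<^bsub>B\<^esub> g x) ` ?Z"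
      by (auto simp: a_r_coset_def r_coset_def hom_module_def)
    show ?thesis
      unfolding 1
    proof (intro equalityI subsetI)
      fix f assume "f \<in> ?Z"
      then show "f \<in> (\<lambda>b. \<lambda>x\<in>carrier (P s). b x \<oplus>\<^bsub>B\<^esub> g x) ` ?Z"
        using cocycle_mdiff_add[of f s g] cocycle_mdiff[of f s g] g by (intro image_eqI[where x = "\<lambda>x\<in>carrier (P s). mdiff R B (f x) (g x)"]) auto
    qed (use cocycle_add g in auto)
  qed
  moreover have "(\<lambda>x\<in>carrier (P s). \<zero>\<^bsub>B\<^esub>) \<in> ?Z"
    using cont_hom_zero[OF P B] by (auto simp: cocycles_iff)
  ultimately have "a_rcosets\<^bsub>cocycle_module s\<^esub> ?Z = {?Z}"
    by (auto simp: A_RCOSETS_def RCOSETS_def a_r_coset_def)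
  then show ?thesis
    by (simp add: restrict_scalars_def ext_def quotient_module_def assms)
qed

lemma coboundary_subset: "ext_coboundaries R P d B s \<subseteq> ext_cocycles R P d B s"
proof (cases s)
  case 0
  then show ?thesis using cont_hom_zero[OF P B]
    by (auto simp: ext_coboundaries_def cocycles_iff hom_module_def)
next
  case (Suc r)
  have "precomp (P (Suc r)) (d r) f \<in> ext_cocycles R P d B (Suc r)" if f: "f \<in> cont_hom R (P r) B" for f
    using cont_hom_comp[OF P d f] module_hom_zero[OF P.module_axioms B.module_axioms f]
    by (auto simp: cocycles_iff precomp_def d_d)
  then show ?thesis using Suc by (auto simp: ext_coboundaries_def)
qed

lemma coboundary_SucI:
  assumes "h \<in> cont_hom R (P r) B" "f \<in> ext_cocycles R P d B (Suc r)"
    "\<And>w. w \<in> carrier (P (Suc r)) \<Longrightarrow> f w = h (d r w)"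
  shows "f \<in> ext_coboundaries R P d B (Suc r)"
proof -
  have "f = precomp (P (Suc r)) (d r) h"
    unfolding precomp_def
    by (rule extensionalityI[of _ "carrier (P (Suc r))"]) (use assms in \<open>auto simp: cocycles_iff cont_homD\<close>)
  then show ?thesis using assms by (auto simp: ext_coboundaries_def)
qed

text \<open>A coboundary \<open>h \<circ> d 0\<close> takes the value \<open>\<gamma>\<close> times
  \<open>h e\<close> at \<open>z\<close>. Conversely, if \<open>f z\<close> is
  \<open>\<gamma>\<close> times \<open>b\<close>, then \<open>D w\<close> times \<open>f z\<close>
  equals \<open>\<psi> (d 0 w)\<close> times \<open>b\<close>, and the formula of
  \<open>cocycle_section\<close> becomes a function of \<open>d 0 w\<close>.\<close>

lemma coboundary_1_iff:
  assumes f: "f \<in> ext_cocycles R P d B 1"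
  shows "f \<in> ext_coboundaries R P d B 1 \<longleftrightarrow> (\<exists>b\<in>carrier B. f z = \<gamma> \<odot>\<^bsub>B\<^esub> b)"
proof
  assume "f \<in> ext_coboundaries R P d B 1"
  then obtain h where h: "h \<in> cont_hom R (P 0) B" "f = precomp (P 1) (d 0) h"
    by (auto simp: ext_coboundaries_def)
  then have "f z = \<gamma> \<odot>\<^bsub>B\<^esub> h e" by (simp add: precomp_def d_z cont_homD(5)[OF h(1)])
  then show "\<exists>b\<in>carrier B. f z = \<gamma> \<odot>\<^bsub>B\<^esub> b" using cont_homD(3)[OF h(1) e] by blast
next
  assume "\<exists>b\<in>carrier B. f z = \<gamma> \<odot>\<^bsub>B\<^esub> b"
  then obtain b where b: "b \<in> carrier B" "f z = \<gamma> \<odot>\<^bsub>B\<^esub> b" by blast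
  have ff: "f \<in> cont_hom R (P 1) B" using f by (simp add: cocycles_iff)
  let ?h = "\<lambda>x\<in>carrier (P 0). (\<lambda>x\<in>carrier (P 0). f (\<alpha> x)) x \<oplus>\<^bsub>B\<^esub> (\<lambda>x\<in>carrier (P 0). \<psi> x \<odot>\<^bsub>B\<^esub> b) x"
  have h: "?h \<in> cont_hom R (P 0) B"
    by (intro cont_hom_add[OF P B] cont_hom_comp[OF P alpha_hom ff] cont_hom_smult_elem[OF P B psi_hom b(1)])
  have "f w = ?h (d 0 w)" if w: "w \<in> carrier (P 1)" for w
  proof -
    have "D w \<odot>\<^bsub>B\<^esub> f z = \<psi> (d 0 w) \<odot>\<^bsub>B\<^esub> b"
      using w b by (simp add: B.smult_assoc1[symmetric] gamma_D[symmetric] m_comm)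
    then show ?thesis using cocycle_section[OF f w] w by simp
  qed
  then show "f \<in> ext_coboundaries R P d B 1" using coboundary_SucI[OF h, of f] f by simp
qed

text \<open>A 0-cocycle is determined by its value at \<open>e\<close>, and this value is
  \<open>\<gamma>\<close>-torsion because \<open>\<gamma> e\<close> is the boundary
  \<open>d 0 z\<close>.\<close>

theorem ext_0_iso:
  assumes add: "\<And>x y. x \<in> carrier B \<Longrightarrow> y \<in> carrier B \<Longrightarrow> \<pi> (x \<oplus>\<^bsub>B\<^esub> y) = \<pi> x \<oplus>\<^bsub>T\<^esub> \<pi> y"
    and smult: "\<And>a. a \<in> carrier S \<Longrightarrow> \<phi> a \<in> carrier R"
      "\<And>a x. a \<in> carrier S \<Longrightarrow> x \<in> carrier B \<Longrightarrow> \<pi> (\<phi> a \<odot>\<^bsub>B\<^esub> x) = a \<odot>\<^bsub>T\<^esub> \<pi> x"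
    and bij: "bij_betw \<pi> {b \<in> carrier B. \<gamma> \<odot>\<^bsub>B\<^esub> b = \<zero>\<^bsub>B\<^esub>} (carrier T)"
  shows "module_iso S (restrict_scalars \<phi> (ext R P d B 0)) T"
proof (rule ext_iso[OF add smult e _ coboundary_subset])
  have inv: "f e \<in> {b \<in> carrier B. \<gamma> \<odot>\<^bsub>B\<^esub> b = \<zero>\<^bsub>B\<^esub>}" if f: "f \<in> ext_cocycles R P d B 0" for f
  proof -
    have ff: "f \<in> cont_hom R (P 0) B" "f (d 0 z) = \<zero>\<^bsub>B\<^esub>" using f by (auto simp: cocycles_iff)
    then show ?thesis by (simp add: d_z cont_homD(3,5)[OF ff(1)])
  qed
  show "(\<lambda>f. \<pi> (f e)) ` ext_cocycles R P d B 0 = carrier T"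
  proof (intro equalityI subsetI)
    fix t assume "t \<in> carrier T"
    then obtain b where b: "b \<in> carrier B" "\<gamma> \<odot>\<^bsub>B\<^esub> b = \<zero>\<^bsub>B\<^esub>" "t = \<pi> b"
      using bij by (auto simp: bij_betw_def)
    \<comment> \<open>This vanishes on boundaries since \<open>\<psi> (d 0 w)\<close> is a multiple
      of \<open>\<gamma>\<close>, and it takes the value \<open>b\<close> at \<open>e\<close> since
      \<open>\<psi> e\<close> is one modulo \<open>\<gamma>\<close>.\<close>
    let ?f = "\<lambda>x\<in>carrier (P 0). \<psi> x \<odot>\<^bsub>B\<^esub> b"
    have "?f (d 0 w) = \<zero>\<^bsub>B\<^esub>" if w: "w \<in> carrier (P 1)" for w
    proof -
      have "\<psi> (d 0 w) \<odot>\<^bsub>B\<^esub> b = (D w \<otimes>\<^bsub>R\<^esub> \<gamma>) \<odot>\<^bsub>B\<^esub> b"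
        using w by (simp add: gamma_D[symmetric] m_comm)
      then show ?thesis using w b by (simp add: B.smult_assoc1)
    qed
    then have f: "?f \<in> ext_cocycles R P d B 0"
      using cont_hom_smult_elem[OF P B psi_hom b(1)] by (simp add: cocycles_iff)
    obtain y where y: "y \<in> carrier R" "\<psi> e \<ominus>\<^bsub>R\<^esub> \<one>\<^bsub>R\<^esub> = \<gamma> \<otimes>\<^bsub>R\<^esub> y" using psi_e by blast
    have "mdiff R B (\<psi> e \<odot>\<^bsub>B\<^esub> b) (\<one>\<^bsub>R\<^esub> \<odot>\<^bsub>B\<^esub> b) = (y \<otimes>\<^bsub>R\<^esub> \<gamma>) \<odot>\<^bsub>B\<^esub> b"
      using y b by (simp add: B.mdiff_smult_left[symmetric] m_comm del: B.smult_one)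
    then have "?f e = b" using y b by (simp add: B.smult_assoc1 B.mdiff_eq_zero_iff)
    then show "t \<in> (\<lambda>f. \<pi> (f e)) ` ext_cocycles R P d B 0" using f b by (intro image_eqI[where x = ?f]) auto
  qed (use inv bij in \<open>auto simp: bij_betw_def\<close>)
next
  fix f g assume f: "f \<in> ext_cocycles R P d B 0" and g: "g \<in> ext_cocycles R P d B 0"
  have C: "f x \<in> carrier B" "g x \<in> carrier B" if "x \<in> carrier (P 0)" for x
    using f g that by (auto simp: cocycles_iff cont_homD)
  have inv: "f e \<in> {b \<in> carrier B. \<gamma> \<odot>\<^bsub>B\<^esub> b = \<zero>\<^bsub>B\<^esub>}" if f: "f \<in> ext_cocycles R P d B 0" for f
  proof -
    have ff: "f \<in> cont_hom R (P 0) B" "f (d 0 z) = \<zero>\<^bsub>B\<^esub>" using f by (auto simp: cocycles_iff)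
    then show ?thesis by (simp add: d_z cont_homD(3,5)[OF ff(1)])
  qed
  have "\<pi> (f e) = \<pi> (g e) \<longleftrightarrow> f e = g e"
    using inj_on_eq_iff[OF bij_betw_imp_inj_on[OF bij] inv[OF f] inv[OF g]] .
  also have "\<dots> \<longleftrightarrow> (\<forall>x\<in>carrier (P 0). f x = g x)"
    using hom_generator[OF f] hom_generator[OF g] e by metis
  also have "\<dots> \<longleftrightarrow> (\<lambda>x\<in>carrier (P 0). mdiff R B (f x) (g x)) = (\<lambda>x\<in>carrier (P 0). \<zero>\<^bsub>B\<^esub>)"
    using C by (auto simp: restrict_def fun_eq_iff B.mdiff_eq_zero_iff)
  finally show "\<pi> (f e) = \<pi> (g e) \<longleftrightarrow>
      (\<lambda>x\<in>carrier (P 0). mdiff R B (f x) (g x)) \<in> ext_coboundaries R P d B 0"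
    by (simp add: ext_coboundaries_def hom_module_def)
qed

lemma ext_0_trivial:
  assumes "\<And>b. b \<in> carrier B \<Longrightarrow> \<gamma> \<odot>\<^bsub>B\<^esub> b = \<zero>\<^bsub>B\<^esub> \<Longrightarrow> b = \<zero>\<^bsub>B\<^esub>"
  shows "carrier (restrict_scalars \<phi> (ext R P d B 0)) = {\<zero>\<^bsub>restrict_scalars \<phi> (ext R P d B 0)\<^esub>}"
proof (rule ext_trivial, rule antisym[OF coboundary_subset], rule subsetI)
  fix f assume f: "f \<in> ext_cocycles R P d B 0"
  then have ff: "f \<in> cont_hom R (P 0) B" "f (d 0 z) = \<zero>\<^bsub>B\<^esub>" by (auto simp: cocycles_iff)
  then have "\<gamma> \<odot>\<^bsub>B\<^esub> f e = \<zero>\<^bsub>B\<^esub>" by (simp add: d_z cont_homD(5)[OF ff(1)])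
  then have "f e = \<zero>\<^bsub>B\<^esub>" using assms cont_homD(3)[OF ff(1) e] by blast
  then have "f x = \<zero>\<^bsub>B\<^esub>" if "x \<in> carrier (P 0)" for x
    using hom_generator[OF f that] that by simp
  then have "f = (\<lambda>x\<in>carrier (P 0). \<zero>\<^bsub>B\<^esub>)"
    by (intro extensionalityI[OF cont_homD(1)[OF ff(1)]]) auto
  then show "f \<in> ext_coboundaries R P d B 0"
    by (simp add: ext_coboundaries_def hom_module_def)
qed

text \<open>By \<open>coboundary_1_iff\<close>, evaluation at \<open>z\<close> separates 1-cocycles
  exactly up to \<open>\<gamma> B\<close>; \<open>\<pi>\<close> is any presentation of the quotient
  of \<open>B\<close> by \<open>\<gamma> B\<close>.\<close>

theorem ext_1_iso:
  assumes add: "\<And>x y. x \<in> carrier B \<Longrightarrow> y \<in> carrier B \<Longrightarrow> \<pi> (x \<oplus>\<^bsub>B\<^esub> y) = \<pi> x \<oplus>\<^bsub>T\<^esub> \<pi> y"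
    and smult: "\<And>a. a \<in> carrier S \<Longrightarrow> \<phi> a \<in> carrier R"
      "\<And>a x. a \<in> carrier S \<Longrightarrow> x \<in> carrier B \<Longrightarrow> \<pi> (\<phi> a \<odot>\<^bsub>B\<^esub> x) = a \<odot>\<^bsub>T\<^esub> \<pi> x"
    and surj: "\<pi> ` carrier B = carrier T"
    and ker: "\<And>x y. x \<in> carrier B \<Longrightarrow> y \<in> carrier B \<Longrightarrow> \<pi> x = \<pi> y \<longleftrightarrow> (\<exists>b\<in>carrier B. mdiff R B x y = \<gamma> \<odot>\<^bsub>B\<^esub> b)"
  shows "module_iso S (restrict_scalars \<phi> (ext R P d B 1)) T"
proof (rule ext_iso[OF add smult z(1) _ coboundary_subset])
  have C: "f z \<in> carrier B" if "f \<in> ext_cocycles R P d B 1" for f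
    using that by (auto simp: cocycles_iff cont_homD)
  show "(\<lambda>f. \<pi> (f z)) ` ext_cocycles R P d B 1 = carrier T"
  proof (intro equalityI subsetI)
    fix t assume "t \<in> carrier T"
    then obtain b where b: "b \<in> carrier B" "t = \<pi> b" using surj by blast
    \<comment> \<open>\<open>D\<close> vanishes on boundaries by regularity of
      \<open>\<gamma>\<close>, so this is a cocycle. Its value at \<open>z\<close> is
      \<open>\<psi> e\<close> times \<open>b\<close>, which agrees with \<open>b\<close> only modulo
      \<open>\<gamma> B\<close>; \<open>\<pi>\<close> does not see the difference.\<close>
    let ?f = "\<lambda>w\<in>carrier (P 1). D w \<odot>\<^bsub>B\<^esub> b"
    have "?f (d 1 w) = \<zero>\<^bsub>B\<^esub>" if w: "w \<in> carrier (P 2)" for w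
    proof -
      have dw: "d 1 w \<in> carrier (P 1)" using w d_simps(1)[of w 1] by (simp add: numeral_2_eq_2)
      have "\<gamma> \<otimes>\<^bsub>R\<^esub> D (d 1 w) = \<zero>\<^bsub>R\<^esub>"
        using gamma_D[OF dw] d_d[of w 0] w module_hom_zero[OF P.module_axioms R_module psi_hom]
        by (simp add: numeral_2_eq_2)
      then have "D (d 1 w) = \<zero>\<^bsub>R\<^esub>" by (rule gamma_inj[rotated]) (use dw in simp)
      then show ?thesis using dw b by simp
    qed
    then have f: "?f \<in> ext_cocycles R P d B 1"
      using cont_hom_smult_elem[OF P B D_hom b(1)] by (simp add: cocycles_iff numeral_2_eq_2)
    obtain y where y: "y \<in> carrier R" "\<psi> e \<ominus>\<^bsub>R\<^esub> \<one>\<^bsub>R\<^esub> = \<gamma> \<otimes>\<^bsub>R\<^esub> y" using psi_e by blast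
    have "mdiff R B (\<psi> e \<odot>\<^bsub>B\<^esub> b) (\<one>\<^bsub>R\<^esub> \<odot>\<^bsub>B\<^esub> b) = \<gamma> \<odot>\<^bsub>B\<^esub> (y \<odot>\<^bsub>B\<^esub> b)"
      using y b by (simp add: B.mdiff_smult_left[symmetric] B.smult_assoc1 del: B.smult_one)
    then have "\<pi> (?f z) = t"
      using ker[of "\<psi> e \<odot>\<^bsub>B\<^esub> b" b] y b by (auto simp: D_z)
    then show "t \<in> (\<lambda>f. \<pi> (f z)) ` ext_cocycles R P d B 1" using f by blast
  qed (use C surj in auto)
next
  fix f g assume f: "f \<in> ext_cocycles R P d B 1" and g: "g \<in> ext_cocycles R P d B 1"
  have C: "f z \<in> carrier B" "g z \<in> carrier B" using f g by (auto simp: cocycles_iff cont_homD)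
  show "\<pi> (f z) = \<pi> (g z) \<longleftrightarrow> (\<lambda>x\<in>carrier (P 1). mdiff R B (f x) (g x)) \<in> ext_coboundaries R P d B 1"
    unfolding coboundary_1_iff[OF cocycle_mdiff[OF f g]] ker[OF C] by simp
qed

lemma ext_1_trivial:
  assumes "\<And>b. b \<in> carrier B \<Longrightarrow> \<exists>c\<in>carrier B. b = \<gamma> \<odot>\<^bsub>B\<^esub> c"
  shows "carrier (restrict_scalars \<phi> (ext R P d B 1)) = {\<zero>\<^bsub>restrict_scalars \<phi> (ext R P d B 1)\<^esub>}"
proof (rule ext_trivial, rule antisym[OF coboundary_subset], rule subsetI)
  fix f assume f: "f \<in> ext_cocycles R P d B 1"
  have "f z \<in> carrier B" using f by (auto simp: cocycles_iff cont_homD)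
  then show "f \<in> ext_coboundaries R P d B 1" using assms coboundary_1_iff[OF f] by blast
qed

text \<open>Lifting the projection of \<open>retraction\<close> gives a splitting \<open>a\<close>
  of \<open>d (Suc n)\<close> over its image. Then \<open>w\<close> minus
  \<open>a (d (Suc n) w)\<close> is a boundary, so the cocycle equals its composite with
  \<open>a \<circ> d (Suc n)\<close>.\<close>

theorem ext_ge_2_trivial:
  "carrier (restrict_scalars \<phi> (ext R P d B (Suc (Suc n)))) =
    {\<zero>\<^bsub>restrict_scalars \<phi> (ext R P d B (Suc (Suc n)))\<^esub>}"
proof (rule ext_trivial, rule antisym[OF coboundary_subset], rule subsetI)
  fix f assume f: "f \<in> ext_cocycles R P d B (Suc (Suc n))"
  then have ff: "f \<in> cont_hom R (P (Suc (Suc n))) B"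
    "\<And>x. x \<in> carrier (P (Suc (Suc (Suc n)))) \<Longrightarrow> f (d (Suc (Suc n)) x) = \<zero>\<^bsub>B\<^esub>"
    by (auto simp: cocycles_iff)
  obtain r where r: "r \<in> cont_hom R (P (Suc n)) (P (Suc n))"
    "\<And>w. w \<in> carrier (P (Suc n)) \<Longrightarrow> d n (r w) = \<zero>\<^bsub>P n\<^esub>"
    "\<And>w. w \<in> carrier (P (Suc n)) \<Longrightarrow> d n w = \<zero>\<^bsub>P n\<^esub> \<Longrightarrow> r w = w" using retraction[of n] by blast
  have "r ` carrier (P (Suc n)) \<subseteq> d (Suc n) ` carrier (P (Suc (Suc n)))"
    using r cont_homD[OF r(1)] unfolding exact_Suc by auto
  then obtain a where a: "a \<in> cont_hom R (P (Suc n)) (P (Suc (Suc n)))"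
    "\<And>x. x \<in> carrier (P (Suc n)) \<Longrightarrow> d (Suc n) (a x) = r x"
    by (rule projective_lift[OF profinite_ring_axioms PP P P d r(1)]) blast
  note aa = cont_homD[OF a(1)]
  let ?h = "\<lambda>x\<in>carrier (P (Suc n)). f (a x)"
  have h: "?h \<in> cont_hom R (P (Suc n)) B" by (rule cont_hom_comp[OF P a(1) ff(1)])
  show "f \<in> ext_coboundaries R P d B (Suc (Suc n))"
  proof (rule coboundary_SucI[OF h f])
    fix w assume w: "w \<in> carrier (P (Suc (Suc n)))"
    let ?x = "mdiff R (P (Suc (Suc n))) w (a (d (Suc n) w))"
    have "d (Suc n) ?x = \<zero>\<^bsub>P (Suc n)\<^esub>" using w aa by (simp add: a r d_d)
    then have "?x \<in> d (Suc (Suc n)) ` carrier (P (Suc (Suc (Suc n))))"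
      using w aa unfolding exact_Suc by simp
    then have "f ?x = \<zero>\<^bsub>B\<^esub>" using ff by auto
    then have "f w = f (a (d (Suc n) w))"
      using cont_hom_mdiff[OF P.module_axioms B.module_axioms ff(1)] w aa cont_homD(3)[OF ff(1)]
      by (simp add: B.mdiff_eq_zero_iff)
    then show "f w = ?h (d (Suc n) w)" using w by simp
  qed
qed

end

section \<open>Group rings of finite abelian groups\<close>

context abelian_monoid begin

lemma finsum_swap:
  assumes "finite A" "finite B" "\<And>i j. i \<in> A \<Longrightarrow> j \<in> B \<Longrightarrow> f i j \<in> carrier G"
  shows "(\<Oplus>i\<in>A. \<Oplus>j\<in>B. f i j) = (\<Oplus>j\<in>B. \<Oplus>i\<in>A. f i j)"
  using assms(1,3)
proof (induction A)
  case (insert a A)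
  have "(\<Oplus>j\<in>B. \<Oplus>i\<in>insert a A. f i j) = (\<Oplus>j\<in>B. f a j \<oplus> (\<Oplus>i\<in>A. f i j))"
    using insert by (intro finsum_cong') (auto intro!: finsum_closed)
  also have "\<dots> = (\<Oplus>j\<in>B. f a j) \<oplus> (\<Oplus>j\<in>B. \<Oplus>i\<in>A. f i j)"
    using insert by (intro finsum_addf) (auto intro!: finsum_closed)
  finally show ?case using insert by (simp add: Pi_def)
qed simp

lemma finsum_fibres:
  assumes "finite A" "finite B" "\<pi> \<in> A \<rightarrow> B" "\<And>a. a \<in> A \<Longrightarrow> f a \<in> carrier G"
  shows "(\<Oplus>b\<in>B. \<Oplus>a\<in>{a \<in> A. \<pi> a = b}. f a) = (\<Oplus>a\<in>A. f a)"
proof -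
  have "(\<Union>b\<in>B. {a \<in> A. \<pi> a = b}) = A" using assms(3) by auto
  moreover have "finsum G f (\<Union>b\<in>B. {a \<in> A. \<pi> a = b}) = (\<Oplus>b\<in>B. \<Oplus>a\<in>{a \<in> A. \<pi> a = b}. f a)"
    by (rule add.finprod_UN_disjoint) (use assms in \<open>auto simp: pairwise_def disjnt_def\<close>)
  ultimately show ?thesis by simp
qed

lemma finsum_bij:
  assumes "bij_betw h A B" "\<And>b. b \<in> B \<Longrightarrow> f b \<in> carrier G"
  shows "(\<Oplus>b\<in>B. f b) = (\<Oplus>a\<in>A. f (h a))"
  using finsum_reindex[of f h A] assms by (auto simp: bij_betw_def)

lemma finsum_delta:
  assumes "finite A" "i \<in> A" "c \<in> carrier G"
  shows "(\<Oplus>j\<in>A. if j = i then c else \<zero>) = c"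
  using add.finprod_singleton_swap[of i A "\<lambda>_. c"] assms by simp

end

locale finite_group_ring = R: cring R + H: comm_group H
  for R (structure) and H :: "('g, 'c) monoid_scheme" +
  assumes finite_carrier [simp]: "finite (carrier H)"
begin

abbreviation "K \<equiv> carrier H"

lemma group_ring_simps:
  "carrier (group_ring R H) = K \<rightarrow>\<^sub>E carrier R"
  "\<zero>\<^bsub>group_ring R H\<^esub> = (\<lambda>x\<in>K. \<zero>)"
  "f \<oplus>\<^bsub>group_ring R H\<^esub> h = (\<lambda>x\<in>K. f x \<oplus> h x)"
  "\<one>\<^bsub>group_ring R H\<^esub> = (\<lambda>x\<in>K. if x = \<one>\<^bsub>H\<^esub> then \<one> else \<zero>)"
  "f \<otimes>\<^bsub>group_ring R H\<^esub> h = (\<lambda>x\<in>K. \<Oplus>y\<in>K. f y \<otimes> h (inv\<^bsub>H\<^esub> y \<otimes>\<^bsub>H\<^esub> x))"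
  by (simp_all add: group_ring_def)

lemma bij_translate:
  assumes "w \<in> K" shows "bij_betw (\<lambda>v. w \<otimes>\<^bsub>H\<^esub> v) K K"
  by (rule bij_betwI[where g = "\<lambda>v. inv\<^bsub>H\<^esub> w \<otimes>\<^bsub>H\<^esub> v"])
     (use assms in \<open>auto simp: H.m_assoc[symmetric]\<close>)

lemma inv_inv_mult:
  assumes "v \<in> K" "x \<in> K" shows "inv\<^bsub>H\<^esub> (inv\<^bsub>H\<^esub> v \<otimes>\<^bsub>H\<^esub> x) \<otimes>\<^bsub>H\<^esub> x = v"
proof -
  have "inv\<^bsub>H\<^esub> (inv\<^bsub>H\<^esub> v \<otimes>\<^bsub>H\<^esub> x) = v \<otimes>\<^bsub>H\<^esub> inv\<^bsub>H\<^esub> x"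
    using assms by (simp add: H.inv_mult_group H.m_comm[of "inv\<^bsub>H\<^esub> x" v])
  then show ?thesis using assms by (simp add: H.m_assoc)
qed

lemma bij_reflect:
  assumes "x \<in> K" shows "bij_betw (\<lambda>v. inv\<^bsub>H\<^esub> v \<otimes>\<^bsub>H\<^esub> x) K K"
proof (rule bij_betwI[where g = "\<lambda>v. x \<otimes>\<^bsub>H\<^esub> inv\<^bsub>H\<^esub> v"])
  fix v assume v: "v \<in> K"
  show "x \<otimes>\<^bsub>H\<^esub> inv\<^bsub>H\<^esub> (inv\<^bsub>H\<^esub> v \<otimes>\<^bsub>H\<^esub> x) = v"
    using inv_inv_mult[OF v assms] v assms by (simp add: H.m_comm)
  show "inv\<^bsub>H\<^esub> (x \<otimes>\<^bsub>H\<^esub> inv\<^bsub>H\<^esub> v) \<otimes>\<^bsub>H\<^esub> x = v"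
    using inv_inv_mult[OF v assms] v assms by (simp add: H.m_comm)
qed (use assms in auto)

lemma mult_closed:
  assumes "f \<in> K \<rightarrow>\<^sub>E carrier R" "h \<in> K \<rightarrow>\<^sub>E carrier R"
  shows "f \<otimes>\<^bsub>group_ring R H\<^esub> h \<in> K \<rightarrow>\<^sub>E carrier R"
  using assms by (auto simp: group_ring_simps PiE_iff intro!: R.finsum_closed)

lemma mult_assoc:
  assumes f: "f \<in> K \<rightarrow>\<^sub>E carrier R" and h: "h \<in> K \<rightarrow>\<^sub>E carrier R" and k: "k \<in> K \<rightarrow>\<^sub>E carrier R"
  shows "(f \<otimes>\<^bsub>group_ring R H\<^esub> h) \<otimes>\<^bsub>group_ring R H\<^esub> k = f \<otimes>\<^bsub>group_ring R H\<^esub> (h \<otimes>\<^bsub>group_ring R H\<^esub> k)"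
proof (rule extensionalityI[of _ K])
  have C [simp]: "f y \<in> carrier R" "h y \<in> carrier R" "k y \<in> carrier R" if "y \<in> K" for y
    using assms that by auto
  fix x assume x: "x \<in> K"
  have "((f \<otimes>\<^bsub>group_ring R H\<^esub> h) \<otimes>\<^bsub>group_ring R H\<^esub> k) x
      = (\<Oplus>y\<in>K. (\<Oplus>w\<in>K. f w \<otimes> h (inv\<^bsub>H\<^esub> w \<otimes>\<^bsub>H\<^esub> y)) \<otimes> k (inv\<^bsub>H\<^esub> y \<otimes>\<^bsub>H\<^esub> x))"
    using x by (auto simp: group_ring_simps intro!: R.finsum_cong' R.finsum_closed)
  also have "\<dots> = (\<Oplus>y\<in>K. \<Oplus>w\<in>K. (f w \<otimes> h (inv\<^bsub>H\<^esub> w \<otimes>\<^bsub>H\<^esub> y)) \<otimes> k (inv\<^bsub>H\<^esub> y \<otimes>\<^bsub>H\<^esub> x))"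
    using x by (intro R.finsum_cong') (auto simp: R.finsum_ldistr intro!: R.finsum_closed)
  also have "\<dots> = (\<Oplus>w\<in>K. \<Oplus>y\<in>K. (f w \<otimes> h (inv\<^bsub>H\<^esub> w \<otimes>\<^bsub>H\<^esub> y)) \<otimes> k (inv\<^bsub>H\<^esub> y \<otimes>\<^bsub>H\<^esub> x))"
    using x by (intro R.finsum_swap) auto
  \<comment> \<open>Substituting y = w v for fixed w removes the outer variable from the argument of
    \<open>h\<close>.\<close>
  also have "\<dots> = (\<Oplus>w\<in>K. \<Oplus>v\<in>K. (f w \<otimes> h v) \<otimes> k (inv\<^bsub>H\<^esub> v \<otimes>\<^bsub>H\<^esub> (inv\<^bsub>H\<^esub> w \<otimes>\<^bsub>H\<^esub> x)))"
  proof (rule R.finsum_cong'[OF refl])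
    fix w assume w: "w \<in> K"
    have "(\<Oplus>y\<in>K. (f w \<otimes> h (inv\<^bsub>H\<^esub> w \<otimes>\<^bsub>H\<^esub> y)) \<otimes> k (inv\<^bsub>H\<^esub> y \<otimes>\<^bsub>H\<^esub> x))
      = (\<Oplus>v\<in>K. (f w \<otimes> h (inv\<^bsub>H\<^esub> w \<otimes>\<^bsub>H\<^esub> (w \<otimes>\<^bsub>H\<^esub> v))) \<otimes> k (inv\<^bsub>H\<^esub> (w \<otimes>\<^bsub>H\<^esub> v) \<otimes>\<^bsub>H\<^esub> x))"
      by (rule R.finsum_bij[OF bij_translate[OF w]]) (use w x in auto)
    also have "\<dots> = (\<Oplus>v\<in>K. (f w \<otimes> h v) \<otimes> k (inv\<^bsub>H\<^esub> v \<otimes>\<^bsub>H\<^esub> (inv\<^bsub>H\<^esub> w \<otimes>\<^bsub>H\<^esub> x)))"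
      using w x by (intro R.finsum_cong') (auto simp: H.m_assoc[symmetric] H.inv_mult_group)
    finally show "(\<Oplus>y\<in>K. (f w \<otimes> h (inv\<^bsub>H\<^esub> w \<otimes>\<^bsub>H\<^esub> y)) \<otimes> k (inv\<^bsub>H\<^esub> y \<otimes>\<^bsub>H\<^esub> x))
      = (\<Oplus>v\<in>K. (f w \<otimes> h v) \<otimes> k (inv\<^bsub>H\<^esub> v \<otimes>\<^bsub>H\<^esub> (inv\<^bsub>H\<^esub> w \<otimes>\<^bsub>H\<^esub> x)))" .
  qed (use x in \<open>auto intro!: R.finsum_closed\<close>)
  also have "\<dots> = (\<Oplus>w\<in>K. f w \<otimes> (\<Oplus>v\<in>K. h v \<otimes> k (inv\<^bsub>H\<^esub> v \<otimes>\<^bsub>H\<^esub> (inv\<^bsub>H\<^esub> w \<otimes>\<^bsub>H\<^esub> x))))"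
    using x by (intro R.finsum_cong') (auto simp: R.finsum_rdistr R.m_assoc intro!: R.finsum_closed R.finsum_cong')
  also have "\<dots> = (f \<otimes>\<^bsub>group_ring R H\<^esub> (h \<otimes>\<^bsub>group_ring R H\<^esub> k)) x"
    using x by (auto simp: group_ring_simps intro!: R.finsum_cong' R.finsum_closed)
  finally show "((f \<otimes>\<^bsub>group_ring R H\<^esub> h) \<otimes>\<^bsub>group_ring R H\<^esub> k) x =
     (f \<otimes>\<^bsub>group_ring R H\<^esub> (h \<otimes>\<^bsub>group_ring R H\<^esub> k)) x" .
qed (auto simp: group_ring_simps)

text \<open>Reflecting the summation index through \<open>x\<close> exchanges the two factors;
  recovering \<open>v\<close> from the reflected index uses that \<open>H\<close> is
  commutative.\<close>

lemma mult_comm: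
  assumes f: "f \<in> K \<rightarrow>\<^sub>E carrier R" and h: "h \<in> K \<rightarrow>\<^sub>E carrier R"
  shows "f \<otimes>\<^bsub>group_ring R H\<^esub> h = h \<otimes>\<^bsub>group_ring R H\<^esub> f"
proof (rule extensionalityI[of _ K])
  have C [simp]: "f y \<in> carrier R" "h y \<in> carrier R" if "y \<in> K" for y
    using assms that by auto
  fix x assume x: "x \<in> K"
  have "(\<Oplus>y\<in>K. f y \<otimes> h (inv\<^bsub>H\<^esub> y \<otimes>\<^bsub>H\<^esub> x))
      = (\<Oplus>v\<in>K. f (inv\<^bsub>H\<^esub> v \<otimes>\<^bsub>H\<^esub> x) \<otimes> h (inv\<^bsub>H\<^esub> (inv\<^bsub>H\<^esub> v \<otimes>\<^bsub>H\<^esub> x) \<otimes>\<^bsub>H\<^esub> x))"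
    by (rule R.finsum_bij[OF bij_reflect[OF x]]) (use x in auto)
  also have "\<dots> = (\<Oplus>v\<in>K. h v \<otimes> f (inv\<^bsub>H\<^esub> v \<otimes>\<^bsub>H\<^esub> x))"
  proof (rule R.finsum_cong'[OF refl])
    fix v assume v: "v \<in> K"
    show "f (inv\<^bsub>H\<^esub> v \<otimes>\<^bsub>H\<^esub> x) \<otimes> h (inv\<^bsub>H\<^esub> (inv\<^bsub>H\<^esub> v \<otimes>\<^bsub>H\<^esub> x) \<otimes>\<^bsub>H\<^esub> x) = h v \<otimes> f (inv\<^bsub>H\<^esub> v \<otimes>\<^bsub>H\<^esub> x)"
      using v x by (simp add: R.m_comm inv_inv_mult)
  qed (use x in auto)
  finally show "(f \<otimes>\<^bsub>group_ring R H\<^esub> h) x = (h \<otimes>\<^bsub>group_ring R H\<^esub> f) x"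
    using x by (simp add: group_ring_simps)
qed (auto simp: group_ring_simps)

text \<open>The group ring element c[g].\<close>

definition delta :: "'a \<Rightarrow> 'g \<Rightarrow> 'g \<Rightarrow> 'a" where
  "delta c g = (\<lambda>x\<in>K. if x = g then c else \<zero>)"

lemma delta_closed: "c \<in> carrier R \<Longrightarrow> delta c g \<in> K \<rightarrow>\<^sub>E carrier R"
  by (auto simp: delta_def)

lemma delta_mult:
  assumes c: "c \<in> carrier R" and g: "g \<in> K" and f: "f \<in> K \<rightarrow>\<^sub>E carrier R"
  shows "delta c g \<otimes>\<^bsub>group_ring R H\<^esub> f = (\<lambda>x\<in>K. c \<otimes> f (inv\<^bsub>H\<^esub> g \<otimes>\<^bsub>H\<^esub> x))"
proof (rule extensionalityI[of _ K])
  have C [simp]: "f y \<in> carrier R" if "y \<in> K" for y using f that by auto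
  fix x assume x: "x \<in> K"
  have "(\<Oplus>y\<in>K. delta c g y \<otimes> f (inv\<^bsub>H\<^esub> y \<otimes>\<^bsub>H\<^esub> x)) = (\<Oplus>y\<in>K. if y = g then c \<otimes> f (inv\<^bsub>H\<^esub> g \<otimes>\<^bsub>H\<^esub> x) else \<zero>)"
    using x c g by (intro R.finsum_cong') (auto simp: delta_def)
  also have "\<dots> = c \<otimes> f (inv\<^bsub>H\<^esub> g \<otimes>\<^bsub>H\<^esub> x)"
    using x c g by (intro R.finsum_delta) auto
  finally show "(delta c g \<otimes>\<^bsub>group_ring R H\<^esub> f) x = (\<lambda>x\<in>K. c \<otimes> f (inv\<^bsub>H\<^esub> g \<otimes>\<^bsub>H\<^esub> x)) x"
    using x by (simp add: group_ring_simps)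
qed (auto simp: group_ring_simps)

lemma one_delta: "\<one>\<^bsub>group_ring R H\<^esub> = delta \<one> \<one>\<^bsub>H\<^esub>"
  by (simp add: group_ring_simps delta_def)

lemma one_mult: "f \<in> K \<rightarrow>\<^sub>E carrier R \<Longrightarrow> \<one>\<^bsub>group_ring R H\<^esub> \<otimes>\<^bsub>group_ring R H\<^esub> f = f"
  unfolding one_delta
  by (subst delta_mult) (auto simp: PiE_iff fun_eq_iff extensional_def)

lemma distrib:
  assumes "f \<in> K \<rightarrow>\<^sub>E carrier R" "h \<in> K \<rightarrow>\<^sub>E carrier R" "k \<in> K \<rightarrow>\<^sub>E carrier R"
  shows "(f \<oplus>\<^bsub>group_ring R H\<^esub> h) \<otimes>\<^bsub>group_ring R H\<^esub> k =
    f \<otimes>\<^bsub>group_ring R H\<^esub> k \<oplus>\<^bsub>group_ring R H\<^esub> h \<otimes>\<^bsub>group_ring R H\<^esub> k"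
proof (rule extensionalityI[of _ K])
  have C [simp]: "f y \<in> carrier R" "h y \<in> carrier R" "k y \<in> carrier R" if "y \<in> K" for y
    using assms that by auto
  fix x assume x: "x \<in> K"
  have "(\<Oplus>y\<in>K. (\<lambda>x\<in>K. f x \<oplus> h x) y \<otimes> k (inv\<^bsub>H\<^esub> y \<otimes>\<^bsub>H\<^esub> x))
    = (\<Oplus>y\<in>K. f y \<otimes> k (inv\<^bsub>H\<^esub> y \<otimes>\<^bsub>H\<^esub> x) \<oplus> h y \<otimes> k (inv\<^bsub>H\<^esub> y \<otimes>\<^bsub>H\<^esub> x))"
    using x by (intro R.finsum_cong') (auto simp: R.l_distr)
  also have "\<dots> = (\<Oplus>y\<in>K. f y \<otimes> k (inv\<^bsub>H\<^esub> y \<otimes>\<^bsub>H\<^esub> x)) \<oplus> (\<Oplus>y\<in>K. h y \<otimes> k (inv\<^bsub>H\<^esub> y \<otimes>\<^bsub>H\<^esub> x))"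
    using x by (intro R.finsum_addf) auto
  finally show "((f \<oplus>\<^bsub>group_ring R H\<^esub> h) \<otimes>\<^bsub>group_ring R H\<^esub> k) x =
      (f \<otimes>\<^bsub>group_ring R H\<^esub> k \<oplus>\<^bsub>group_ring R H\<^esub> h \<otimes>\<^bsub>group_ring R H\<^esub> k) x"
    using x by (simp add: group_ring_simps)
qed (auto simp: group_ring_simps)

end

section \<open>Functoriality of group rings\<close>

definition pushforward ::
    "('r, 'b) ring_scheme \<Rightarrow> 'g set \<Rightarrow> 'h set \<Rightarrow> ('g \<Rightarrow> 'h) \<Rightarrow> ('g \<Rightarrow> 'r) \<Rightarrow> 'h \<Rightarrow> 'r" where
  "pushforward R A B \<pi> f = (\<lambda>b\<in>B. \<Oplus>\<^bsub>R\<^esub>a\<in>{a \<in> A. \<pi> a = b}. f a)"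

locale finite_group_ring_hom = A: finite_group_ring R A + B: finite_group_ring R B
  for R (structure) and A :: "('g, 'c) monoid_scheme" and B :: "('h, 'd) monoid_scheme" +
  fixes \<pi> :: "'g \<Rightarrow> 'h"
  assumes hom: "\<pi> \<in> hom A B"
begin

abbreviation "push \<equiv> pushforward R (carrier A) (carrier B) \<pi>"

lemma pi_closed [simp]: "a \<in> carrier A \<Longrightarrow> \<pi> a \<in> carrier B"
  using hom by (auto simp: hom_def)

lemma pi_mult [simp]: "a \<in> carrier A \<Longrightarrow> b \<in> carrier A \<Longrightarrow> \<pi> (a \<otimes>\<^bsub>A\<^esub> b) = \<pi> a \<otimes>\<^bsub>B\<^esub> \<pi> b"
  using hom by (auto simp: hom_def)

lemma pi_group_hom: "group_hom A B \<pi>"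
  using hom A.H.group_axioms B.H.group_axioms by (simp add: group_hom_def group_hom_axioms_def)

lemma pi_one [simp]: "\<pi> \<one>\<^bsub>A\<^esub> = \<one>\<^bsub>B\<^esub>"
  using group_hom.hom_one[OF pi_group_hom] .

lemma pi_inv [simp]: "a \<in> carrier A \<Longrightarrow> \<pi> (inv\<^bsub>A\<^esub> a) = inv\<^bsub>B\<^esub> \<pi> a"
  using group_hom.hom_inv[OF pi_group_hom] .

lemma push_closed: "f \<in> carrier A \<rightarrow>\<^sub>E carrier R \<Longrightarrow> push f \<in> carrier B \<rightarrow>\<^sub>E carrier R"
  by (auto simp: pushforward_def PiE_iff intro!: A.R.finsum_closed)

lemma push_add:
  assumes "f \<in> carrier A \<rightarrow>\<^sub>E carrier R" "h \<in> carrier A \<rightarrow>\<^sub>E carrier R"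
  shows "push (f \<oplus>\<^bsub>group_ring R A\<^esub> h) = push f \<oplus>\<^bsub>group_ring R B\<^esub> push h"
proof -
  have C [simp]: "f y \<in> carrier R" "h y \<in> carrier R" if "y \<in> carrier A" for y
    using assms that by auto
  have "(\<Oplus>a\<in>{a \<in> carrier A. \<pi> a = b}. (\<lambda>x\<in>carrier A. f x \<oplus> h x) a)
      = (\<Oplus>a\<in>{a \<in> carrier A. \<pi> a = b}. f a) \<oplus> (\<Oplus>a\<in>{a \<in> carrier A. \<pi> a = b}. h a)" (is "?l = ?r") for b
  proof -
    have "?l = (\<Oplus>a\<in>{a \<in> carrier A. \<pi> a = b}. f a \<oplus> h a)" by (rule A.R.finsum_cong') auto
    also have "\<dots> = ?r" by (rule A.R.finsum_addf) auto
    finally show ?thesis .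
  qed
  then show ?thesis
    by (auto simp: pushforward_def A.group_ring_simps B.group_ring_simps fun_eq_iff)
qed

lemma push_delta:
  assumes "c \<in> carrier R" "g \<in> carrier A"
  shows "push (A.delta c g) = B.delta c (\<pi> g)"
proof (rule extensionalityI[of _ "carrier B"])
  fix b assume b: "b \<in> carrier B"
  show "push (A.delta c g) b = B.delta c (\<pi> g) b"
  proof (cases "b = \<pi> g")
    case True
    have "(\<Oplus>a\<in>{a \<in> carrier A. \<pi> a = b}. A.delta c g a) = (\<Oplus>a\<in>{a \<in> carrier A. \<pi> a = b}. if a = g then c else \<zero>)"
      using assms by (intro A.R.finsum_cong') (auto simp: A.delta_def)
    also have "\<dots> = c" using assms True by (intro A.R.finsum_delta) auto
    finally show ?thesis using b True by (simp add: pushforward_def B.delta_def)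
  next
    case False
    have "(\<Oplus>a\<in>{a \<in> carrier A. \<pi> a = b}. A.delta c g a) = (\<Oplus>a\<in>{a \<in> carrier A. \<pi> a = b}. \<zero>)"
      using assms False by (intro A.R.finsum_cong') (auto simp: A.delta_def)
    then show ?thesis using b False by (simp add: pushforward_def B.delta_def)
  qed
qed (auto simp: pushforward_def B.delta_def)

text \<open>For fixed \<open>a\<close>, left translation by \<open>a\<close> identifies the fibre
  over \<open>\<pi> a\<close> inverse times \<open>c\<close> with the fibre over \<open>c\<close>,
  so the inner sum is a value of \<open>push h\<close>. Collecting the \<open>a\<close> by their
  images then produces \<open>push f\<close>.\<close>

lemma push_mult:
  assumes f: "f \<in> carrier A \<rightarrow>\<^sub>E carrier R" and h: "h \<in> carrier A \<rightarrow>\<^sub>E carrier R"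
  shows "push (f \<otimes>\<^bsub>group_ring R A\<^esub> h) = push f \<otimes>\<^bsub>group_ring R B\<^esub> push h"
proof (rule extensionalityI[of _ "carrier B"])
  let ?A = "carrier A" and ?B = "carrier B"
  have C [simp]: "f y \<in> carrier R" "h y \<in> carrier R" if "y \<in> carrier A" for y
    using assms that by auto
  have P [simp]: "push h b \<in> carrier R" if "b \<in> ?B" for b using push_closed[OF h] that by auto
  fix c assume c: "c \<in> carrier B"
  let ?F = "\<lambda>c. {a \<in> ?A. \<pi> a = c}"
  have "push (f \<otimes>\<^bsub>group_ring R A\<^esub> h) c = (\<Oplus>b\<in>?F c. \<Oplus>a\<in>?A. f a \<otimes> h (inv\<^bsub>A\<^esub> a \<otimes>\<^bsub>A\<^esub> b))"
    using c by (auto simp: pushforward_def A.group_ring_simps intro!: A.R.finsum_cong' A.R.finsum_closed)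
  also have "\<dots> = (\<Oplus>a\<in>?A. \<Oplus>b\<in>?F c. f a \<otimes> h (inv\<^bsub>A\<^esub> a \<otimes>\<^bsub>A\<^esub> b))"
    by (intro A.R.finsum_swap) auto
  also have "\<dots> = (\<Oplus>a\<in>?A. f a \<otimes> push h (inv\<^bsub>B\<^esub> \<pi> a \<otimes>\<^bsub>B\<^esub> c))"
  proof (rule A.R.finsum_cong'[OF refl])
    fix a assume a: "a \<in> ?A"
    have bij: "bij_betw (\<lambda>b. a \<otimes>\<^bsub>A\<^esub> b) (?F (inv\<^bsub>B\<^esub> \<pi> a \<otimes>\<^bsub>B\<^esub> c)) (?F c)"
      by (rule bij_betwI[where g = "\<lambda>b. inv\<^bsub>A\<^esub> a \<otimes>\<^bsub>A\<^esub> b"])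
         (use a c in \<open>auto simp: A.H.m_assoc[symmetric] B.H.m_assoc[symmetric]\<close>)
    have "(\<Oplus>b\<in>?F c. f a \<otimes> h (inv\<^bsub>A\<^esub> a \<otimes>\<^bsub>A\<^esub> b))
        = (\<Oplus>b\<in>?F (inv\<^bsub>B\<^esub> \<pi> a \<otimes>\<^bsub>B\<^esub> c). f a \<otimes> h (inv\<^bsub>A\<^esub> a \<otimes>\<^bsub>A\<^esub> (a \<otimes>\<^bsub>A\<^esub> b)))"
      by (rule A.R.finsum_bij[OF bij]) (use a in auto)
    also have "\<dots> = (\<Oplus>b\<in>?F (inv\<^bsub>B\<^esub> \<pi> a \<otimes>\<^bsub>B\<^esub> c). f a \<otimes> h b)"
      using a by (intro A.R.finsum_cong') (auto simp: A.H.m_assoc[symmetric])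
    also have "\<dots> = f a \<otimes> push h (inv\<^bsub>B\<^esub> \<pi> a \<otimes>\<^bsub>B\<^esub> c)"
      using a c by (subst A.R.finsum_rdistr[symmetric]) (auto simp: pushforward_def)
    finally show "(\<Oplus>b\<in>?F c. f a \<otimes> h (inv\<^bsub>A\<^esub> a \<otimes>\<^bsub>A\<^esub> b)) = f a \<otimes> push h (inv\<^bsub>B\<^esub> \<pi> a \<otimes>\<^bsub>B\<^esub> c)" .
  qed (use c in auto)
  also have "\<dots> = (\<Oplus>b\<in>?B. \<Oplus>a\<in>?F b. f a \<otimes> push h (inv\<^bsub>B\<^esub> \<pi> a \<otimes>\<^bsub>B\<^esub> c))"
    by (rule A.R.finsum_fibres[symmetric]) (use c in auto)
  also have "\<dots> = (\<Oplus>b\<in>?B. push f b \<otimes> push h (inv\<^bsub>B\<^esub> b \<otimes>\<^bsub>B\<^esub> c))"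
  proof (rule A.R.finsum_cong'[OF refl])
    fix b assume b: "b \<in> ?B"
    have "(\<Oplus>a\<in>?F b. f a \<otimes> push h (inv\<^bsub>B\<^esub> \<pi> a \<otimes>\<^bsub>B\<^esub> c)) = (\<Oplus>a\<in>?F b. f a \<otimes> push h (inv\<^bsub>B\<^esub> b \<otimes>\<^bsub>B\<^esub> c))"
      using b c by (intro A.R.finsum_cong') auto
    also have "\<dots> = push f b \<otimes> push h (inv\<^bsub>B\<^esub> b \<otimes>\<^bsub>B\<^esub> c)"
      using b c by (subst A.R.finsum_ldistr[symmetric]) (auto simp: pushforward_def[of _ _ _ _ f])
    finally show "(\<Oplus>a\<in>?F b. f a \<otimes> push h (inv\<^bsub>B\<^esub> \<pi> a \<otimes>\<^bsub>B\<^esub> c)) = push f b \<otimes> push h (inv\<^bsub>B\<^esub> b \<otimes>\<^bsub>B\<^esub> c)" .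
  qed (use c push_closed[OF f] in \<open>auto simp: PiE_iff\<close>)
  also have "\<dots> = (push f \<otimes>\<^bsub>group_ring R B\<^esub> push h) c"
    using c by (simp add: B.group_ring_simps)
  finally show "push (f \<otimes>\<^bsub>group_ring R A\<^esub> h) c = (push f \<otimes>\<^bsub>group_ring R B\<^esub> push h) c" .
qed (auto simp: pushforward_def B.group_ring_simps)

end

section \<open>The completed group algebra of an abelian profinite group\<close>

text \<open>An equaliser into a Hausdorff space is closed. Used for the compactness of both inverse
  limits and for sets of approximate solutions.\<close>

lemma closedin_all_eq:
  assumes "Hausdorff_space Y" "\<And>i. i \<in> I \<Longrightarrow> continuous_map X Y (f i)" "\<And>i. i \<in> I \<Longrightarrow> continuous_map X Y (g i)"
  shows "closedin X {x \<in> topspace X. \<forall>i\<in>I. f i x = g i x}"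
proof -
  have "{x \<in> topspace X. \<forall>i\<in>I. f i x = g i x} = \<Inter>(insert (topspace X) ((\<lambda>i. {x \<in> topspace X. f i x = g i x}) ` I))"
    by auto
  moreover have "closedin X \<dots>"
    using closedin_continuous_maps_eq[OF assms] by (intro closedin_Inter) auto
  ultimately show ?thesis by simp
qed

lemma (in profinite_ring) continuous_finsum:
  assumes "finite A" "\<And>a. a \<in> A \<Longrightarrow> continuous_map Z (rtop R) (f a)"
  shows "continuous_map Z (rtop R) (\<lambda>z. \<Oplus>\<^bsub>R\<^esub>a\<in>A. f a z)"
  using assms
proof (induction A)
  case (insert a A)
  have "f b z \<in> carrier R" if "b \<in> insert a A" "z \<in> topspace Z" for b z
    using continuous_map_image_subset_topspace[OF insert.prems[OF that(1)]] that(2) by auto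
  then have eq: "f a z \<oplus>\<^bsub>R\<^esub> (\<Oplus>\<^bsub>R\<^esub>a\<in>A. f a z) = (\<Oplus>\<^bsub>R\<^esub>a\<in>insert a A. f a z)" if "z \<in> topspace Z" for z
    using that insert.hyps by (simp add: Pi_def)
  have "continuous_map Z (rtop R) (\<lambda>z. f a z \<oplus>\<^bsub>R\<^esub> (\<Oplus>\<^bsub>R\<^esub>a\<in>A. f a z))"
    using continuous_add[OF profinite, of Z "f a" "\<lambda>z. \<Oplus>\<^bsub>R\<^esub>a\<in>A. f a z"] insert by simp
  then show ?case by (rule continuous_map_eq) (rule eq)
qed simp

text \<open>Profiniteness of \<open>G\<close> enters through the finiteness of the quotients by open
  normal subgroups, which makes every level an ordinary group ring.\<close>

locale abelian_completion = R: profinite_ring R + G: comm_group G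
  for R :: "'r topring" and G :: "'g topgroup" +
  assumes topspace_G: "topspace (gtop G) = carrier G"
    and finite_quotient: "\<And>U. U \<in> open_normal_subgroups G \<Longrightarrow> finite (carrier (G Mod U))"
begin

abbreviation "\<N> \<equiv> open_normal_subgroups G"
abbreviation "\<Lambda> \<equiv> completed_group_algebra R G"

text \<open>For \<open>U \<subseteq> V\<close> this product set is the \<open>V\<close>-coset
  containing the \<open>U\<close>-coset \<open>b\<close>, obtained without choosing a
  representative.\<close>

definition proj :: "'g set \<Rightarrow> 'g set \<Rightarrow> 'g set" where "proj V b = V <#>\<^bsub>G\<^esub> b"

lemma subgroup_N: "U \<in> \<N> \<Longrightarrow> subgroup U G" and normal_N: "U \<in> \<N> \<Longrightarrow> normal U G"
  unfolding open_normal_subgroups_def using normal_imp_subgroup by auto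

lemma N_Int: "U \<in> \<N> \<Longrightarrow> V \<in> \<N> \<Longrightarrow> U \<inter> V \<in> \<N>"
  unfolding open_normal_subgroups_def
  by (auto simp: G.normal_iff_subgroup intro: G.subgroups_Inter_pair openin_Int)

lemma carrier_in_N: "carrier G \<in> \<N>"
  unfolding open_normal_subgroups_def
  using G.subgroup_self openin_topspace[of "gtop G"] by (simp add: G.normal_iff_subgroup topspace_G)

lemma coset_cases:
  assumes "b \<in> carrier (G Mod U)" obtains g where "g \<in> carrier G" "b = U #>\<^bsub>G\<^esub> g"
  using assms by (auto simp: carrier_FactGroup)

lemma coset_in [simp]: "g \<in> carrier G \<Longrightarrow> U #>\<^bsub>G\<^esub> g \<in> carrier (G Mod U)"
  by (auto simp: carrier_FactGroup)

lemma group_ring_Mod: "U \<in> \<N> \<Longrightarrow> finite_group_ring R (G Mod U)"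
  by (intro finite_group_ring.intro finite_group_ring_axioms.intro R.cring
      G.abelian_FactGroup subgroup_N finite_quotient)

lemma proj_coset:
  assumes "U \<in> \<N>" "V \<in> \<N>" "U \<subseteq> V" "g \<in> carrier G"
  shows "proj V (U #>\<^bsub>G\<^esub> g) = V #>\<^bsub>G\<^esub> g"
proof -
  have sub: "V \<subseteq> carrier G" "U \<subseteq> carrier G" using assms subgroup_N subgroup.subset by blast+
  have "V <#>\<^bsub>G\<^esub> U = V"
  proof
    show "V <#>\<^bsub>G\<^esub> U \<subseteq> V"
      using assms subgroup.m_closed[OF subgroup_N[OF assms(2)]] by (auto simp: set_mult_def)
    show "V \<subseteq> V <#>\<^bsub>G\<^esub> U"
      using sub subgroup.one_closed[OF subgroup_N[OF assms(1)]] by (force simp: set_mult_def)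
  qed
  then show ?thesis using G.setmult_rcos_assoc[OF sub assms(4)] by (simp add: proj_def)
qed

text \<open>Turns the inclusion of cosets in the definition of the transition maps into membership
  in a fibre of \<open>proj V\<close>, so that these maps become pushforwards along group
  homomorphisms.\<close>

lemma subset_coset_iff:
  assumes "U \<in> \<N>" "V \<in> \<N>" "U \<subseteq> V" "b \<in> carrier (G Mod U)" "c \<in> carrier (G Mod V)"
  shows "b \<subseteq> c \<longleftrightarrow> proj V b = c"
proof -
  obtain g where g: "g \<in> carrier G" "b = U #>\<^bsub>G\<^esub> g" using coset_cases[OF assms(4)] .
  obtain h where h: "h \<in> carrier G" "c = V #>\<^bsub>G\<^esub> h" using coset_cases[OF assms(5)] .
  have eq: "proj V b = V #>\<^bsub>G\<^esub> g" using proj_coset assms g by simp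
  show ?thesis
  proof
    assume "b \<subseteq> c"
    then have "g \<in> V #>\<^bsub>G\<^esub> h" using g h G.rcos_self[OF _ subgroup_N[OF assms(1)]] by blast
    then show "proj V b = c" using eq h G.repr_independence[OF _ _ subgroup_N[OF assms(2)]] by metis
  next
    assume "proj V b = c"
    then show "b \<subseteq> c" using eq g assms(3) by (auto simp: r_coset_def)
  qed
qed

lemma group_ring_hom_proj:
  assumes "U \<in> \<N>" "V \<in> \<N>" "U \<subseteq> V"
  shows "finite_group_ring_hom R (G Mod U) (G Mod V) (proj V)"
proof (intro finite_group_ring_hom.intro finite_group_ring_hom_axioms.intro group_ring_Mod assms)
  show "proj V \<in> hom (G Mod U) (G Mod V)"
  proof (rule homI)
    fix b c assume "b \<in> carrier (G Mod U)" "c \<in> carrier (G Mod U)"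
    then obtain g h where "g \<in> carrier G" "b = U #>\<^bsub>G\<^esub> g" "h \<in> carrier G" "c = U #>\<^bsub>G\<^esub> h"
      by (metis coset_cases)
    then show "proj V (b \<otimes>\<^bsub>G Mod U\<^esub> c) = proj V b \<otimes>\<^bsub>G Mod V\<^esub> proj V c"
      using assms by (simp add: normal.rcos_sum[OF normal_N] proj_coset)
  next
    fix b assume "b \<in> carrier (G Mod U)"
    then show "proj V b \<in> carrier (G Mod V)" using assms by (auto elim!: coset_cases simp: proj_coset)
  qed
qed

abbreviation "push U V \<equiv> pushforward R (carrier (G Mod U)) (carrier (G Mod V)) (proj V)"

lemma Lambda_simps:
  "\<zero>\<^bsub>\<Lambda>\<^esub> = (\<lambda>U\<in>\<N>. \<zero>\<^bsub>group_ring R (G Mod U)\<^esub>)"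
  "\<one>\<^bsub>\<Lambda>\<^esub> = (\<lambda>U\<in>\<N>. \<one>\<^bsub>group_ring R (G Mod U)\<^esub>)"
  "x \<oplus>\<^bsub>\<Lambda>\<^esub> y = (\<lambda>U\<in>\<N>. x U \<oplus>\<^bsub>group_ring R (G Mod U)\<^esub> y U)"
  "x \<otimes>\<^bsub>\<Lambda>\<^esub> y = (\<lambda>U\<in>\<N>. x U \<otimes>\<^bsub>group_ring R (G Mod U)\<^esub> y U)"
  by (simp_all add: completed_group_algebra_def Let_def)

lemma Lambda_at:
  assumes "U \<in> \<N>"
  shows "\<zero>\<^bsub>\<Lambda>\<^esub> U = \<zero>\<^bsub>group_ring R (G Mod U)\<^esub>"
  "\<one>\<^bsub>\<Lambda>\<^esub> U = \<one>\<^bsub>group_ring R (G Mod U)\<^esub>"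
  "(x \<oplus>\<^bsub>\<Lambda>\<^esub> y) U = x U \<oplus>\<^bsub>group_ring R (G Mod U)\<^esub> y U"
  "(x \<otimes>\<^bsub>\<Lambda>\<^esub> y) U = x U \<otimes>\<^bsub>group_ring R (G Mod U)\<^esub> y U"
  using assms by (simp_all add: Lambda_simps)

lemma Lambda_ext [simp]:
  "\<zero>\<^bsub>\<Lambda>\<^esub> \<in> extensional \<N>" "\<one>\<^bsub>\<Lambda>\<^esub> \<in> extensional \<N>" "x \<oplus>\<^bsub>\<Lambda>\<^esub> y \<in> extensional \<N>" "x \<otimes>\<^bsub>\<Lambda>\<^esub> y \<in> extensional \<N>"
  by (simp_all add: Lambda_simps)

text \<open>Expressing compatibility by \<open>push\<close> makes closure under the ring operations
  a consequence of \<open>push\<close> being additive and multiplicative.\<close>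

lemma Lambda_carrier:
  "x \<in> carrier \<Lambda> \<longleftrightarrow> x \<in> extensional \<N> \<and> (\<forall>U\<in>\<N>. x U \<in> carrier (G Mod U) \<rightarrow>\<^sub>E carrier R) \<and>
    (\<forall>U\<in>\<N>. \<forall>V\<in>\<N>. U \<subseteq> V \<longrightarrow> x V = push U V (x U))"
proof -
  have *: "(\<forall>c\<in>carrier (G Mod V). x V c = (\<Oplus>\<^bsub>R\<^esub>b\<in>{b\<in>carrier (G Mod U). b \<subseteq> c}. x U b)) \<longleftrightarrow> x V = push U V (x U)"
    if UV: "U \<in> \<N>" "V \<in> \<N>" "U \<subseteq> V" and V: "x V \<in> carrier (G Mod V) \<rightarrow>\<^sub>E carrier R" for U V
  proof -
    have "{b\<in>carrier (G Mod U). b \<subseteq> c} = {b\<in>carrier (G Mod U). proj V b = c}" if "c \<in> carrier (G Mod V)" for c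
      using subset_coset_iff[OF UV _ that] by blast
    then have "(\<forall>c\<in>carrier (G Mod V). x V c = (\<Oplus>\<^bsub>R\<^esub>b\<in>{b\<in>carrier (G Mod U). b \<subseteq> c}. x U b))
        \<longleftrightarrow> (\<forall>c\<in>carrier (G Mod V). x V c = push U V (x U) c)" by (simp add: pushforward_def)
    also have "\<dots> \<longleftrightarrow> x V = push U V (x U)"
      using V by (auto simp: pushforward_def PiE_iff intro: extensionalityI[of _ "carrier (G Mod V)"])
    finally show ?thesis .
  qed
  have "x \<in> carrier \<Lambda> \<longleftrightarrow> x \<in> (\<Pi>\<^sub>E U\<in>\<N>. carrier (group_ring R (G Mod U))) \<and>
      (\<forall>U\<in>\<N>. \<forall>V\<in>\<N>. U \<subseteq> V \<longrightarrow> (\<forall>c\<in>carrier (G Mod V).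
        x V c = (\<Oplus>\<^bsub>R\<^esub>b\<in>{b\<in>carrier (G Mod U). b \<subseteq> c}. x U b)))"
    by (simp add: completed_group_algebra_def Let_def)
  moreover have "x \<in> (\<Pi>\<^sub>E U\<in>\<N>. carrier (group_ring R (G Mod U))) \<longleftrightarrow>
      x \<in> extensional \<N> \<and> (\<forall>U\<in>\<N>. x U \<in> carrier (G Mod U) \<rightarrow>\<^sub>E carrier R)"
    unfolding PiE_iff[of x] by (auto simp: group_ring_def)
  ultimately show ?thesis using * by meson
qed

lemma LambdaD:
  assumes "x \<in> carrier \<Lambda>"
  shows "x \<in> extensional \<N>" "\<And>U. U \<in> \<N> \<Longrightarrow> x U \<in> carrier (G Mod U) \<rightarrow>\<^sub>E carrier R"
    "\<And>U V. U \<in> \<N> \<Longrightarrow> V \<in> \<N> \<Longrightarrow> U \<subseteq> V \<Longrightarrow> x V = push U V (x U)"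
    "\<And>U b. U \<in> \<N> \<Longrightarrow> b \<in> carrier (G Mod U) \<Longrightarrow> x U b \<in> carrier R"
proof -
  show "x \<in> extensional \<N>" using assms unfolding Lambda_carrier by blast
  show 1: "x U \<in> carrier (G Mod U) \<rightarrow>\<^sub>E carrier R" if "U \<in> \<N>" for U
    using assms that unfolding Lambda_carrier by blast
  show "x V = push U V (x U)" if "U \<in> \<N>" "V \<in> \<N>" "U \<subseteq> V" for U V
    using assms that unfolding Lambda_carrier by blast
  show "x U b \<in> carrier R" if "U \<in> \<N>" "b \<in> carrier (G Mod U)" for U b
    using 1[OF that(1)] that(2) by auto
qed

lemma Lambda_eqI:
  assumes "x \<in> carrier \<Lambda>" "y \<in> carrier \<Lambda>"
    and "\<And>U b. U \<in> \<N> \<Longrightarrow> b \<in> carrier (G Mod U) \<Longrightarrow> x U b = y U b"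
  shows "x = y"
proof (rule extensionalityI[of _ \<N>])
  fix U assume U: "U \<in> \<N>"
  then show "x U = y U"
    by (intro PiE_ext[OF LambdaD(2)[OF assms(1) U] LambdaD(2)[OF assms(2) U]] assms(3))
qed (use assms in \<open>auto dest: LambdaD(1)\<close>)

lemma Lambda_add_apply:
  "U \<in> \<N> \<Longrightarrow> b \<in> carrier (G Mod U) \<Longrightarrow> (x \<oplus>\<^bsub>\<Lambda>\<^esub> y) U b = x U b \<oplus>\<^bsub>R\<^esub> y U b"
  by (simp add: Lambda_simps group_ring_def)

lemma Lambda_zero_apply:
  "U \<in> \<N> \<Longrightarrow> b \<in> carrier (G Mod U) \<Longrightarrow> \<zero>\<^bsub>\<Lambda>\<^esub> U b = \<zero>\<^bsub>R\<^esub>"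
  by (simp add: Lambda_simps group_ring_def)

lemma Lambda_mult_apply:
  "U \<in> \<N> \<Longrightarrow> b \<in> carrier (G Mod U) \<Longrightarrow> (x \<otimes>\<^bsub>\<Lambda>\<^esub> y) U b =
    (\<Oplus>\<^bsub>R\<^esub>a\<in>carrier (G Mod U). x U a \<otimes>\<^bsub>R\<^esub> y U (inv\<^bsub>G Mod U\<^esub> a \<otimes>\<^bsub>G Mod U\<^esub> b))"
  by (simp add: Lambda_simps group_ring_def)

lemma Lambda_add_closed:
  assumes "x \<in> carrier \<Lambda>" "y \<in> carrier \<Lambda>" shows "x \<oplus>\<^bsub>\<Lambda>\<^esub> y \<in> carrier \<Lambda>"
  unfolding Lambda_carrier
proof (intro conjI ballI impI)
  note X = LambdaD[OF assms(1)] and Y = LambdaD[OF assms(2)]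
  fix U assume U: "U \<in> \<N>"
  show "(x \<oplus>\<^bsub>\<Lambda>\<^esub> y) U \<in> carrier (G Mod U) \<rightarrow>\<^sub>E carrier R"
    unfolding Lambda_at[OF U] finite_group_ring.group_ring_simps[OF group_ring_Mod[OF U]] using X(4)[OF U] Y(4)[OF U] by auto
  fix V assume V: "V \<in> \<N>" "U \<subseteq> V"
  show "(x \<oplus>\<^bsub>\<Lambda>\<^esub> y) V = push U V ((x \<oplus>\<^bsub>\<Lambda>\<^esub> y) U)"
    unfolding Lambda_at[OF U] Lambda_at[OF V(1)] finite_group_ring_hom.push_add[OF group_ring_hom_proj[OF U V] X(2)[OF U] Y(2)[OF U]]
      X(3)[OF U V, symmetric] Y(3)[OF U V, symmetric] ..
qed simp

lemma Lambda_mult_closed: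
  assumes "x \<in> carrier \<Lambda>" "y \<in> carrier \<Lambda>" shows "x \<otimes>\<^bsub>\<Lambda>\<^esub> y \<in> carrier \<Lambda>"
  unfolding Lambda_carrier
proof (intro conjI ballI impI)
  note X = LambdaD[OF assms(1)] and Y = LambdaD[OF assms(2)]
  fix U assume U: "U \<in> \<N>"
  show "(x \<otimes>\<^bsub>\<Lambda>\<^esub> y) U \<in> carrier (G Mod U) \<rightarrow>\<^sub>E carrier R"
    unfolding Lambda_at[OF U] by (rule finite_group_ring.mult_closed[OF group_ring_Mod[OF U] X(2)[OF U] Y(2)[OF U]])
  fix V assume V: "V \<in> \<N>" "U \<subseteq> V"
  show "(x \<otimes>\<^bsub>\<Lambda>\<^esub> y) V = push U V ((x \<otimes>\<^bsub>\<Lambda>\<^esub> y) U)"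
    unfolding Lambda_at[OF U] Lambda_at[OF V(1)] finite_group_ring_hom.push_mult[OF group_ring_hom_proj[OF U V] X(2)[OF U] Y(2)[OF U]]
      X(3)[OF U V, symmetric] Y(3)[OF U V, symmetric] ..
qed simp

section \<open>Group elements inside the completed algebra\<close>

definition dirac :: "'r \<Rightarrow> 'g \<Rightarrow> 'g set \<Rightarrow> 'g set \<Rightarrow> 'r" where
  "dirac c g = (\<lambda>U\<in>\<N>. finite_group_ring.delta R (G Mod U) c (U #>\<^bsub>G\<^esub> g))"

lemma dirac_at: "U \<in> \<N> \<Longrightarrow> dirac c g U = finite_group_ring.delta R (G Mod U) c (U #>\<^bsub>G\<^esub> g)"
  by (simp add: dirac_def)

lemma dirac_closed [simp]:
  assumes "c \<in> carrier R" "g \<in> carrier G" shows "dirac c g \<in> carrier \<Lambda>"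
  unfolding Lambda_carrier
proof (intro conjI ballI impI)
  fix U assume U: "U \<in> \<N>"
  show "dirac c g U \<in> carrier (G Mod U) \<rightarrow>\<^sub>E carrier R"
    unfolding dirac_at[OF U] by (rule finite_group_ring.delta_closed[OF group_ring_Mod[OF U] assms(1)])
  fix V assume V: "V \<in> \<N>" "U \<subseteq> V"
  show "dirac c g V = push U V (dirac c g U)"
    unfolding dirac_at[OF U] dirac_at[OF V(1)] finite_group_ring_hom.push_delta[OF group_ring_hom_proj[OF U V] assms(1) coset_in[OF assms(2)]]
      proj_coset[OF U V assms(2)] ..
qed (simp add: dirac_def)

lemma dirac_apply:
  assumes "U \<in> \<N>" "b \<in> carrier (G Mod U)"
  shows "dirac c g U b = (if b = U #>\<^bsub>G\<^esub> g then c else \<zero>\<^bsub>R\<^esub>)"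
proof -
  show ?thesis unfolding dirac_at[OF assms(1)] finite_group_ring.delta_def[OF group_ring_Mod[OF assms(1)]] using assms(2) by simp
qed

lemma coset_one: "U \<in> \<N> \<Longrightarrow> U #>\<^bsub>G\<^esub> \<one>\<^bsub>G\<^esub> = U"
  using G.coset_mult_one subgroup.subset[OF subgroup_N] by blast

lemma one_dirac: "\<one>\<^bsub>\<Lambda>\<^esub> = dirac \<one>\<^bsub>R\<^esub> \<one>\<^bsub>G\<^esub>"
  unfolding Lambda_simps dirac_def
proof (rule restrict_ext)
  fix U assume U: "U \<in> \<N>"
  show "\<one>\<^bsub>group_ring R (G Mod U)\<^esub> = finite_group_ring.delta R (G Mod U) \<one>\<^bsub>R\<^esub> (U #>\<^bsub>G\<^esub> \<one>\<^bsub>G\<^esub>)"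
    unfolding coset_one[OF U] finite_group_ring.one_delta[OF group_ring_Mod[OF U]] one_FactGroup ..
qed

lemma scalar_embedding_dirac: "scalar_embedding R G c = dirac c \<one>\<^bsub>G\<^esub>"
  unfolding scalar_embedding_def dirac_def
proof (rule restrict_ext)
  fix U assume U: "U \<in> \<N>"
  show "(\<lambda>b\<in>carrier (G Mod U). if b = U then c else \<zero>\<^bsub>R\<^esub>) = finite_group_ring.delta R (G Mod U) c (U #>\<^bsub>G\<^esub> \<one>\<^bsub>G\<^esub>)"
    unfolding coset_one[OF U] finite_group_ring.delta_def[OF group_ring_Mod[OF U]] ..
qed

lemma Mod_inv_coset:
  "U \<in> \<N> \<Longrightarrow> g \<in> carrier G \<Longrightarrow> inv\<^bsub>G Mod U\<^esub> (U #>\<^bsub>G\<^esub> g) = U #>\<^bsub>G\<^esub> inv\<^bsub>G\<^esub> g"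
  using normal.inv_FactGroup[OF normal_N] normal.rcos_inv[OF normal_N] by simp

text \<open>The convolution has a single nonzero term, so multiplication by a group element merely
  translates coefficients.\<close>

lemma dirac_mult_apply:
  assumes "c \<in> carrier R" "g \<in> carrier G" "x \<in> carrier \<Lambda>" "U \<in> \<N>" "h \<in> carrier G"
  shows "(dirac c g \<otimes>\<^bsub>\<Lambda>\<^esub> x) U (U #>\<^bsub>G\<^esub> h) = c \<otimes>\<^bsub>R\<^esub> x U (U #>\<^bsub>G\<^esub> (inv\<^bsub>G\<^esub> g \<otimes>\<^bsub>G\<^esub> h))"
proof -
  have "inv\<^bsub>G Mod U\<^esub> (U #>\<^bsub>G\<^esub> g) \<otimes>\<^bsub>G Mod U\<^esub> (U #>\<^bsub>G\<^esub> h) = U #>\<^bsub>G\<^esub> (inv\<^bsub>G\<^esub> g \<otimes>\<^bsub>G\<^esub> h)"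
    unfolding Mod_inv_coset[OF assms(4,2)] mult_FactGroup
    using assms by (intro normal.rcos_sum[OF normal_N]) auto
  then show ?thesis
    unfolding Lambda_at[OF assms(4)] dirac_at[OF assms(4)]
      finite_group_ring.delta_mult[OF group_ring_Mod[OF assms(4)] assms(1) coset_in[OF assms(2)] LambdaD(2)[OF assms(3,4)]]
    using assms(5) by simp
qed

lemma Lambda_cring: "cring \<Lambda>"
proof (rule cringI)
  have zero: "\<zero>\<^bsub>\<Lambda>\<^esub> = dirac \<zero>\<^bsub>R\<^esub> \<one>\<^bsub>G\<^esub>"
    unfolding dirac_def Lambda_simps
  proof (rule restrict_ext)
    fix U assume U: "U \<in> \<N>"
    show "\<zero>\<^bsub>group_ring R (G Mod U)\<^esub> = finite_group_ring.delta R (G Mod U) \<zero>\<^bsub>R\<^esub> (U #>\<^bsub>G\<^esub> \<one>\<^bsub>G\<^esub>)"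
      unfolding finite_group_ring.group_ring_simps[OF group_ring_Mod[OF U]] finite_group_ring.delta_def[OF group_ring_Mod[OF U]] by (rule restrict_ext) simp
  qed
  show "abelian_group \<Lambda>"
  proof (rule abelian_groupI)
    show z: "\<zero>\<^bsub>\<Lambda>\<^esub> \<in> carrier \<Lambda>" unfolding zero by simp
    fix x assume x: "x \<in> carrier \<Lambda>"
    show "\<zero>\<^bsub>\<Lambda>\<^esub> \<oplus>\<^bsub>\<Lambda>\<^esub> x = x"
      by (rule Lambda_eqI) (use x z Lambda_add_closed in \<open>auto simp: Lambda_add_apply Lambda_zero_apply LambdaD(4)\<close>)
    \<comment> \<open>The negative is a product with minus one, so its membership in
      \<open>\<Lambda>\<close> comes from closure under multiplication.\<close>
    let ?y = "dirac (\<ominus>\<^bsub>R\<^esub> \<one>\<^bsub>R\<^esub>) \<one>\<^bsub>G\<^esub> \<otimes>\<^bsub>\<Lambda>\<^esub> x"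
    have y: "?y \<in> carrier \<Lambda>" using x by (intro Lambda_mult_closed) auto
    have "?y \<oplus>\<^bsub>\<Lambda>\<^esub> x = \<zero>\<^bsub>\<Lambda>\<^esub>"
    proof (rule Lambda_eqI)
      fix U b assume U: "U \<in> \<N>" and b: "b \<in> carrier (G Mod U)"
      obtain g where g: "g \<in> carrier G" "b = U #>\<^bsub>G\<^esub> g" using coset_cases[OF b] .
      then show "(?y \<oplus>\<^bsub>\<Lambda>\<^esub> x) U b = \<zero>\<^bsub>\<Lambda>\<^esub> U b"
        using U x b LambdaD(4)[OF x U b]
        by (simp add: Lambda_add_apply Lambda_zero_apply dirac_mult_apply R.l_minus R.l_neg)
    qed (use x y z Lambda_add_closed in auto)
    then show "\<exists>y\<in>carrier \<Lambda>. y \<oplus>\<^bsub>\<Lambda>\<^esub> x = \<zero>\<^bsub>\<Lambda>\<^esub>" using y by blast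
    fix y assume y: "y \<in> carrier \<Lambda>"
    show "x \<oplus>\<^bsub>\<Lambda>\<^esub> y \<in> carrier \<Lambda>" by (rule Lambda_add_closed[OF x y])
    show "x \<oplus>\<^bsub>\<Lambda>\<^esub> y = y \<oplus>\<^bsub>\<Lambda>\<^esub> x"
      by (rule Lambda_eqI) (use x y Lambda_add_closed in \<open>auto simp: Lambda_add_apply LambdaD(4) R.a_comm\<close>)
    fix z assume z: "z \<in> carrier \<Lambda>"
    show "(x \<oplus>\<^bsub>\<Lambda>\<^esub> y) \<oplus>\<^bsub>\<Lambda>\<^esub> z = x \<oplus>\<^bsub>\<Lambda>\<^esub> (y \<oplus>\<^bsub>\<Lambda>\<^esub> z)"
      by (rule Lambda_eqI) (use x y z Lambda_add_closed in \<open>auto simp: Lambda_add_apply LambdaD(4) R.a_assoc\<close>)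
  qed
  show "comm_monoid \<Lambda>"
  proof (rule comm_monoidI)
    show "\<one>\<^bsub>\<Lambda>\<^esub> \<in> carrier \<Lambda>" unfolding one_dirac by simp
    fix x assume x: "x \<in> carrier \<Lambda>"
    show "\<one>\<^bsub>\<Lambda>\<^esub> \<otimes>\<^bsub>\<Lambda>\<^esub> x = x"
    proof (rule extensionalityI[of _ \<N>])
      fix U assume U: "U \<in> \<N>"
      show "(\<one>\<^bsub>\<Lambda>\<^esub> \<otimes>\<^bsub>\<Lambda>\<^esub> x) U = x U"
        unfolding Lambda_at[OF U] by (rule finite_group_ring.one_mult[OF group_ring_Mod[OF U] LambdaD(2)[OF x U]])
    qed (use LambdaD(1)[OF x] in auto)
    fix y assume y: "y \<in> carrier \<Lambda>"
    show "x \<otimes>\<^bsub>\<Lambda>\<^esub> y \<in> carrier \<Lambda>" by (rule Lambda_mult_closed[OF x y])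
    show "x \<otimes>\<^bsub>\<Lambda>\<^esub> y = y \<otimes>\<^bsub>\<Lambda>\<^esub> x"
      unfolding Lambda_simps
    proof (rule restrict_ext)
      fix U assume U: "U \<in> \<N>"
      show "x U \<otimes>\<^bsub>group_ring R (G Mod U)\<^esub> y U = y U \<otimes>\<^bsub>group_ring R (G Mod U)\<^esub> x U"
        by (rule finite_group_ring.mult_comm[OF group_ring_Mod[OF U] LambdaD(2)[OF x U] LambdaD(2)[OF y U]])
    qed
    fix z assume z: "z \<in> carrier \<Lambda>"
    show "x \<otimes>\<^bsub>\<Lambda>\<^esub> y \<otimes>\<^bsub>\<Lambda>\<^esub> z = x \<otimes>\<^bsub>\<Lambda>\<^esub> (y \<otimes>\<^bsub>\<Lambda>\<^esub> z)"
    proof (rule extensionalityI[of _ \<N>])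
      fix U assume U: "U \<in> \<N>"
      show "(x \<otimes>\<^bsub>\<Lambda>\<^esub> y \<otimes>\<^bsub>\<Lambda>\<^esub> z) U = (x \<otimes>\<^bsub>\<Lambda>\<^esub> (y \<otimes>\<^bsub>\<Lambda>\<^esub> z)) U"
        unfolding Lambda_at[OF U] by (rule finite_group_ring.mult_assoc[OF group_ring_Mod[OF U] LambdaD(2)[OF x U] LambdaD(2)[OF y U] LambdaD(2)[OF z U]])
    qed simp_all
  qed
  fix x y z assume x: "x \<in> carrier \<Lambda>" and y: "y \<in> carrier \<Lambda>" and z: "z \<in> carrier \<Lambda>"
  show "(x \<oplus>\<^bsub>\<Lambda>\<^esub> y) \<otimes>\<^bsub>\<Lambda>\<^esub> z = x \<otimes>\<^bsub>\<Lambda>\<^esub> z \<oplus>\<^bsub>\<Lambda>\<^esub> y \<otimes>\<^bsub>\<Lambda>\<^esub> z"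
  proof (rule extensionalityI[of _ \<N>])
    fix U assume U: "U \<in> \<N>"
    show "((x \<oplus>\<^bsub>\<Lambda>\<^esub> y) \<otimes>\<^bsub>\<Lambda>\<^esub> z) U = (x \<otimes>\<^bsub>\<Lambda>\<^esub> z \<oplus>\<^bsub>\<Lambda>\<^esub> y \<otimes>\<^bsub>\<Lambda>\<^esub> z) U"
      unfolding Lambda_at[OF U] by (rule finite_group_ring.distrib[OF group_ring_Mod[OF U] LambdaD(2)[OF x U] LambdaD(2)[OF y U] LambdaD(2)[OF z U]])
  qed simp_all
qed

section \<open>Topology of the completed algebra\<close>

abbreviation "big \<equiv> product_topology (\<lambda>U. product_topology (\<lambda>_. rtop R) (carrier (G Mod U))) \<N>"

lemma Lambda_top: "rtop \<Lambda> = subtopology big (carrier \<Lambda>)"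
  by (simp add: completed_group_algebra_def Let_def)

lemma Lambda_subset_big: "carrier \<Lambda> \<subseteq> topspace big"
proof
  fix x assume "x \<in> carrier \<Lambda>"
  from LambdaD(1,2)[OF this] show "x \<in> topspace big" by (simp add: PiE_iff)
qed

lemma topspace_Lambda: "topspace (rtop \<Lambda>) = carrier \<Lambda>"
  unfolding Lambda_top using Lambda_subset_big by auto

lemma big_eval:
  assumes "U \<in> \<N>" "b \<in> carrier (G Mod U)"
  shows "continuous_map big (rtop R) (\<lambda>x. x U b)"
  using continuous_map_compose[OF continuous_map_product_projection[OF assms(1),
        of "\<lambda>U. product_topology (\<lambda>_. rtop R) (carrier (G Mod U))"]
      continuous_map_product_projection[OF assms(2), of "\<lambda>_. rtop R"]] by (simp add: o_def)

lemma continuous_eval: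
  "U \<in> \<N> \<Longrightarrow> b \<in> carrier (G Mod U) \<Longrightarrow> continuous_map (rtop \<Lambda>) (rtop R) (\<lambda>x. x U b)"
  unfolding Lambda_top by (intro continuous_map_from_subtopology big_eval)

lemma continuous_into_Lambda:
  assumes "\<And>z. z \<in> topspace Z \<Longrightarrow> f z \<in> carrier \<Lambda>"
    and "\<And>U b. U \<in> \<N> \<Longrightarrow> b \<in> carrier (G Mod U) \<Longrightarrow> continuous_map Z (rtop R) (\<lambda>z. f z U b)"
  shows "continuous_map Z (rtop \<Lambda>) f"
proof -
  have "continuous_map Z (product_topology (\<lambda>_. rtop R) (carrier (G Mod U))) (\<lambda>z. f z U)" if U: "U \<in> \<N>" for U
    unfolding continuous_map_componentwise
  proof (intro conjI ballI assms(2) U)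
    show "(\<lambda>z. f z U) ` topspace Z \<subseteq> extensional (carrier (G Mod U))"
      using LambdaD(2)[OF assms(1) U] by (auto simp: PiE_def)
  qed
  moreover have "f ` topspace Z \<subseteq> extensional \<N>" using LambdaD(1)[OF assms(1)] by blast
  ultimately show ?thesis
    unfolding Lambda_top continuous_map_in_subtopology continuous_map_componentwise[of Z _ \<N>]
    using assms(1) by blast
qed

text \<open>A closed subset of a Tychonoff product: each triple of two nested levels and a coset of
  the coarser one contributes one equation between continuous functions of the coefficients.\<close>

lemma Lambda_compact: "compact_space (rtop \<Lambda>)"
proof -
  let ?I = "{(U, V, c). U \<in> \<N> \<and> V \<in> \<N> \<and> U \<subseteq> V \<and> c \<in> carrier (G Mod V)}"
  let ?f = "\<lambda>(U, V, c) x. (x :: 'g set \<Rightarrow> 'g set \<Rightarrow> 'r) V c"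
  let ?g = "\<lambda>(U, V, c) x. \<Oplus>\<^bsub>R\<^esub>b\<in>{b \<in> carrier (G Mod U). proj V b = c}. (x :: 'g set \<Rightarrow> 'g set \<Rightarrow> 'r) U b"
  have eq: "carrier \<Lambda> = {x \<in> topspace big. \<forall>i\<in>?I. ?f i x = ?g i x}"
  proof (intro equalityI subsetI)
    fix x assume x: "x \<in> carrier \<Lambda>"
    have eq: "x V c = (\<Oplus>\<^bsub>R\<^esub>b\<in>{b \<in> carrier (G Mod U). proj V b = c}. x U b)"
      if "U \<in> \<N>" "V \<in> \<N>" "U \<subseteq> V" "c \<in> carrier (G Mod V)" for U V c
      using LambdaD(3)[OF x that(1-3)] that(4) by (simp add: pushforward_def)
    have "?f i x = ?g i x" if i: "i \<in> ?I" for i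
    proof -
      obtain U V c where "i = (U, V, c)" by (cases i)
      then show ?thesis using eq[of U V c] i by (simp only: split_conv mem_Collect_eq)
    qed
    then show "x \<in> {x \<in> topspace big. \<forall>i\<in>?I. ?f i x = ?g i x}" using x Lambda_subset_big by blast
  next
    fix x assume x: "x \<in> {x \<in> topspace big. \<forall>i\<in>?I. ?f i x = ?g i x}"
    have "x V = push U V (x U)" if UV: "U \<in> \<N>" "V \<in> \<N>" "U \<subseteq> V" for U V
    proof (rule extensionalityI[of _ "carrier (G Mod V)"])
      fix c assume c: "c \<in> carrier (G Mod V)"
      have "(U, V, c) \<in> ?I" using UV c by simp
      then have "?f (U, V, c) x = ?g (U, V, c) x" using x by blast
      then show "x V c = push U V (x U) c" using c by (simp add: pushforward_def)
    next
      show "x V \<in> extensional (carrier (G Mod V))" using x UV(2) by (simp add: PiE_iff)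
    qed (simp add: pushforward_def)
    moreover have "x \<in> extensional \<N>" "\<forall>U\<in>\<N>. x U \<in> carrier (G Mod U) \<rightarrow>\<^sub>E carrier R"
      using x by (simp_all add: PiE_iff)
    ultimately show "x \<in> carrier \<Lambda>" unfolding Lambda_carrier by blast
  qed
  have cl: "closedin big {x \<in> topspace big. \<forall>i\<in>?I. ?f i x = ?g i x}"
    by (rule closedin_all_eq[OF R.top_facts(4)])
       (auto intro!: big_eval R.continuous_finsum finite_subset[OF _ finite_quotient])
  have cp: "compact_space big"
    using R.top_facts(3) by (auto simp: compact_space_product_topology)
  have "compactin big (carrier \<Lambda>)"
    unfolding eq by (rule closedin_compact_space[OF cp cl])
  then show ?thesis unfolding Lambda_top by (rule compact_space_subtopology)
qed

text \<open>Each coefficient of a product is a finite sum of products of coefficients, so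
  multiplication is continuous coordinate by coordinate.\<close>

lemma Lambda_profinite: "profinite_ring \<Lambda>"
proof
  interpret L: cring \<Lambda> by (rule Lambda_cring)
  have fs: "continuous_map (prod_topology (rtop \<Lambda>) (rtop \<Lambda>)) (rtop R) (\<lambda>z. fst z U b)"
    "continuous_map (prod_topology (rtop \<Lambda>) (rtop \<Lambda>)) (rtop R) (\<lambda>z. snd z U b)"
    if "U \<in> \<N>" "b \<in> carrier (G Mod U)" for U b
    using continuous_map_compose[OF continuous_map_fst continuous_eval[OF that]]
      continuous_map_compose[OF continuous_map_snd continuous_eval[OF that]] by (simp_all add: o_def)
  show "profinite_module \<Lambda> (ring_as_topmod \<Lambda>)"
    unfolding profinite_module_def ring_as_topmod_simps
  proof (intro conjI topspace_Lambda Lambda_compact)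
    show "module \<Lambda> (ring_as_topmod \<Lambda>)"
    proof (rule moduleI[OF Lambda_cring])
      show "abelian_group (ring_as_topmod \<Lambda>)"
        by (rule abelian_groupI) (auto simp: L.a_ac intro: bexI[of _ "\<ominus>\<^bsub>\<Lambda>\<^esub> _"] L.l_neg)
    qed (auto simp: L.l_distr L.r_distr L.m_assoc)
    show "Hausdorff_space (rtop \<Lambda>)"
      unfolding Lambda_top
      by (intro Hausdorff_space_subtopology) (simp add: Hausdorff_space_product_topology R.top_facts)
    show "totally_disconnected_space (rtop \<Lambda>)"
      unfolding Lambda_top
      by (intro totally_disconnected_space_subtopology totally_disconnected_space_product R.top_facts)
    show "continuous_map (prod_topology (rtop \<Lambda>) (rtop \<Lambda>)) (rtop \<Lambda>) (\<lambda>(x, y). x \<oplus>\<^bsub>\<Lambda>\<^esub> y)"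
      unfolding case_prod_unfold
      by (rule continuous_into_Lambda)
         (auto simp: topspace_Lambda Lambda_add_apply intro!: R.continuous_add[OF R.profinite, simplified] fs)
    show "continuous_map (prod_topology (rtop \<Lambda>) (rtop \<Lambda>)) (rtop \<Lambda>) (\<lambda>(x, y). x \<otimes>\<^bsub>\<Lambda>\<^esub> y)"
      unfolding case_prod_unfold
    proof (rule continuous_into_Lambda)
      fix U b assume U: "U \<in> \<N>" and b: "b \<in> carrier (G Mod U)"
      have "group (G Mod U)" by (rule comm_group.axioms(2)[OF G.abelian_FactGroup[OF subgroup_N[OF U]]])
      then have inv: "inv\<^bsub>G Mod U\<^esub> a \<otimes>\<^bsub>G Mod U\<^esub> b \<in> carrier (G Mod U)" if "a \<in> carrier (G Mod U)" for a
        by (intro monoid.m_closed group.is_monoid group.inv_closed that b)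
      show "continuous_map (prod_topology (rtop \<Lambda>) (rtop \<Lambda>)) (rtop R) (\<lambda>z. (fst z \<otimes>\<^bsub>\<Lambda>\<^esub> snd z) U b)"
        unfolding Lambda_mult_apply[OF U b]
        by (intro R.continuous_finsum R.continuous_smult[OF R.profinite, simplified] fs U inv finite_quotient)
    qed (auto simp: topspace_Lambda)
  qed
qed

end

section \<open>The p-adic integers\<close>

locale padic =
  fixes p :: nat
  assumes prime_p: "prime p"
begin

abbreviation "Z \<equiv> Zp p"
abbreviation "q n \<equiv> int p ^ n"

lemma p_gt_1: "int p > 1" using prime_gt_1_nat[OF prime_p] by simp
lemma p_pos [simp]: "0 < p" using p_gt_1 by simp
lemma p_nonzero [simp]: "p \<noteq> 0" using p_pos by simp
lemma q_pos: "q n > 0" by simp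
lemma q_dvd: "m \<le> n \<Longrightarrow> q m dvd q n" by (rule le_imp_power_dvd)
lemma mod_q_mod_q: "m \<le> n \<Longrightarrow> a mod q n mod q m = a mod q m" by (simp add: mod_mod_cancel q_dvd)

lemma Z_carrier: "x \<in> carrier Z \<longleftrightarrow> (\<forall>n. 0 \<le> x n \<and> x n < q n \<and> x (Suc n) mod q n = x n)"
  by (simp add: Zp_def Let_def)

lemma Z_simps:
  "x \<otimes>\<^bsub>Z\<^esub> y = (\<lambda>n. (x n * y n) mod q n)" "\<one>\<^bsub>Z\<^esub> = (\<lambda>n. 1 mod q n)"
  "\<zero>\<^bsub>Z\<^esub> = (\<lambda>n. 0)" "x \<oplus>\<^bsub>Z\<^esub> y = (\<lambda>n. (x n + y n) mod q n)"
  by (simp_all add: Zp_def Let_def)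

lemma Z_top: "rtop Z = subtopology (product_topology (\<lambda>_. discrete_topology UNIV) UNIV) (carrier Z)"
  by (simp add: Zp_def Let_def)

lemma Z_bounds: assumes "x \<in> carrier Z" shows "0 \<le> x n" "x n < q n" using assms by (auto simp: Z_carrier)

lemma Z_mod [simp]: "x \<in> carrier Z \<Longrightarrow> x n mod q n = x n"
  using Z_bounds[of x n] by simp

lemma Z_level: "x \<in> carrier Z \<Longrightarrow> m \<le> n \<Longrightarrow> x n mod q m = x m"
proof (induction n)
  case (Suc n)
  show ?case
  proof (cases "m = Suc n")
    case False
    then have "x (Suc n) mod q m = x (Suc n) mod q n mod q m" using Suc by (simp add: mod_q_mod_q del: power_Suc)
    also have "x (Suc n) mod q n = x n" using Suc by (simp add: Z_carrier)
    finally show ?thesis using Suc False by simp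
  qed (use Suc in \<open>simp del: power_Suc\<close>)
qed (use Z_bounds[of x 0] in simp)

text \<open>Lets a p-adic integer be given by unreduced residues that are compatible modulo
  \<open>q n\<close>.\<close>

lemma Z_closedI:
  assumes "\<And>n. f (Suc n) mod q n = f n mod q n"
  shows "(\<lambda>n. f n mod q n) \<in> carrier Z"
  unfolding Z_carrier
proof
  fix n
  have "f (Suc n) mod q (Suc n) mod q n = f n mod q n" using assms[of n] mod_q_mod_q[of n "Suc n"] by simp
  then show "0 \<le> f n mod q n \<and> f n mod q n < q n \<and> f (Suc n) mod q (Suc n) mod q n = f n mod q n"
    by (simp del: power_Suc)
qed

lemma Z_step: "x \<in> carrier Z \<Longrightarrow> x (Suc n) mod q n = x n mod q n"
  by (simp add: Z_level)

lemma Z_cring: "cring Z"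
proof (rule cringI)
  have zero: "\<zero>\<^bsub>Z\<^esub> \<in> carrier Z" by (simp add: Z_carrier Z_simps)
  have add: "x \<oplus>\<^bsub>Z\<^esub> y \<in> carrier Z" if "x \<in> carrier Z" "y \<in> carrier Z" for x y
    unfolding Z_simps by (intro Z_closedI mod_add_cong Z_step that)
  show "abelian_group Z"
  proof (rule abelian_groupI)
    fix x assume x: "x \<in> carrier Z"
    let ?y = "\<lambda>n. (- x n) mod q n"
    have "?y \<in> carrier Z" by (intro Z_closedI mod_minus_cong Z_step x)
    moreover have "?y \<oplus>\<^bsub>Z\<^esub> x = \<zero>\<^bsub>Z\<^esub>" by (simp add: Z_simps mod_simps)
    ultimately show "\<exists>y\<in>carrier Z. y \<oplus>\<^bsub>Z\<^esub> x = \<zero>\<^bsub>Z\<^esub>" by blast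
  qed (auto simp: zero[unfolded Z_simps] add[unfolded Z_simps] Z_simps mod_simps ac_simps)
  show "comm_monoid Z"
  proof (rule comm_monoidI)
    show "\<one>\<^bsub>Z\<^esub> \<in> carrier Z" unfolding Z_simps by (rule Z_closedI) simp
    show "x \<otimes>\<^bsub>Z\<^esub> y \<in> carrier Z" if "x \<in> carrier Z" "y \<in> carrier Z" for x y
      unfolding Z_simps by (intro Z_closedI mod_mult_cong Z_step that)
  qed (auto simp: Z_simps mod_simps ac_simps)
  show "(x \<oplus>\<^bsub>Z\<^esub> y) \<otimes>\<^bsub>Z\<^esub> z = x \<otimes>\<^bsub>Z\<^esub> z \<oplus>\<^bsub>Z\<^esub> y \<otimes>\<^bsub>Z\<^esub> z" for x y z
    by (simp add: Z_simps mod_simps distrib_right)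
qed

text \<open>A product of two discrete spaces is discrete, so any function of two integer-valued
  coordinates is continuous.\<close>

lemma continuous_discrete_binary:
  assumes "continuous_map X (discrete_topology UNIV) f" "continuous_map X (discrete_topology UNIV) g"
  shows "continuous_map X (discrete_topology UNIV) (\<lambda>x. h (f x) (g x))"
  by (rule continuous_map_binary[OF assms]) (simp add: prod_topology_discrete_topology[symmetric])

lemma continuous_Z_eval: "continuous_map (rtop Z) (discrete_topology UNIV) (\<lambda>x. x n)"
  unfolding Z_top
  by (intro continuous_map_from_subtopology continuous_map_product_projection) simp

lemma continuous_into_Z:
  assumes "\<And>x. x \<in> topspace X \<Longrightarrow> f x \<in> carrier Z"
    and "\<And>n. continuous_map X (discrete_topology UNIV) (\<lambda>x. f x n)"
  shows "continuous_map X (rtop Z) f"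
  unfolding Z_top using assms by (auto simp: continuous_map_in_subtopology continuous_map_componentwise)

lemma topspace_Z: "topspace (rtop Z) = carrier Z"
  by (simp add: Z_top)

text \<open>In the product of copies of the discrete integers, the bounds on residues cut out a
  compact box and the compatibilities a closed subset.\<close>

lemma Z_compact: "compact_space (rtop Z)"
proof -
  let ?X = "product_topology (\<lambda>_::nat. discrete_topology (UNIV :: int set)) UNIV"
  have eq: "carrier Z = PiE UNIV (\<lambda>n. {0..<q n}) \<inter> {x \<in> topspace ?X. \<forall>n\<in>UNIV. x (Suc n) mod q n = x n}"
    by (auto simp: Z_carrier PiE_def Pi_iff)
  have "compactin ?X (PiE UNIV (\<lambda>n. {0..<q n}))"
    by (auto simp: compactin_PiE intro!: finite_imp_compactin)
  moreover have "closedin ?X {x \<in> topspace ?X. \<forall>n\<in>UNIV. x (Suc n) mod q n = x n}"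
  proof (rule closedin_all_eq)
    have pr: "continuous_map ?X (discrete_topology UNIV) (\<lambda>x. x n)" for n
      by (rule continuous_map_product_projection) simp
    show "continuous_map ?X (discrete_topology UNIV) (\<lambda>x. x (Suc n) mod q n)" for n
      using continuous_discrete_binary[OF pr[of "Suc n"] pr[of "Suc n"], of "\<lambda>a b. a mod q n"] by simp
    show "continuous_map ?X (discrete_topology UNIV) (\<lambda>x. x n)" for n by (rule pr)
  qed (rule Hausdorff_space_discrete_topology)
  ultimately have "compactin ?X (carrier Z)" unfolding eq by (rule compact_Int_closedin)
  then show ?thesis unfolding Z_top by (rule compact_space_subtopology)
qed

lemma Z_profinite: "profinite_ring Z"
proof
  interpret cring Z by (rule Z_cring)
  have fs: "continuous_map (prod_topology (rtop Z) (rtop Z)) (discrete_topology UNIV) (\<lambda>z. fst z n)"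
    "continuous_map (prod_topology (rtop Z) (rtop Z)) (discrete_topology UNIV) (\<lambda>z. snd z n)" for n
    using continuous_map_compose[OF continuous_map_fst continuous_Z_eval]
      continuous_map_compose[OF continuous_map_snd continuous_Z_eval] by (simp_all add: o_def)
  show "profinite_module Z (ring_as_topmod Z)"
    unfolding profinite_module_def ring_as_topmod_simps
  proof (intro conjI topspace_Z Z_compact)
    show "module Z (ring_as_topmod Z)"
    proof (rule moduleI[OF Z_cring])
      show "abelian_group (ring_as_topmod Z)"
        by (rule abelian_groupI) (auto simp: a_ac intro: bexI[of _ "\<ominus>\<^bsub>Z\<^esub> _"] l_neg)
    qed (auto simp: l_distr r_distr m_assoc)
    show "Hausdorff_space (rtop Z)"
      unfolding Z_top by (intro Hausdorff_space_subtopology) (simp add: Hausdorff_space_product_topology)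
    show "totally_disconnected_space (rtop Z)"
      unfolding Z_top
      by (intro totally_disconnected_space_subtopology totally_disconnected_space_product
          totally_disconnected_space_discrete)
    show "continuous_map (prod_topology (rtop Z) (rtop Z)) (rtop Z) (\<lambda>(x, y). x \<oplus>\<^bsub>Z\<^esub> y)"
      unfolding case_prod_unfold
    proof (rule continuous_into_Z)
      fix n
      show "continuous_map (prod_topology (rtop Z) (rtop Z)) (discrete_topology UNIV) (\<lambda>z. (fst z \<oplus>\<^bsub>Z\<^esub> snd z) n)"
        unfolding Z_simps by (rule continuous_discrete_binary[OF fs])
    qed (auto simp: topspace_Z)
    show "continuous_map (prod_topology (rtop Z) (rtop Z)) (rtop Z) (\<lambda>(x, y). x \<otimes>\<^bsub>Z\<^esub> y)"
      unfolding case_prod_unfold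
    proof (rule continuous_into_Z)
      fix n
      show "continuous_map (prod_topology (rtop Z) (rtop Z)) (discrete_topology UNIV) (\<lambda>z. (fst z \<otimes>\<^bsub>Z\<^esub> snd z) n)"
        unfolding Z_simps by (rule continuous_discrete_binary[OF fs])
    qed (auto simp: topspace_Z)
  qed
qed

sublocale Z: profinite_ring Z by (rule Z_profinite)

lemma Z_finsum:
  assumes "finite A" "\<And>a. a \<in> A \<Longrightarrow> f a \<in> carrier Z"
  shows "(\<Oplus>\<^bsub>Z\<^esub>a\<in>A. f a) n = (\<Sum>a\<in>A. f a n) mod q n"
  using assms
proof (induction A)
  case (insert a A)
  have "(\<Oplus>\<^bsub>Z\<^esub>a\<in>insert a A. f a) = f a \<oplus>\<^bsub>Z\<^esub> (\<Oplus>\<^bsub>Z\<^esub>a\<in>A. f a)"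
    using insert by (intro Z.finsum_insert) auto
  moreover have "(\<Oplus>\<^bsub>Z\<^esub>a\<in>A. f a) n = (\<Sum>a\<in>A. f a n) mod q n" using insert by simp
  ultimately show ?case using insert.hyps by (simp add: Z_simps mod_add_right_eq)
qed (simp add: Z_simps)

text \<open>A basic open set constrains finitely many coordinates, and a residue determines those at
  all lower levels; hence congruence classes form a neighbourhood base.\<close>

lemma Z_open_nbhd:
  assumes "openin (rtop Z) W" "y \<in> W"
  obtains n where "\<And>z. z \<in> carrier Z \<Longrightarrow> z n = y n \<Longrightarrow> z \<in> W"
proof -
  obtain T where T: "openin (product_topology (\<lambda>_::nat. discrete_topology (UNIV :: int set)) UNIV) T"
      "W = T \<inter> carrier Z"
    using assms(1) unfolding Z_top openin_subtopology by blast
  then obtain B where B: "finite {i. B i \<noteq> UNIV}" "y \<in> PiE UNIV B" "PiE UNIV B \<subseteq> T"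
    using assms(2) product_topology_open_contains_basis[OF T(1), of y] by auto
  \<comment> \<open>Inserting zero keeps the maximum defined when no coordinate is
    constrained.\<close>
  define n where "n = Max (insert 0 {i. B i \<noteq> UNIV})"
  have n: "i \<le> n" if "B i \<noteq> UNIV" for i
    using B(1) that unfolding n_def by (intro Max_ge) auto
  have y: "y \<in> carrier Z" using assms T by blast
  have "z \<in> W" if z: "z \<in> carrier Z" "z n = y n" for z
  proof -
    have "z i \<in> B i" for i
    proof (cases "B i = UNIV")
      case False
      have "z i = y i" using Z_level[OF z(1) n[OF False]] Z_level[OF y n[OF False]] z(2) by simp
      then show ?thesis using B(2) by auto
    qed simp
    then have "z \<in> PiE UNIV B" by auto
    then show ?thesis using B(3) T z by blast
  qed
  then show ?thesis using that by blast
qed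

section \<open>Integers, units and division by powers of p\<close>

definition of_Z :: "int \<Rightarrow> nat \<Rightarrow> int" where "of_Z a = (\<lambda>n. a mod q n)"

lemma of_Z_closed [simp]: "of_Z a \<in> carrier Z"
  unfolding of_Z_def by (rule Z_closedI) simp

lemma of_Z_mult: "of_Z (a * b) = of_Z a \<otimes>\<^bsub>Z\<^esub> of_Z b"
  by (simp add: of_Z_def Z_simps mod_mult_eq)

lemma of_Z_one: "of_Z 1 = \<one>\<^bsub>Z\<^esub>"
  by (simp add: of_Z_def Z_simps)

lemma coprime_q: "coprime a (int p) \<Longrightarrow> coprime a (q n)"
  by simp

text \<open>Inverses exist modulo each \<open>q n\<close>; they are compatible because cancelling
  \<open>a\<close> makes them unique there.\<close>

lemma of_Z_Unit:
  assumes "coprime a (int p)" shows "of_Z a \<in> Units Z"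
proof -
  have "\<exists>b. (a * b) mod q n = 1 mod q n" for n
    using cong_solve_coprime_int[OF coprime_q[OF assms, of n]] by (auto simp: cong_def)
  then obtain b where b: "\<And>n. (a * b n) mod q n = 1 mod q n" by metis
  let ?y = "\<lambda>n. b n mod q n"
  have y: "?y \<in> carrier Z"
  proof (rule Z_closedI)
    fix n
    have "(a * b (Suc n)) mod q n = 1 mod q n"
      using arg_cong[OF b[of "Suc n"], of "\<lambda>x. x mod q n"] by (simp add: mod_q_mod_q[of n "Suc n"] del: power_Suc)
    then have "[a * b (Suc n) = a * b n] (mod q n)" using b[of n] by (simp add: cong_def)
    then have "[b (Suc n) = b n] (mod q n)"
      using coprime_q[OF assms, of n] cong_mult_lcancel[of a "q n"] by blast
    then show "b (Suc n) mod q n = b n mod q n" by (simp add: cong_def)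
  qed
  have "of_Z a \<otimes>\<^bsub>Z\<^esub> ?y = \<one>\<^bsub>Z\<^esub>" by (simp add: of_Z_def Z_simps mod_simps b)
  then show ?thesis using y Z.m_comm[OF y of_Z_closed[of a]] unfolding Units_def by auto
qed

lemma Units_coprime:
  assumes "u \<in> Units Z" shows "coprime (u n) (q n)"
proof -
  obtain v where v: "u \<otimes>\<^bsub>Z\<^esub> v = \<one>\<^bsub>Z\<^esub>" using assms unfolding Units_def by auto
  then have "[u n * v n = 1] (mod q n)" by (auto simp: Z_simps fun_eq_iff cong_def)
  then show ?thesis by (metis coprime_mult_left_iff cong_imp_coprime cong_sym coprime_1_left)
qed

text \<open>Division by \<open>q v\<close> costs \<open>v\<close> digits of precision, so level
  \<open>n\<close> of the quotient is read from level \<open>n + v\<close> of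
  \<open>x\<close>.\<close>

lemma Z_divide_power:
  assumes x: "x \<in> carrier Z" and "x v = 0"
  obtains y where "y \<in> carrier Z" "x = of_Z (q v) \<otimes>\<^bsub>Z\<^esub> y"
proof -
  have dvd: "q v dvd x (n + v)" for n
    using Z_level[OF x, of v "n + v"] assms(2) by (simp add: dvd_eq_mod_eq_0)
  define y where "y n = x (n + v) div q v" for n
  have y: "q v * y n = x (n + v)" for n using dvd[of n] by (simp add: y_def)
  have yc: "y \<in> carrier Z"
    unfolding Z_carrier
  proof (intro allI conjI)
    fix n
    show "0 \<le> y n" using Z_bounds[OF x] by (simp add: y_def pos_imp_zdiv_nonneg_iff)
    have "q v * y n < q v * q n" using y[of n] Z_bounds(2)[OF x, of "n + v"] by (simp add: power_add mult.commute)
    then show "y n < q n" using q_pos[of v] by (simp only: mult_less_cancel_left_pos)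
    have "q v * (y (Suc n) mod q n) = (q v * y (Suc n)) mod (q v * q n)"
      by (rule mult_mod_right)
    also have "q v * q n = q (n + v)" by (simp add: power_add mult.commute)
    also have "(q v * y (Suc n)) mod q (n + v) = q v * y n"
      unfolding y using Z_level[OF x, of "n + v" "Suc n + v"] by simp
    finally show "y (Suc n) mod q n = y n" by simp
  qed
  have "x = of_Z (q v) \<otimes>\<^bsub>Z\<^esub> y"
  proof
    fix n
    have "x n = (q v * y n) mod q n" using Z_level[OF x, of n "n + v"] y[of n] by simp
    then show "x n = (of_Z (q v) \<otimes>\<^bsub>Z\<^esub> y) n" by (simp add: of_Z_def Z_simps mod_mult_left_eq)
  qed
  then show ?thesis using that yc by blast
qed

text \<open>The same shift of precision: level \<open>n + v\<close> of the equation forces level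
  \<open>n\<close> of \<open>x\<close> to vanish.\<close>

lemma Z_power_torsion_free:
  assumes x: "x \<in> carrier Z" and 0: "of_Z (q v) \<otimes>\<^bsub>Z\<^esub> x = \<zero>\<^bsub>Z\<^esub>"
  shows "x = \<zero>\<^bsub>Z\<^esub>"
proof
  fix n
  have "(of_Z (q v) \<otimes>\<^bsub>Z\<^esub> x) (n + v) = 0" by (simp add: 0) (simp add: Z_simps)
  then have "(q v * x (n + v)) mod q (n + v) = 0" by (simp add: of_Z_def Z_simps mod_simps)
  then have "q v * q n dvd q v * x (n + v)" by (simp add: dvd_eq_mod_eq_0 power_add mult.commute)
  then have "q n dvd x (n + v)" by simp
  then show "x n = \<zero>\<^bsub>Z\<^esub> n" using Z_level[OF x, of n "n + v"] by (simp add: Z_simps)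
qed

end

section \<open>The group \<open>\<int>\<^sub>p\<^sup>\<times>\<close> and its characters\<close>

context padic begin

abbreviation "G \<equiv> Zp_units p"

lemma G_simps [simp]:
  "carrier G = Units Z" "mult G = mult Z" "one G = one Z"
  "gtop G = subtopology (rtop Z) (Units Z)"
  by (simp_all add: Zp_units_def monoid.extend_def topgroup.fields_def units_of_def)

lemma G_comm_group: "comm_group G"
proof (rule comm_groupI)
  fix u assume "u \<in> carrier G"
  then show "\<exists>v\<in>carrier G. v \<otimes>\<^bsub>G\<^esub> u = \<one>\<^bsub>G\<^esub>"
    by (intro bexI[of _ "inv\<^bsub>Z\<^esub> u"]) auto
next
  fix u w assume "u \<in> carrier G" "w \<in> carrier G"
  then show "u \<otimes>\<^bsub>G\<^esub> w = w \<otimes>\<^bsub>G\<^esub> u" by (simp add: Z.m_comm Z.Units_closed)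
qed (simp_all add: Z.m_assoc Z.Units_closed)

sublocale G: comm_group G by (rule G_comm_group)

lemma G_apply: "(u \<otimes>\<^bsub>G\<^esub> w) n = (u n * w n) mod q n" "\<one>\<^bsub>G\<^esub> n = 1 mod q n"
  by (simp_all add: Z_simps)

lemma G_inv_apply: "u \<in> carrier G \<Longrightarrow> (u n * (inv\<^bsub>G\<^esub> u) n) mod q n = 1 mod q n"
  using G.r_inv[of u] by (metis G_apply)

text \<open>The congruence subgroup of units in 1 + p^n Z_p; \<open>V 0\<close> is the whole
  group.\<close>

definition V :: "nat \<Rightarrow> (nat \<Rightarrow> int) set" where
  "V n = {u \<in> carrier G. u n = 1 mod q n}"

lemma V_subgroup: "subgroup (V n) G"
proof (rule G.subgroupI)
  show "V n \<noteq> {}" using G.one_closed unfolding V_def by (auto simp: Z_simps)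
  fix u assume u: "u \<in> V n"
  then have uG: "u \<in> carrier G" "u n = 1 mod q n" by (auto simp: V_def)
  have i: "inv\<^bsub>G\<^esub> u \<in> carrier G" using uG by blast
  have "(inv\<^bsub>G\<^esub> u) n = (1 * (inv\<^bsub>G\<^esub> u) n) mod q n"
    using i by (simp add: Z.Units_closed)
  also have "\<dots> = (u n * (inv\<^bsub>G\<^esub> u) n) mod q n" unfolding uG(2) by (simp add: mod_mult_left_eq)
  finally show "inv\<^bsub>G\<^esub> u \<in> V n" using i G_inv_apply[OF uG(1)] by (simp add: V_def)
  fix w assume "w \<in> V n"
  then have wG: "w \<in> carrier G" "w n = 1 mod q n" by (auto simp: V_def)
  have "(u \<otimes>\<^bsub>G\<^esub> w) n = 1 mod q n" unfolding G_apply uG wG by (simp add: mod_simps)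
  then show "u \<otimes>\<^bsub>G\<^esub> w \<in> V n" using G.m_closed[OF uG(1) wG(1)] by (simp add: V_def del: G_simps)
qed (auto simp: V_def)

text \<open>Multiplying by an element congruent to one keeps the residue, and the quotient of two
  units with equal residues is congruent to one. The cosets of \<open>V n\<close> can therefore be
  handled as residues.\<close>

lemma V_coset_iff:
  assumes u: "u \<in> carrier G" and w: "w \<in> carrier G"
  shows "u \<in> V n #>\<^bsub>G\<^esub> w \<longleftrightarrow> u n = w n"
proof
  assume "u \<in> V n #>\<^bsub>G\<^esub> w"
  then obtain v where v: "v n = 1 mod q n" "u = v \<otimes>\<^bsub>Z\<^esub> w" by (auto simp: r_coset_def V_def)
  then have "u n = (1 * w n) mod q n" by (simp add: Z_simps mod_mult_left_eq)
  then show "u n = w n" using w by (simp add: Z.Units_closed)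
next
  assume eq: "u n = w n"
  let ?v = "u \<otimes>\<^bsub>G\<^esub> inv\<^bsub>G\<^esub> w"
  have "?v n = 1 mod q n" unfolding G_apply eq by (rule G_inv_apply[OF w])
  moreover have "?v \<in> carrier G" using u w by blast
  ultimately have "?v \<in> V n" by (simp add: V_def)
  moreover have "u = ?v \<otimes>\<^bsub>G\<^esub> w" using u w by (simp only: G.m_assoc G.inv_closed G.l_inv G.r_one)
  ultimately show "u \<in> V n #>\<^bsub>G\<^esub> w" unfolding r_coset_def by blast
qed

lemma V_open: "openin (gtop G) (V n)"
proof -
  have "openin (rtop Z) {x \<in> topspace (rtop Z). x n \<in> {1 mod q n}}"
    by (rule openin_continuous_map_preimage[OF continuous_Z_eval]) simp
  moreover have "V n = {x \<in> topspace (rtop Z). x n \<in> {1 mod q n}} \<inter> Units Z"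
    by (auto simp: V_def topspace_Z Z.Units_closed)
  ultimately show ?thesis by (auto simp: openin_subtopology)
qed

lemma V_in_N: "V n \<in> open_normal_subgroups G"
  unfolding open_normal_subgroups_def
  using V_subgroup V_open by (simp add: G.normal_iff_subgroup del: G_simps)

lemma V_decseq: "m \<le> n \<Longrightarrow> V n \<subseteq> V m"
proof
  fix u assume "m \<le> n" "u \<in> V n"
  then show "u \<in> V m"
    using Z_level[of u m n] mod_q_mod_q[of m n 1] by (auto simp: V_def Z.Units_closed)
qed

text \<open>\<open>Z_open_nbhd\<close> at the identity. It reduces statements about all open normal
  subgroups to the sequence \<open>V\<close>.\<close>

lemma V_cofinal:
  assumes "U \<in> open_normal_subgroups G" obtains n where "V n \<subseteq> U"
proof -
  have "openin (gtop G) U" "subgroup U G"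
    using assms normal_imp_subgroup by (auto simp: open_normal_subgroups_def)
  then obtain T where T: "openin (rtop Z) T" "U = T \<inter> Units Z" and "\<one>\<^bsub>Z\<^esub> \<in> U"
    using subgroup.one_closed by (fastforce simp: openin_subtopology)
  then obtain n where "\<And>z. z \<in> carrier Z \<Longrightarrow> z n = \<one>\<^bsub>Z\<^esub> n \<Longrightarrow> z \<in> T"
    using Z_open_nbhd[of T "\<one>\<^bsub>Z\<^esub>"] by blast
  then have "V n \<subseteq> U" using T by (auto simp: V_def Z_simps Z.Units_closed)
  then show ?thesis using that by blast
qed

lemma finite_quotient_G:
  assumes U: "U \<in> open_normal_subgroups G" shows "finite (carrier (G Mod U))"
proof -
  obtain n where n: "V n \<subseteq> U" by (rule V_cofinal[OF U])
  have sub: "subgroup U G" using U normal_imp_subgroup by (auto simp: open_normal_subgroups_def)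
  \<comment> \<open>A unit with residue \<open>r\<close>, when there is one. A coset of
    \<open>U\<close> contains such a representative for the residue of any of its elements, because
    \<open>V n \<subseteq> U\<close>.\<close>
  define s where "s r = (SOME g. g \<in> carrier G \<and> g n = r)" for r
  have "carrier (G Mod U) \<subseteq> (\<lambda>r. U #>\<^bsub>G\<^esub> s r) ` {0..<q n}"
  proof
    fix b assume "b \<in> carrier (G Mod U)"
    then obtain g where g: "g \<in> carrier G" "b = U #>\<^bsub>G\<^esub> g" by (auto simp: carrier_FactGroup)
    have s: "s (g n) \<in> carrier G" "s (g n) n = g n"
      using someI[of "\<lambda>h. h \<in> carrier G \<and> h n = g n" g] g by (auto simp: s_def)
    have "s (g n) \<in> V n #>\<^bsub>G\<^esub> g" using V_coset_iff[OF s(1) g(1)] s(2) by simp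
    then have "s (g n) \<in> U #>\<^bsub>G\<^esub> g" using n by (auto simp: r_coset_def)
    then have "b = U #>\<^bsub>G\<^esub> s (g n)" using G.repr_independence[OF _ g(1) sub] g(2) by simp
    moreover have "g n \<in> {0..<q n}" using Z_bounds[of g n] g by (simp add: Z.Units_closed)
    ultimately show "b \<in> (\<lambda>r. U #>\<^bsub>G\<^esub> s r) ` {0..<q n}" by blast
  qed
  then show ?thesis by (rule finite_subset) simp
qed

sublocale L: abelian_completion Z G
proof (intro abelian_completion.intro abelian_completion_axioms.intro Z_profinite G_comm_group finite_quotient_G)
  show "topspace (gtop G) = carrier G" using Z.Units_closed by (auto simp: topspace_Z)
qed

definition rep :: "(nat \<Rightarrow> int) set \<Rightarrow> nat \<Rightarrow> int" where "rep b = (SOME g. g \<in> b)"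

lemma rep_in:
  assumes "U \<in> L.\<N>" "b \<in> carrier (G Mod U)" shows "rep b \<in> b"
proof -
  obtain g where "g \<in> carrier G" "b = U #>\<^bsub>G\<^esub> g" using assms(2) by (rule L.coset_cases)
  then have "g \<in> b" using G.rcos_self[OF _ L.subgroup_N[OF assms(1)]] by simp
  then show ?thesis unfolding rep_def by (auto simp: some_in_eq)
qed

lemma in_coset:
  assumes "U \<in> L.\<N>" "b \<in> carrier (G Mod U)" "g \<in> b"
  shows "g \<in> carrier G" "b = U #>\<^bsub>G\<^esub> g"
proof -
  obtain h where h: "h \<in> carrier G" "b = U #>\<^bsub>G\<^esub> h" using assms(2) by (rule L.coset_cases)
  have sub: "subgroup U G" by (rule L.subgroup_N[OF assms(1)])
  show "b = U #>\<^bsub>G\<^esub> g" using G.repr_independence[OF _ h(1) sub] h(2) assms(3) by simp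
  show "g \<in> carrier G" using G.r_coset_subset_G[OF subgroup.subset[OF sub] h(1)] h(2) assms(3) by blast
qed

end

section \<open>Characters and the maps they induce on the completed algebra\<close>

locale padic_character = padic +
  fixes \<theta> :: "(nat \<Rightarrow> int) \<Rightarrow> nat \<Rightarrow> int"
  assumes theta_closed: "\<And>u. u \<in> carrier G \<Longrightarrow> \<theta> u \<in> carrier G"
    and theta_mult: "\<And>u w. u \<in> carrier G \<Longrightarrow> w \<in> carrier G \<Longrightarrow> \<theta> (u \<otimes>\<^bsub>G\<^esub> w) = \<theta> u \<otimes>\<^bsub>G\<^esub> \<theta> w"
    and theta_level: "\<And>u w n. u \<in> carrier G \<Longrightarrow> w \<in> carrier G \<Longrightarrow> u n = w n \<Longrightarrow> \<theta> u n = \<theta> w n"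
begin

abbreviation "\<Lambda> \<equiv> L.\<Lambda>"

text \<open>The ring homomorphism from \<open>\<Lambda>\<close> to the p-adic integers that extends
  \<open>\<theta>\<close>. By \<open>theta_level\<close> the value of \<open>\<theta>\<close> modulo
  \<open>q n\<close> depends only on the coset of \<open>V n\<close>, so a finite sum gives each
  residue.\<close>

definition \<xi> :: "((nat \<Rightarrow> int) set \<Rightarrow> (nat \<Rightarrow> int) set \<Rightarrow> nat \<Rightarrow> int) \<Rightarrow> nat \<Rightarrow> int" where
  "\<xi> x = (\<lambda>n. (\<Sum>b\<in>carrier (G Mod V n). x (V n) b n * \<theta> (rep b) n) mod q n)"

lemma theta_coset:
  assumes "U \<in> L.\<N>" "U \<subseteq> V n" "b \<in> carrier (G Mod U)" "g \<in> b" "h \<in> L.proj (V n) b"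
  shows "\<theta> g n = \<theta> h n"
proof -
  note g = in_coset[OF assms(1,3,4)]
  have pb: "L.proj (V n) b = V n #>\<^bsub>G\<^esub> g" using L.proj_coset[OF assms(1) V_in_N assms(2) g(1)] g(2) by simp
  then have "h \<in> carrier G"
    using assms(5) in_coset(1)[OF V_in_N L.coset_in[OF g(1)]] by simp
  moreover from this have "h n = g n" using V_coset_iff[OF _ g(1)] assms(5) pb by simp
  ultimately show ?thesis using theta_level[OF g(1)] by simp
qed

text \<open>Group the \<open>U\<close>-cosets by the \<open>V n\<close>-coset containing them:
  \<open>\<theta>\<close> is constant modulo \<open>q n\<close> on each group, and the coefficients
  add up to those of \<open>x (V n)\<close>. Both the compatibility of the residues of
  \<open>\<xi> x\<close> and the limit in \<open>completed_smult\<close> rest on this freedom of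
  level and representatives.\<close>

lemma xi_level:
  assumes x: "x \<in> carrier \<Lambda>" and U: "U \<in> L.\<N>" "U \<subseteq> V n"
    and r: "\<And>b. b \<in> carrier (G Mod U) \<Longrightarrow> r b \<in> b"
  shows "(\<Sum>b\<in>carrier (G Mod U). x U b n * \<theta> (r b) n) mod q n = \<xi> x n"
proof -
  let ?A = "carrier (G Mod U)" and ?C = "carrier (G Mod V n)" and ?\<pi> = "L.proj (V n)"
  have fin: "finite ?A" "finite ?C" using L.finite_quotient U V_in_N by auto
  have im: "?\<pi> ` ?A \<subseteq> ?C"
    using L.proj_coset[OF U(1) V_in_N U(2)] by (auto elim!: L.coset_cases simp del: G_simps)
  have "(\<Sum>b\<in>?A. x U b n * \<theta> (r b) n) = (\<Sum>c\<in>?C. \<Sum>b\<in>{b\<in>?A. ?\<pi> b = c}. x U b n * \<theta> (r b) n)"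
    by (rule sum.group[OF fin im, symmetric])
  also have "\<dots> = (\<Sum>c\<in>?C. (\<Sum>b\<in>{b\<in>?A. ?\<pi> b = c}. x U b n) * \<theta> (rep c) n)"
  proof (rule sum.cong[OF refl])
    fix c assume c: "c \<in> ?C"
    have "\<theta> (r b) n = \<theta> (rep c) n" if "b \<in> ?A" "?\<pi> b = c" for b
      using theta_coset[OF U that(1) r[OF that(1)]] rep_in[OF V_in_N c] that(2) by simp
    then show "(\<Sum>b\<in>{b\<in>?A. ?\<pi> b = c}. x U b n * \<theta> (r b) n) = (\<Sum>b\<in>{b\<in>?A. ?\<pi> b = c}. x U b n) * \<theta> (rep c) n"
      by (simp add: sum_distrib_right)
  qed
  finally have eq: "(\<Sum>b\<in>?A. x U b n * \<theta> (r b) n) = \<dots>" .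
  have "[(\<Sum>c\<in>?C. (\<Sum>b\<in>{b\<in>?A. ?\<pi> b = c}. x U b n) * \<theta> (rep c) n) = (\<Sum>c\<in>?C. x (V n) c n * \<theta> (rep c) n)] (mod q n)"
  proof (intro cong_sum cong_mult cong_refl)
    fix c assume c: "c \<in> ?C"
    have "x (V n) c n = (\<Oplus>\<^bsub>Z\<^esub>b\<in>{b\<in>?A. ?\<pi> b = c}. x U b) n"
      using L.LambdaD(3)[OF x U(1) V_in_N U(2)] c by (simp add: pushforward_def del: G_simps)
    also have "\<dots> = (\<Sum>b\<in>{b\<in>?A. ?\<pi> b = c}. x U b n) mod q n"
      by (rule Z_finsum) (use fin L.LambdaD(4)[OF x U(1)] in auto)
    finally show "[(\<Sum>b\<in>{b\<in>?A. ?\<pi> b = c}. x U b n) = x (V n) c n] (mod q n)" by (simp add: cong_def)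
  qed
  then show ?thesis unfolding eq \<xi>_def by (simp add: cong_def)
qed

lemma xi_closed [simp]:
  assumes x: "x \<in> carrier \<Lambda>" shows "\<xi> x \<in> carrier Z"
  unfolding \<xi>_def
proof (rule Z_closedI)
  fix n
  let ?A = "carrier (G Mod V (Suc n))"
  have "(\<Sum>b\<in>?A. x (V (Suc n)) b (Suc n) * \<theta> (rep b) (Suc n)) mod q n
      = (\<Sum>b\<in>?A. x (V (Suc n)) b n * \<theta> (rep b) n) mod q n"
    unfolding cong_def[symmetric]
  proof (intro cong_sum cong_mult)
    fix b assume b: "b \<in> ?A"
    have "rep b \<in> carrier G" by (rule in_coset(1)[OF V_in_N b rep_in[OF V_in_N b]])
    then have "\<theta> (rep b) \<in> carrier Z" using theta_closed[of "rep b"] Z.Units_closed by simp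
    then show "[\<theta> (rep b) (Suc n) = \<theta> (rep b) n] (mod q n)" by (simp add: cong_def Z_step)
    show "[x (V (Suc n)) b (Suc n) = x (V (Suc n)) b n] (mod q n)"
      using L.LambdaD(4)[OF x V_in_N b] by (simp add: cong_def Z_step)
  qed
  also have "\<dots> = \<xi> x n"
    by (rule xi_level[OF x V_in_N V_decseq rep_in[OF V_in_N]]) auto
  finally show "(\<Sum>b\<in>?A. x (V (Suc n)) b (Suc n) * \<theta> (rep b) (Suc n)) mod q n
      = (\<Sum>b\<in>carrier (G Mod V n). x (V n) b n * \<theta> (rep b) n) mod q n" by (simp add: \<xi>_def)
qed

lemma xi_add: "\<xi> (x \<oplus>\<^bsub>\<Lambda>\<^esub> y) = \<xi> x \<oplus>\<^bsub>Z\<^esub> \<xi> y"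
proof
  fix n
  have "[(\<Sum>b\<in>carrier (G Mod V n). (x \<oplus>\<^bsub>\<Lambda>\<^esub> y) (V n) b n * \<theta> (rep b) n)
     = (\<Sum>b\<in>carrier (G Mod V n). (x (V n) b n + y (V n) b n) * \<theta> (rep b) n)] (mod q n)"
    by (intro cong_sum cong_mult cong_refl) (simp add: L.Lambda_add_apply[OF V_in_N] Z_simps cong_def)
  then show "\<xi> (x \<oplus>\<^bsub>\<Lambda>\<^esub> y) n = (\<xi> x \<oplus>\<^bsub>Z\<^esub> \<xi> y) n"
    by (simp add: \<xi>_def Z_simps cong_def distrib_right sum.distrib mod_simps)
qed

lemma theta_mod_mult:
  assumes "a \<in> carrier (G Mod V n)" "c \<in> carrier (G Mod V n)"
  shows "[\<theta> (rep (a \<otimes>\<^bsub>G Mod V n\<^esub> c)) n = \<theta> (rep a) n * \<theta> (rep c) n] (mod q n)"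
proof -
  note a = in_coset[OF V_in_N assms(1) rep_in[OF V_in_N assms(1)]]
    and c = in_coset[OF V_in_N assms(2) rep_in[OF V_in_N assms(2)]]
  let ?w = "rep a \<otimes>\<^bsub>G\<^esub> rep c"
  have w: "?w \<in> carrier G" using a(1) c(1) by (rule G.m_closed)
  have ac: "a \<otimes>\<^bsub>G Mod V n\<^esub> c = V n #>\<^bsub>G\<^esub> ?w"
    unfolding mult_FactGroup using normal.rcos_sum[OF L.normal_N[OF V_in_N] a(1) c(1)]
      arg_cong2[OF a(2) c(2), of "set_mult G"] by (simp only:)
  have r: "rep (V n #>\<^bsub>G\<^esub> ?w) \<in> V n #>\<^bsub>G\<^esub> ?w" by (rule rep_in[OF V_in_N L.coset_in[OF w]])
  have rG: "rep (V n #>\<^bsub>G\<^esub> ?w) \<in> carrier G" by (rule in_coset(1)[OF V_in_N L.coset_in[OF w] r])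
  have "\<theta> (rep (V n #>\<^bsub>G\<^esub> ?w)) n = \<theta> ?w n"
    by (rule theta_level[OF rG w]) (use V_coset_iff[OF rG w] r in blast)
  also have "\<dots> = (\<theta> (rep a) n * \<theta> (rep c) n) mod q n"
    unfolding theta_mult[OF a(1) c(1)] by (rule G_apply)
  finally show ?thesis unfolding ac by (simp add: cong_def)
qed

text \<open>\<open>\<theta>\<close> is multiplicative on representatives modulo \<open>q n\<close>,
  so after the substitution b = a c the convolution factors into a product of two sums.\<close>

lemma xi_mult:
  assumes x: "x \<in> carrier \<Lambda>" and y: "y \<in> carrier \<Lambda>"
  shows "\<xi> (x \<otimes>\<^bsub>\<Lambda>\<^esub> y) = \<xi> x \<otimes>\<^bsub>Z\<^esub> \<xi> y"
proof
  fix n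
  let ?Q = "G Mod V n"
  let ?A = "carrier ?Q" and ?t = "\<lambda>b. \<theta> (rep b) n" and ?x = "\<lambda>b. x (V n) b n" and ?y = "\<lambda>b. y (V n) b n"
  have fin: "finite ?A" by (rule L.finite_quotient[OF V_in_N])
  have fgr: "finite_group_ring Z ?Q" by (rule L.group_ring_Mod[OF V_in_N])
  have grp: "group ?Q" using fgr by (simp add: finite_group_ring_def comm_group_def)
  note mc = monoid.m_closed[OF group.is_monoid[OF grp]] and ic = group.inv_closed[OF grp]
  have 1: "[(\<Sum>b\<in>?A. (x \<otimes>\<^bsub>\<Lambda>\<^esub> y) (V n) b n * ?t b)
      = (\<Sum>b\<in>?A. (\<Sum>a\<in>?A. ?x a * ?y (inv\<^bsub>?Q\<^esub> a \<otimes>\<^bsub>?Q\<^esub> b)) * ?t b)] (mod q n)"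
  proof (intro cong_sum cong_mult cong_refl)
    fix b assume b: "b \<in> ?A"
    have c: "inv\<^bsub>?Q\<^esub> a \<otimes>\<^bsub>?Q\<^esub> b \<in> ?A" if "a \<in> ?A" for a by (rule mc[OF ic[OF that] b])
    have "(x \<otimes>\<^bsub>\<Lambda>\<^esub> y) (V n) b n = (\<Sum>a\<in>?A. (x (V n) a \<otimes>\<^bsub>Z\<^esub> y (V n) (inv\<^bsub>?Q\<^esub> a \<otimes>\<^bsub>?Q\<^esub> b)) n) mod q n"
      unfolding L.Lambda_mult_apply[OF V_in_N b]
      by (rule Z_finsum[OF fin]) (intro Z.m_closed L.LambdaD(4)[OF x V_in_N] L.LambdaD(4)[OF y V_in_N] c)
    also have "\<dots> = (\<Sum>a\<in>?A. ?x a * ?y (inv\<^bsub>?Q\<^esub> a \<otimes>\<^bsub>?Q\<^esub> b)) mod q n"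
      by (simp add: Z_simps mod_sum_eq)
    finally show "[(x \<otimes>\<^bsub>\<Lambda>\<^esub> y) (V n) b n = (\<Sum>a\<in>?A. ?x a * ?y (inv\<^bsub>?Q\<^esub> a \<otimes>\<^bsub>?Q\<^esub> b))] (mod q n)"
      by (simp add: cong_def)
  qed
  have 2: "(\<Sum>b\<in>?A. (\<Sum>a\<in>?A. ?x a * ?y (inv\<^bsub>?Q\<^esub> a \<otimes>\<^bsub>?Q\<^esub> b)) * ?t b)
      = (\<Sum>a\<in>?A. \<Sum>b\<in>?A. ?x a * ?y (inv\<^bsub>?Q\<^esub> a \<otimes>\<^bsub>?Q\<^esub> b) * ?t b)"
    unfolding sum_distrib_right by (rule sum.swap)
  have 3: "[(\<Sum>a\<in>?A. \<Sum>b\<in>?A. ?x a * ?y (inv\<^bsub>?Q\<^esub> a \<otimes>\<^bsub>?Q\<^esub> b) * ?t b)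
      = (\<Sum>a\<in>?A. \<Sum>c\<in>?A. (?x a * ?t a) * (?y c * ?t c))] (mod q n)"
  proof (rule cong_sum)
    fix a assume a: "a \<in> ?A"
    have 5: "(\<Sum>b\<in>?A. ?x a * ?y (inv\<^bsub>?Q\<^esub> a \<otimes>\<^bsub>?Q\<^esub> b) * ?t b)
        = (\<Sum>c\<in>?A. ?x a * ?y (inv\<^bsub>?Q\<^esub> a \<otimes>\<^bsub>?Q\<^esub> (a \<otimes>\<^bsub>?Q\<^esub> c)) * ?t (a \<otimes>\<^bsub>?Q\<^esub> c))"
      by (rule sum.reindex_bij_betw[OF finite_group_ring.bij_translate[OF fgr a], symmetric])
    show "[(\<Sum>b\<in>?A. ?x a * ?y (inv\<^bsub>?Q\<^esub> a \<otimes>\<^bsub>?Q\<^esub> b) * ?t b)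
        = (\<Sum>c\<in>?A. (?x a * ?t a) * (?y c * ?t c))] (mod q n)"
      unfolding 5
    proof (rule cong_sum)
      fix c assume c: "c \<in> ?A"
      have "inv\<^bsub>?Q\<^esub> a \<otimes>\<^bsub>?Q\<^esub> (a \<otimes>\<^bsub>?Q\<^esub> c) = c"
        using group.inv_solve_left[OF grp, of c "a" "a \<otimes>\<^bsub>?Q\<^esub> c"] a c mc by metis
      moreover have "[?x a * ?y c * ?t (a \<otimes>\<^bsub>?Q\<^esub> c) = ?x a * ?y c * (?t a * ?t c)] (mod q n)"
        by (intro cong_mult cong_refl theta_mod_mult a c)
      ultimately show "[?x a * ?y (inv\<^bsub>?Q\<^esub> a \<otimes>\<^bsub>?Q\<^esub> (a \<otimes>\<^bsub>?Q\<^esub> c)) * ?t (a \<otimes>\<^bsub>?Q\<^esub> c)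
          = (?x a * ?t a) * (?y c * ?t c)] (mod q n)" by (simp only: ac_simps)
    qed
  qed
  have 4: "(\<Sum>a\<in>?A. \<Sum>c\<in>?A. (?x a * ?t a) * (?y c * ?t c)) = (\<Sum>a\<in>?A. ?x a * ?t a) * (\<Sum>c\<in>?A. ?y c * ?t c)"
    by (simp only: sum_product)
  have "[(\<Sum>b\<in>?A. (x \<otimes>\<^bsub>\<Lambda>\<^esub> y) (V n) b n * ?t b) = (\<Sum>a\<in>?A. ?x a * ?t a) * (\<Sum>c\<in>?A. ?y c * ?t c)] (mod q n)"
    using cong_trans[OF 1[unfolded 2] 3] unfolding 4 .
  then show "\<xi> (x \<otimes>\<^bsub>\<Lambda>\<^esub> y) n = (\<xi> x \<otimes>\<^bsub>Z\<^esub> \<xi> y) n"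
    by (simp add: \<xi>_def Z_simps cong_def mod_mult_eq)
qed

lemma xi_dirac:
  assumes c: "c \<in> carrier Z" and g: "g \<in> carrier G"
  shows "\<xi> (L.dirac c g) = c \<otimes>\<^bsub>Z\<^esub> \<theta> g"
proof
  fix n
  let ?A = "carrier (G Mod V n)" and ?b = "V n #>\<^bsub>G\<^esub> g"
  have b: "?b \<in> ?A" by (rule L.coset_in[OF g])
  have r: "rep ?b \<in> ?b" by (rule rep_in[OF V_in_N b])
  have rG: "rep ?b \<in> carrier G" by (rule in_coset(1)[OF V_in_N b r])
  have "(\<Sum>b\<in>?A. L.dirac c g (V n) b n * \<theta> (rep b) n) = (\<Sum>b\<in>?A. if b = ?b then c n * \<theta> (rep b) n else 0)"
    by (intro sum.cong refl) (simp add: L.dirac_apply[OF V_in_N] Z_simps del: G_simps)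
  also have "\<dots> = c n * \<theta> (rep ?b) n" using L.finite_quotient[OF V_in_N, of n] b by (simp del: G_simps)
  also have "\<theta> (rep ?b) n = \<theta> g n" by (rule theta_level[OF rG g]) (use V_coset_iff[OF rG g] r in blast)
  finally show "\<xi> (L.dirac c g) n = (c \<otimes>\<^bsub>Z\<^esub> \<theta> g) n" by (simp add: \<xi>_def Z_simps)
qed

lemma theta_one: "\<theta> \<one>\<^bsub>G\<^esub> = \<one>\<^bsub>G\<^esub>"
proof -
  have "\<theta> \<one>\<^bsub>G\<^esub> \<otimes>\<^bsub>G\<^esub> \<theta> \<one>\<^bsub>G\<^esub> = \<theta> \<one>\<^bsub>G\<^esub>"
    using theta_mult[OF G.one_closed G.one_closed] G.l_one[OF G.one_closed] by simp
  then show ?thesis using theta_closed[OF G.one_closed] G.r_cancel_one' by metis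
qed

lemma xi_scalar: "c \<in> carrier Z \<Longrightarrow> \<xi> (scalar_embedding Z G c) = c"
  unfolding L.scalar_embedding_dirac using xi_dirac[OF _ G.one_closed, of c] theta_one by simp

lemma xi_one: "\<xi> \<one>\<^bsub>\<Lambda>\<^esub> = \<one>\<^bsub>Z\<^esub>"
  unfolding L.one_dirac using xi_dirac[OF Z.one_closed G.one_closed] theta_one by simp

lemma continuous_discrete_sum:
  assumes "finite A" "\<And>a. a \<in> A \<Longrightarrow> continuous_map X (discrete_topology UNIV) (f a)"
  shows "continuous_map X (discrete_topology UNIV) (\<lambda>x. \<Sum>a\<in>A. f a x :: int)"
  using assms
proof (induction A)
  case (insert a A)
  then show ?case using continuous_discrete_binary[of X "f a" "\<lambda>x. \<Sum>a\<in>A. f a x" "(+)"] by simp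
qed simp

lemma xi_continuous: "continuous_map (rtop \<Lambda>) (rtop Z) \<xi>"
proof (rule continuous_into_Z)
  show "\<xi> x \<in> carrier Z" if "x \<in> topspace (rtop \<Lambda>)" for x using that L.topspace_Lambda by simp
  fix n
  have e: "continuous_map (rtop \<Lambda>) (discrete_topology UNIV) (\<lambda>x. x (V n) b n)" if "b \<in> carrier (G Mod V n)" for b
    using continuous_map_compose[OF L.continuous_eval[OF V_in_N that] continuous_Z_eval] by (simp add: o_def)
  have "continuous_map (rtop \<Lambda>) (discrete_topology UNIV) (\<lambda>x. \<Sum>b\<in>carrier (G Mod V n). x (V n) b n * \<theta> (rep b) n)"
  proof (rule continuous_discrete_sum[OF L.finite_quotient[OF V_in_N]])
    fix b assume "b \<in> carrier (G Mod V n)"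
    then show "continuous_map (rtop \<Lambda>) (discrete_topology UNIV) (\<lambda>x. x (V n) b n * \<theta> (rep b) n)"
      using continuous_discrete_binary[OF e e, of b b "\<lambda>i j. i * \<theta> (rep b) n"] by simp
  qed
  from continuous_discrete_binary[OF this this, of "\<lambda>i j. i mod q n"]
  show "continuous_map (rtop \<Lambda>) (discrete_topology UNIV) (\<lambda>x. \<xi> x n)" by (simp add: \<xi>_def)
qed

text \<open>Open normal subgroups are closed under intersection, so the principal filters form a
  directed base.\<close>

lemma eventually_N:
  "eventually P (INF V\<in>L.\<N>. principal {U \<in> L.\<N>. U \<subseteq> V}) \<longleftrightarrow>
    (\<exists>V\<in>L.\<N>. \<forall>U\<in>L.\<N>. U \<subseteq> V \<longrightarrow> P U)"
proof (subst eventually_INF_base)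
  show "L.\<N> \<noteq> {}" using L.carrier_in_N by blast
  fix A B assume "A \<in> L.\<N>" "B \<in> L.\<N>"
  then show "\<exists>C\<in>L.\<N>. principal {U \<in> L.\<N>. U \<subseteq> C}
      \<le> inf (principal {U \<in> L.\<N>. U \<subseteq> A}) (principal {U \<in> L.\<N>. U \<subseteq> B})"
    by (intro bexI[of _ "A \<inter> B"] L.N_Int) auto
qed (auto simp: eventually_principal)

text \<open>When \<open>G\<close> acts on \<open>m\<close> through the scalars
  \<open>\<theta> g\<close>, the finite sums are multiples of \<open>m\<close> by scalars converging
  to \<open>\<xi> x\<close>, and continuity of c |-> c m carries the limit to \<open>M\<close>. This
  trades the definite description for a formula.\<close>

lemma completed_smult_eq:
  assumes M: "profinite_module Z M" and x: "x \<in> carrier \<Lambda>" and m: "m \<in> carrier M"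
    and act: "\<And>g. g \<in> carrier G \<Longrightarrow> act g m = \<theta> g \<odot>\<^bsub>M\<^esub> m"
  shows "completed_smult G M act x m = \<xi> x \<odot>\<^bsub>M\<^esub> m"
proof -
  interpret M: module Z M by (rule profinite_moduleD[OF M])
  let ?F = "INF V\<in>L.\<N>. principal {U \<in> L.\<N>. U \<subseteq> V}"
  let ?f = "\<lambda>U. \<Oplus>\<^bsub>M\<^esub>b\<in>carrier (G Mod U). x U b \<odot>\<^bsub>M\<^esub> act (SOME g. g \<in> b) m"
  let ?s = "\<lambda>U. \<Oplus>\<^bsub>Z\<^esub>b\<in>carrier (G Mod U). x U b \<otimes>\<^bsub>Z\<^esub> \<theta> (rep b)"
  have sl: "(\<Oplus>\<^bsub>Z\<^esub>a\<in>A. h a) \<odot>\<^bsub>M\<^esub> m = (\<Oplus>\<^bsub>M\<^esub>a\<in>A. h a \<odot>\<^bsub>M\<^esub> m)"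
    if "finite A" "\<And>a. a \<in> A \<Longrightarrow> h a \<in> carrier Z" for A :: "(nat \<Rightarrow> int) set set" and h
    using that by (induction A) (use m in \<open>auto simp: M.smult_l_distr Pi_def\<close>)
  have cl: "x U b \<otimes>\<^bsub>Z\<^esub> \<theta> (rep b) \<in> carrier Z" "x U b \<in> carrier Z" "\<theta> (rep b) \<in> carrier Z" "rep b \<in> carrier G"
    if "U \<in> L.\<N>" "b \<in> carrier (G Mod U)" for U b
  proof -
    show r: "rep b \<in> carrier G" by (rule in_coset(1)[OF that rep_in[OF that]])
    show t: "\<theta> (rep b) \<in> carrier Z" using theta_closed[OF r] Z.Units_closed by simp
    show x': "x U b \<in> carrier Z" by (rule L.LambdaD(4)[OF x that])
    show "x U b \<otimes>\<^bsub>Z\<^esub> \<theta> (rep b) \<in> carrier Z" using x' t by (rule Z.m_closed)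
  qed
  have f: "?f U = ?s U \<odot>\<^bsub>M\<^esub> m" if U: "U \<in> L.\<N>" for U
  proof -
    have "?f U = (\<Oplus>\<^bsub>M\<^esub>b\<in>carrier (G Mod U). (x U b \<otimes>\<^bsub>Z\<^esub> \<theta> (rep b)) \<odot>\<^bsub>M\<^esub> m)"
    proof (rule M.M.finsum_cong'[OF refl])
      fix b assume b: "b \<in> carrier (G Mod U)"
      show "x U b \<odot>\<^bsub>M\<^esub> act (SOME g. g \<in> b) m = (x U b \<otimes>\<^bsub>Z\<^esub> \<theta> (rep b)) \<odot>\<^bsub>M\<^esub> m"
        using cl[OF U b] act[OF cl(4)[OF U b]] m by (simp add: M.smult_assoc1 rep_def)
    qed (use cl[OF U] m in auto)
    also have "\<dots> = ?s U \<odot>\<^bsub>M\<^esub> m" by (rule sl[symmetric]) (use L.finite_quotient[OF U] cl[OF U] in auto)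
    finally show ?thesis .
  qed
  have s: "?s U n = \<xi> x n" if "U \<in> L.\<N>" "U \<subseteq> V n" for U n
  proof -
    have "?s U n = (\<Sum>b\<in>carrier (G Mod U). (x U b \<otimes>\<^bsub>Z\<^esub> \<theta> (rep b)) n) mod q n"
      by (rule Z_finsum[OF L.finite_quotient[OF that(1)] cl(1)[OF that(1)]])
    also have "\<dots> = (\<Sum>b\<in>carrier (G Mod U). x U b n * \<theta> (rep b) n) mod q n"
      by (simp add: Z_simps mod_sum_eq)
    also have "\<dots> = \<xi> x n" by (rule xi_level[OF x that rep_in[OF that(1)]])
    finally show ?thesis .
  qed
  have limZ: "limitin (rtop Z) ?s (\<xi> x) ?F"
    unfolding limitin_def eventually_N
  proof (intro conjI allI impI)
    show "\<xi> x \<in> topspace (rtop Z)" using x by (simp add: topspace_Z)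
    fix W assume "openin (rtop Z) W \<and> \<xi> x \<in> W"
    then obtain n where n: "\<And>z. z \<in> carrier Z \<Longrightarrow> z n = \<xi> x n \<Longrightarrow> z \<in> W" using Z_open_nbhd by metis
    have "?s U \<in> W" if "U \<in> L.\<N>" "U \<subseteq> V n" for U
      by (rule n[of "?s U", OF _ s[OF that]]) (intro Z.finsum_closed Pi_I cl(1)[OF that(1)])
    then show "\<exists>V\<in>L.\<N>. \<forall>U\<in>L.\<N>. U \<subseteq> V \<longrightarrow> ?s U \<in> W" using V_in_N by blast
  qed
  have cm: "continuous_map (rtop Z) (mtop M) (\<lambda>c. c \<odot>\<^bsub>M\<^esub> m)"
    by (rule Z.continuous_smult[OF M]) (use m profinite_moduleD(2)[OF M] in auto)
  have "limitin (mtop M) (\<lambda>U. ?s U \<odot>\<^bsub>M\<^esub> m) (\<xi> x \<odot>\<^bsub>M\<^esub> m) ?F"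
    using continuous_map_limit[OF cm limZ] by (simp add: o_def)
  moreover have "eventually (\<lambda>U. ?s U \<odot>\<^bsub>M\<^esub> m = ?f U) ?F"
    unfolding eventually_N by (intro bexI[OF _ L.carrier_in_N] ballI impI f[symmetric])
  ultimately have lim: "limitin (mtop M) ?f (\<xi> x \<odot>\<^bsub>M\<^esub> m) ?F"
    by (rule limitin_transform_eventually[rotated])
  \<comment> \<open>Every basic set contains the subgroup that defines it, so the filter is proper
    and limits in the Hausdorff space \<open>M\<close> are unique.\<close>
  have "\<not> trivial_limit ?F"
    unfolding trivial_limit_def eventually_N by blast
  then have uniq: "y = \<xi> x \<odot>\<^bsub>M\<^esub> m" if "limitin (mtop M) ?f y ?F" for y
    using limitin_Hausdorff_unique[OF that lim] profinite_moduleD(4)[OF M] by simp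
  show ?thesis unfolding completed_smult_def 
    by (rule the_equality[where P = "\<lambda>y. limitin (mtop M) ?f y ?F", OF lim uniq])
qed

text \<open>By the formula above, the completed module is \<open>M\<close> with scalars pulled back
  along the continuous ring homomorphism \<open>\<xi>\<close>.\<close>

lemma completed_module_profinite:
  assumes M: "profinite_module Z M"
    and act: "\<And>g m. g \<in> carrier G \<Longrightarrow> m \<in> carrier M \<Longrightarrow> act g m = \<theta> g \<odot>\<^bsub>M\<^esub> m"
  shows "profinite_module \<Lambda> (completed_module G M act)"
proof -
  interpret M: module Z M by (rule profinite_moduleD[OF M])
  let ?C = "completed_module G M act"
  have s: "x \<odot>\<^bsub>?C\<^esub> m = \<xi> x \<odot>\<^bsub>M\<^esub> m" if "x \<in> carrier \<Lambda>" "m \<in> carrier M" for x m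
    using completed_smult_eq[OF M that] act[OF _ that(2)] by (simp add: completed_module_def)
  have C: "carrier ?C = carrier M" "\<zero>\<^bsub>?C\<^esub> = \<zero>\<^bsub>M\<^esub>" "add ?C = add M" "mtop ?C = mtop M"
    by (simp_all add: completed_module_def)
  interpret \<Lambda>: profinite_ring \<Lambda> by (rule L.Lambda_profinite)
  have "module \<Lambda> ?C"
  proof (rule moduleI[OF L.Lambda_cring])
    show "abelian_group ?C"
      by (rule abelian_groupI) (auto simp: C M.M.a_ac intro: bexI[of _ "\<ominus>\<^bsub>M\<^esub> _"] M.M.l_neg)
  qed (auto simp: C s xi_add xi_mult xi_one M.smult_l_distr M.smult_r_distr M.smult_assoc1)
  moreover have "continuous_map (prod_topology (rtop \<Lambda>) (mtop M)) (mtop M) (\<lambda>(x, m). x \<odot>\<^bsub>?C\<^esub> m)"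
  proof (rule continuous_map_eq)
    show "continuous_map (prod_topology (rtop \<Lambda>) (mtop M)) (mtop M) (\<lambda>z. \<xi> (fst z) \<odot>\<^bsub>M\<^esub> snd z)"
      by (rule Z.continuous_smult[OF M])
         (auto intro: continuous_map_compose[OF continuous_map_fst xi_continuous, unfolded o_def] continuous_map_snd)
  qed (auto simp: s L.topspace_Lambda profinite_moduleD(2)[OF M])
  ultimately show ?thesis
    using profinite_moduleD(2-6)[OF M] unfolding profinite_module_def C by simp
qed

end

section \<open>A topological generator and the augmentation ideal\<close>

lemma (in cring) diff_add_diff:
  "\<lbrakk>a \<in> carrier R; b \<in> carrier R; c \<in> carrier R; d \<in> carrier R\<rbrakk> \<Longrightarrow>
    (a \<ominus> b) \<oplus> (c \<ominus> d) = (a \<oplus> c) \<ominus> (b \<oplus> d)"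
  by algebra

context padic begin

lemma Lambda_eqI_V:
  assumes x: "x \<in> carrier L.\<Lambda>" and y: "y \<in> carrier L.\<Lambda>"
    and eq: "\<And>n b. b \<in> carrier (G Mod V n) \<Longrightarrow> x (V n) b = y (V n) b"
  shows "x = y"
proof (rule L.Lambda_eqI[OF x y])
  fix U b assume U: "U \<in> L.\<N>"
  obtain n where n: "V n \<subseteq> U" by (rule V_cofinal[OF U])
  have "x (V n) = y (V n)"
    by (rule PiE_ext[OF L.LambdaD(2)[OF x V_in_N] L.LambdaD(2)[OF y V_in_N] eq])
  then show "x U b = y U b"
    using L.LambdaD(3)[OF x V_in_N U n] L.LambdaD(3)[OF y V_in_N U n] by simp
qed

lemma carrier_Mod_V0: "carrier (G Mod V 0) = {V 0}"
proof -
  have V0: "V 0 = carrier G" using Z_bounds[of _ 0] by (fastforce simp: V_def Z.Units_closed)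
  have "V 0 #>\<^bsub>G\<^esub> g = V 0" if "g \<in> carrier G" for g
    by (rule G.coset_join2[OF that V_subgroup]) (use that V0 in simp)
  then show ?thesis unfolding carrier_FactGroup using G.one_closed by blast
qed

text \<open>\<open>V 0\<close> is the whole group, so its quotient has one coset, and compatibility
  makes the coefficient there the sum of all coefficients at any level \<open>V n\<close>: the
  augmentation.\<close>

lemma Lambda_total:
  assumes x: "x \<in> carrier L.\<Lambda>"
  shows "x (V 0) (V 0) = (\<Oplus>\<^bsub>Z\<^esub>b\<in>carrier (G Mod V n). x (V n) b)"
proof -
  have V0: "V 0 \<in> carrier (G Mod V 0)" unfolding carrier_Mod_V0 by simp
  have sub: "V n \<subseteq> V 0" by (rule V_decseq) simp
  have "L.proj (V 0) b \<in> carrier (G Mod V 0)" if b: "b \<in> carrier (G Mod V n)" for b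
  proof -
    obtain g where g: "g \<in> carrier G" "b = V n #>\<^bsub>G\<^esub> g" by (rule L.coset_cases[OF b])
    show ?thesis unfolding g(2) L.proj_coset[OF V_in_N V_in_N sub g(1)] by (rule L.coset_in[OF g(1)])
  qed
  then have "{b \<in> carrier (G Mod V n). L.proj (V 0) b = V 0} = carrier (G Mod V n)"
    unfolding carrier_Mod_V0 by blast
  then show ?thesis using fun_cong[OF L.LambdaD(3)[OF x V_in_N V_in_N sub], of "V 0"] V0
    by (simp add: pushforward_def)
qed

lemma Lambda_finsum_apply:
  assumes "finite A" "\<And>a. a \<in> A \<Longrightarrow> f a \<in> carrier L.\<Lambda>" "U \<in> L.\<N>" "b \<in> carrier (G Mod U)"
  shows "(\<Oplus>\<^bsub>L.\<Lambda>\<^esub>a\<in>A. f a) U b = (\<Oplus>\<^bsub>Z\<^esub>a\<in>A. f a U b)"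
proof -
  interpret \<Lambda>: cring L.\<Lambda> by (rule L.Lambda_cring)
  show ?thesis
    using assms(1,2)
  proof (induction A)
    case empty
    then show ?case using L.Lambda_zero_apply[OF assms(3,4)] by simp
  next
    case (insert a A)
    have "f i U b \<in> carrier Z" if "i \<in> insert a A" for i
      using L.LambdaD(4)[OF insert.prems[OF that] assms(3,4)] .
    then have "(\<Oplus>\<^bsub>Z\<^esub>a\<in>insert a A. f a U b) = f a U b \<oplus>\<^bsub>Z\<^esub> (\<Oplus>\<^bsub>Z\<^esub>a\<in>A. f a U b)"
      using insert.hyps by (intro Z.finsum_insert) auto
    moreover have "(\<Oplus>\<^bsub>L.\<Lambda>\<^esub>a\<in>insert a A. f a) = f a \<oplus>\<^bsub>L.\<Lambda>\<^esub> (\<Oplus>\<^bsub>L.\<Lambda>\<^esub>a\<in>A. f a)"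
      using insert by (intro \<Lambda>.finsum_insert) auto
    ultimately show ?case using insert L.Lambda_add_apply[OF assms(3,4)] by simp
  qed
qed

lemma dirac_mult_dirac:
  assumes "c \<in> carrier Z" "d \<in> carrier Z" "g \<in> carrier G" "h \<in> carrier G"
  shows "L.dirac c g \<otimes>\<^bsub>L.\<Lambda>\<^esub> L.dirac d h = L.dirac (c \<otimes>\<^bsub>Z\<^esub> d) (g \<otimes>\<^bsub>G\<^esub> h)"
proof (rule L.Lambda_eqI)
  show 1: "L.dirac c g \<otimes>\<^bsub>L.\<Lambda>\<^esub> L.dirac d h \<in> carrier L.\<Lambda>"
    by (intro L.Lambda_mult_closed L.dirac_closed assms)
  have gh: "g \<otimes>\<^bsub>G\<^esub> h \<in> carrier G" using assms by (intro G.m_closed)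
  then show "L.dirac (c \<otimes>\<^bsub>Z\<^esub> d) (g \<otimes>\<^bsub>G\<^esub> h) \<in> carrier L.\<Lambda>" using assms by (intro L.dirac_closed Z.m_closed)
  fix U b assume U: "U \<in> L.\<N>" and b: "b \<in> carrier (G Mod U)"
  obtain w where w: "w \<in> carrier G" "b = U #>\<^bsub>G\<^esub> w" by (rule L.coset_cases[OF b])
  have sub: "subgroup U G" by (rule L.subgroup_N[OF U])
  have gw: "inv\<^bsub>G\<^esub> g \<otimes>\<^bsub>G\<^esub> w \<in> carrier G" using assms(3) w(1) by (intro G.m_closed G.inv_closed)
  have "U #>\<^bsub>G\<^esub> (inv\<^bsub>G\<^esub> g \<otimes>\<^bsub>G\<^esub> w) = U #>\<^bsub>G\<^esub> h \<longleftrightarrow> U #>\<^bsub>G\<^esub> w = U #>\<^bsub>G\<^esub> (g \<otimes>\<^bsub>G\<^esub> h)"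
  proof -
    note rs = normal.rcos_sum[OF L.normal_N[OF U]]
    have "U #>\<^bsub>G\<^esub> w = (U #>\<^bsub>G\<^esub> g) <#>\<^bsub>G\<^esub> (U #>\<^bsub>G\<^esub> (inv\<^bsub>G\<^esub> g \<otimes>\<^bsub>G\<^esub> w))"
      unfolding rs[OF assms(3) gw] using assms(3) w(1) G.inv_closed[OF assms(3)]
      by (simp only: G.m_assoc[symmetric] G.r_inv G.l_one)
    moreover have "U #>\<^bsub>G\<^esub> (inv\<^bsub>G\<^esub> g \<otimes>\<^bsub>G\<^esub> w) = (U #>\<^bsub>G\<^esub> inv\<^bsub>G\<^esub> g) <#>\<^bsub>G\<^esub> (U #>\<^bsub>G\<^esub> w)"
      unfolding rs[OF G.inv_closed[OF assms(3)] w(1)] ..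
    moreover have "(U #>\<^bsub>G\<^esub> inv\<^bsub>G\<^esub> g) <#>\<^bsub>G\<^esub> (U #>\<^bsub>G\<^esub> (g \<otimes>\<^bsub>G\<^esub> h)) = U #>\<^bsub>G\<^esub> h"
      unfolding rs[OF G.inv_closed[OF assms(3)] gh] using assms(3,4) G.inv_closed[OF assms(3)]
      by (simp only: G.m_assoc[symmetric] G.l_inv G.l_one)
    moreover have "(U #>\<^bsub>G\<^esub> g) <#>\<^bsub>G\<^esub> (U #>\<^bsub>G\<^esub> h) = U #>\<^bsub>G\<^esub> (g \<otimes>\<^bsub>G\<^esub> h)" by (rule rs[OF assms(3,4)])
    ultimately show ?thesis by metis
  qed
  then show "(L.dirac c g \<otimes>\<^bsub>L.\<Lambda>\<^esub> L.dirac d h) U b = L.dirac (c \<otimes>\<^bsub>Z\<^esub> d) (g \<otimes>\<^bsub>G\<^esub> h) U b"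
    unfolding w(2) L.dirac_mult_apply[OF assms(1,3) L.dirac_closed[OF assms(2,4)] U w(1)]
      L.dirac_apply[OF U L.coset_in[OF w(1)]] L.dirac_apply[OF U L.coset_in[OF gw]]
    using assms(1) by simp
qed

lemma dirac_add:
  assumes "c \<in> carrier Z" "d \<in> carrier Z" "g \<in> carrier G"
  shows "L.dirac c g \<oplus>\<^bsub>L.\<Lambda>\<^esub> L.dirac d g = L.dirac (c \<oplus>\<^bsub>Z\<^esub> d) g"
proof (rule L.Lambda_eqI)
  show "L.dirac c g \<oplus>\<^bsub>L.\<Lambda>\<^esub> L.dirac d g \<in> carrier L.\<Lambda>"
    by (intro L.Lambda_add_closed L.dirac_closed assms)
  show "L.dirac (c \<oplus>\<^bsub>Z\<^esub> d) g \<in> carrier L.\<Lambda>" by (intro L.dirac_closed Z.a_closed assms)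
qed (use assms in \<open>simp add: L.Lambda_add_apply L.dirac_apply del: G_simps\<close>)

lemma dirac_zero: "g \<in> carrier G \<Longrightarrow> L.dirac \<zero>\<^bsub>Z\<^esub> g = \<zero>\<^bsub>L.\<Lambda>\<^esub>"
proof (rule L.Lambda_eqI)
  interpret \<Lambda>: cring L.\<Lambda> by (rule L.Lambda_cring)
  show "\<zero>\<^bsub>L.\<Lambda>\<^esub> \<in> carrier L.\<Lambda>" by simp
qed (auto simp: L.Lambda_zero_apply L.dirac_apply simp del: G_simps)

end

section \<open>A topological generator of the unit group\<close>

locale odd_padic = padic +
  assumes odd_p: "odd p"
begin

text \<open>One integer serves all powers of p at once; oddness of p provides it. Its powers are
  then dense in the unit group.\<close>

definition g0 :: nat where "g0 = (SOME g. \<forall>k>0. residue_primroot (p ^ k) g)"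

lemma g0: "k > 0 \<Longrightarrow> residue_primroot (p ^ k) g0"
proof -
  obtain g where "\<forall>k>0. residue_primroot (p ^ k) g"
    using residue_primroot_odd_prime_power_exists[OF prime_p odd_p] by blast
  then show "k > 0 \<Longrightarrow> residue_primroot (p ^ k) g0"
    unfolding g0_def by (rule someI2[where Q = "\<lambda>g. k > 0 \<longrightarrow> residue_primroot (p ^ k) g", rule_format]) auto
qed

lemma g0_coprime: "coprime (int g0) (int p)"
  using g0[of 1] by (simp add: residue_primroot_def coprime_commute)

definition gp :: "nat \<Rightarrow> nat \<Rightarrow> int" where "gp j = of_Z (int g0 ^ j)"

lemma gp_closed: "gp j \<in> carrier G"
  unfolding gp_def using of_Z_Unit[of "int g0 ^ j"] g0_coprime by simp

lemma gp_Suc: "gp (Suc j) = gp 1 \<otimes>\<^bsub>G\<^esub> gp j"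
  unfolding gp_def by (simp add: of_Z_mult)

lemma gp_0: "gp 0 = \<one>\<^bsub>G\<^esub>"
  unfolding gp_def by (simp add: of_Z_one)

lemma gp_pow: "gp j = gp 1 [^]\<^bsub>G\<^esub> j"
proof (induction j)
  case 0
  then show ?case using gp_0 by simp
next
  case (Suc j)
  have "gp (Suc j) = gp j \<otimes>\<^bsub>G\<^esub> gp 1"
    unfolding gp_Suc[of j] by (rule G.m_comm[OF gp_closed gp_closed])
  also have "\<dots> = gp 1 [^]\<^bsub>G\<^esub> Suc j" unfolding G.nat_pow_Suc Suc[symmetric] ..
  finally show ?case .
qed

lemma gp_covers:
  assumes u: "u \<in> carrier G" and n: "n > 0"
  obtains j where "j < totient (p ^ n)" "u n = gp j n"
proof -
  have uc: "coprime (u n) (q n)" using Units_coprime u by simp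
  have b: "0 \<le> u n" "u n < q n" using Z_bounds[of u n] u by (simp_all add: Z.Units_closed)
  have m: "p ^ n > 1" by (rule one_less_power[OF prime_gt_1_nat[OF prime_p] n])
  define w where "w = nat (u n)"
  have w: "u n = int w" using b(1) by (simp add: w_def)
  have "coprime (int w) (int (p ^ n))" using uc unfolding w by (simp only: of_nat_power)
  then have "coprime w (p ^ n)" by (simp only: coprime_int_iff)
  moreover have "int w < int (p ^ n)" using b(2) unfolding w by (simp only: of_nat_power)
  then have "w < p ^ n" by (simp only: of_nat_less_iff)
  moreover have "w \<noteq> 0"
  proof
    assume "w = 0"
    then show False using \<open>coprime w (p ^ n)\<close> m by auto
  qed
  ultimately have "w \<in> totatives (p ^ n)" by (simp add: totatives_def)
  then have "nat (u n) \<in> totatives (p ^ n)" by (simp only: w_def)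
  then obtain j where j: "j < totient (p ^ n)" "nat (u n) = g0 ^ j mod p ^ n"
    using residue_primroot_is_generator[OF m g0[OF n]] by (auto simp: bij_betw_def image_iff)
  have "u n = int (g0 ^ j mod p ^ n)" using j(2) b by simp
  then have "u n = gp j n" by (simp add: gp_def of_Z_def zmod_int)
  then show ?thesis using that j(1) by blast
qed

text \<open>Cosets are residues, and the powers of a primitive root run once through the totatives.
  Level zero stays out because the modulus must exceed one.\<close>

lemma cosets_V:
  assumes "n > 0"
  shows "bij_betw (\<lambda>j. V n #>\<^bsub>G\<^esub> gp j) {..<totient (p ^ n)} (carrier (G Mod V n))"
  unfolding bij_betw_def
proof
  have m: "p ^ n > 1" by (rule one_less_power[OF prime_gt_1_nat[OF prime_p] assms])
  have inj: "inj_on (\<lambda>i. g0 ^ i mod p ^ n) {..<totient (p ^ n)}"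
    using residue_primroot_is_generator[OF m g0[OF assms]] by (simp add: bij_betw_def)
  show "inj_on (\<lambda>j. V n #>\<^bsub>G\<^esub> gp j) {..<totient (p ^ n)}"
  proof (rule inj_onI)
    fix i j assume ij: "i \<in> {..<totient (p ^ n)}" "j \<in> {..<totient (p ^ n)}" "V n #>\<^bsub>G\<^esub> gp i = V n #>\<^bsub>G\<^esub> gp j"
    have "gp i \<in> V n #>\<^bsub>G\<^esub> gp j" using G.rcos_self[OF gp_closed V_subgroup] ij(3) by metis
    then have "gp i n = gp j n" using V_coset_iff[OF gp_closed gp_closed] by blast
    then have "int (g0 ^ i mod p ^ n) = int (g0 ^ j mod p ^ n)" by (simp add: gp_def of_Z_def zmod_int)
    then show "i = j" using inj_onD[OF inj _ ij(1,2)] by simp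
  qed
  show "(\<lambda>j. V n #>\<^bsub>G\<^esub> gp j) ` {..<totient (p ^ n)} = carrier (G Mod V n)"
  proof
    show "(\<lambda>j. V n #>\<^bsub>G\<^esub> gp j) ` {..<totient (p ^ n)} \<subseteq> carrier (G Mod V n)"
      using L.coset_in[OF gp_closed] by blast
    show "carrier (G Mod V n) \<subseteq> (\<lambda>j. V n #>\<^bsub>G\<^esub> gp j) ` {..<totient (p ^ n)}"
    proof
      fix b assume "b \<in> carrier (G Mod V n)"
      then obtain u where u: "u \<in> carrier G" "b = V n #>\<^bsub>G\<^esub> u" by (rule L.coset_cases)
      obtain j where j: "j < totient (p ^ n)" "u n = gp j n" by (rule gp_covers[OF u(1) assms])
      have "u \<in> V n #>\<^bsub>G\<^esub> gp j" using V_coset_iff[OF u(1) gp_closed] j(2) by blast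
      then have "b = V n #>\<^bsub>G\<^esub> gp j" using G.repr_independence[OF _ gp_closed V_subgroup] u(2) by simp
      then show "b \<in> (\<lambda>j. V n #>\<^bsub>G\<^esub> gp j) ` {..<totient (p ^ n)}" using j(1) by blast
    qed
  qed
qed

lemma coset_gp: "b \<in> carrier (G Mod V n) \<Longrightarrow> \<exists>j. b = V n #>\<^bsub>G\<^esub> gp j"
proof (cases "n = 0")
  case True
  assume "b \<in> carrier (G Mod V n)"
  then have "b = V 0" unfolding True carrier_Mod_V0 by simp
  moreover have "V 0 #>\<^bsub>G\<^esub> gp 0 = V 0"
    using L.coset_in[OF gp_closed, of "V 0" 0] unfolding carrier_Mod_V0 by (rule singletonD)
  ultimately have "b = V n #>\<^bsub>G\<^esub> gp 0" unfolding True by (simp only:)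
  then show ?thesis ..
next
  case False
  assume "b \<in> carrier (G Mod V n)"
  moreover have "(\<lambda>j. V n #>\<^bsub>G\<^esub> gp j) ` {..<totient (p ^ n)} = carrier (G Mod V n)"
    using False by (intro bij_betw_imp_surj_on[OF cosets_V]) simp
  ultimately show ?thesis by blast
qed

section \<open>Multiplication by [g] - 1\<close>

definition \<gamma> :: "(nat \<Rightarrow> int) set \<Rightarrow> (nat \<Rightarrow> int) set \<Rightarrow> nat \<Rightarrow> int" where
  "\<gamma> = L.dirac \<one>\<^bsub>Z\<^esub> (gp 1) \<ominus>\<^bsub>L.\<Lambda>\<^esub> \<one>\<^bsub>L.\<Lambda>\<^esub>"

sublocale \<Lambda>: profinite_ring L.\<Lambda> by (rule L.Lambda_profinite)

lemma gamma_closed [simp]: "\<gamma> \<in> carrier L.\<Lambda>"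
  unfolding \<gamma>_def using L.dirac_closed[OF Z.one_closed gp_closed] by simp

text \<open>An element killed by \<open>\<gamma>\<close> has constant coefficients at every level. Their sum does not
  depend on the level, and the number of cosets is divisible by arbitrarily high powers of \<open>p\<close>.\<close>

lemma gamma_injective:
  assumes x: "x \<in> carrier L.\<Lambda>" and 0: "\<gamma> \<otimes>\<^bsub>L.\<Lambda>\<^esub> x = \<zero>\<^bsub>L.\<Lambda>\<^esub>"
  shows "x = \<zero>\<^bsub>L.\<Lambda>\<^esub>"
proof -
  let ?D = "L.dirac \<one>\<^bsub>Z\<^esub> (gp 1)"
  have D: "?D \<in> carrier L.\<Lambda>" by (rule L.dirac_closed[OF Z.one_closed gp_closed])
  have "?D \<otimes>\<^bsub>L.\<Lambda>\<^esub> x \<ominus>\<^bsub>L.\<Lambda>\<^esub> x = \<zero>\<^bsub>L.\<Lambda>\<^esub>"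
    using 0 D x by (simp add: \<gamma>_def a_minus_def \<Lambda>.l_distr \<Lambda>.l_minus)
  then have Dx: "?D \<otimes>\<^bsub>L.\<Lambda>\<^esub> x = x" using D x by simp
  \<comment> \<open>Being killed by \<open>\<gamma>\<close> means being invariant under translation
    by the generator.\<close>
  have shift: "x (V n) (V n #>\<^bsub>G\<^esub> gp (Suc j)) = x (V n) (V n #>\<^bsub>G\<^esub> gp j)" for n j
  proof -
    have "x (V n) (V n #>\<^bsub>G\<^esub> gp (Suc j)) = \<one>\<^bsub>Z\<^esub> \<otimes>\<^bsub>Z\<^esub> x (V n) (V n #>\<^bsub>G\<^esub> (inv\<^bsub>G\<^esub> gp 1 \<otimes>\<^bsub>G\<^esub> gp (Suc j)))"
      using L.dirac_mult_apply[OF Z.one_closed gp_closed x V_in_N gp_closed, of 1 n "Suc j"] Dx by simp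
    also have "inv\<^bsub>G\<^esub> gp 1 \<otimes>\<^bsub>G\<^esub> gp (Suc j) = gp j"
      unfolding gp_Suc using gp_closed G.inv_closed[OF gp_closed]
      by (simp only: G.m_assoc[symmetric] G.l_inv G.l_one)
    finally show ?thesis using L.LambdaD(4)[OF x V_in_N L.coset_in[OF gp_closed]] by (simp only: Z.l_one)
  qed
  define c where "c n = x (V n) (V n)" for n
  have one: "V n #>\<^bsub>G\<^esub> gp 0 = V n" for n unfolding gp_0 by (rule L.coset_one[OF V_in_N])
  have "x (V n) (V n #>\<^bsub>G\<^esub> gp j) = c n" for n j
    by (induction j) (simp_all only: shift one c_def)
  then have const: "x (V n) b = c n" if "b \<in> carrier (G Mod V n)" for n b
    using coset_gp[OF that] by auto
  have cZ: "c n \<in> carrier Z" for n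
    using L.LambdaD(4)[OF x V_in_N L.coset_in[OF gp_closed, of "V n" 0]] one by (simp only: c_def)
  have total: "c 0 l = (int (totient (p ^ n)) * c n l) mod q l" if n: "n > 0" for n l
  proof -
    have fin: "finite (carrier (G Mod V n))" by (rule L.finite_quotient[OF V_in_N])
    have "c 0 l = (\<Sum>b\<in>carrier (G Mod V n). x (V n) b l) mod q l"
      unfolding c_def Lambda_total[OF x, of n]
      by (rule Z_finsum[OF fin]) (rule L.LambdaD(4)[OF x V_in_N])
    also have "(\<Sum>b\<in>carrier (G Mod V n). x (V n) b l) = (\<Sum>b\<in>carrier (G Mod V n). c n l)"
      by (intro sum.cong refl) (simp only: const)
    also have "\<dots> = int (totient (p ^ n)) * c n l"
      using bij_betw_same_card[OF cosets_V[OF n]] by (simp del: G_simps)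
    finally show ?thesis .
  qed
  have tot: "totient (p ^ Suc n) = p ^ n * (p - 1)" for n
    using totient_prime_power[OF prime_p, of "Suc n"] by simp
  \<comment> \<open>At level \<open>Suc l\<close> the number of cosets is a multiple of
    \<open>p ^ l\<close>, so the total vanishes modulo \<open>q l\<close>.\<close>
  have c0: "c 0 l = 0" for l
    using total[of "Suc l" l] by (simp add: tot mult.assoc del: power_Suc)
  \<comment> \<open>Since the total is zero, \<open>c n\<close> is annihilated by the number of
    cosets, which is a unit times a power of p.\<close>
  have cn: "c n = \<zero>\<^bsub>Z\<^esub>" if "n > 0" for n
  proof -
    obtain k where k: "n = Suc k" using \<open>n > 0\<close> by (cases n) auto
    have tn: "int (totient (p ^ n)) = (int p - 1) * q k" using p_gt_1 unfolding k tot by (simp add: of_nat_diff)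
    have "of_Z (int p - 1) \<otimes>\<^bsub>Z\<^esub> (of_Z (q k) \<otimes>\<^bsub>Z\<^esub> c n) = \<zero>\<^bsub>Z\<^esub>"
    proof
      fix l
      have "(of_Z (int p - 1) \<otimes>\<^bsub>Z\<^esub> (of_Z (q k) \<otimes>\<^bsub>Z\<^esub> c n)) l = ((int p - 1) * (q k * c n l)) mod q l"
        by (simp only: Z_simps of_Z_def mod_mult_left_eq mod_mult_right_eq)
      also have "\<dots> = c 0 l" unfolding total[OF that] tn by (simp only: mult.assoc)
      finally show "(of_Z (int p - 1) \<otimes>\<^bsub>Z\<^esub> (of_Z (q k) \<otimes>\<^bsub>Z\<^esub> c n)) l = \<zero>\<^bsub>Z\<^esub> l"
        unfolding c0 by (simp add: Z_simps)
    qed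
    moreover have "coprime (int p - 1) (int p)" using coprime_diff_one_left[of "int p"] by simp
    then have "of_Z (int p - 1) \<in> Units Z" by (rule of_Z_Unit)
    ultimately have "of_Z (q k) \<otimes>\<^bsub>Z\<^esub> c n = \<zero>\<^bsub>Z\<^esub>"
      using cZ[of n] Z.Units_l_cancel[of "of_Z (int p - 1)" "of_Z (q k) \<otimes>\<^bsub>Z\<^esub> c n" "\<zero>\<^bsub>Z\<^esub>"]
      by simp
    then show ?thesis by (rule Z_power_torsion_free[OF cZ])
  qed
  show ?thesis
  proof (rule Lambda_eqI_V[OF x])
    fix n b assume b: "b \<in> carrier (G Mod V n)"
    have "c n = \<zero>\<^bsub>Z\<^esub>" using cn[of n] c0 by (cases "n = 0") (auto simp: Z_simps)
    then show "x (V n) b = \<zero>\<^bsub>L.\<Lambda>\<^esub> (V n) b"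
      using const[OF b] L.Lambda_zero_apply[OF V_in_N b] by simp
  qed simp
qed

text \<open>Telescoping: c[g^(j+1)] - c[1] = (c[g^j] - c[1]) + ([g] - 1) c[g^j], so the witness
  grows by \<open>L.dirac c (gp j)\<close> at each step.\<close>

lemma gamma_dirac:
  assumes c: "c \<in> carrier Z"
  shows "\<exists>y\<in>carrier L.\<Lambda>. \<gamma> \<otimes>\<^bsub>L.\<Lambda>\<^esub> y = L.dirac c (gp j) \<ominus>\<^bsub>L.\<Lambda>\<^esub> L.dirac c \<one>\<^bsub>G\<^esub>"
proof (induction j)
  case 0
  have "L.dirac c \<one>\<^bsub>G\<^esub> \<in> carrier L.\<Lambda>" by (rule L.dirac_closed[OF c G.one_closed])
  then show ?case unfolding gp_0 by (intro bexI[of _ "\<zero>\<^bsub>L.\<Lambda>\<^esub>"]) (simp_all add: a_minus_def \<Lambda>.r_neg del: G_simps)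
next
  case (Suc j)
  then obtain y where y: "y \<in> carrier L.\<Lambda>" "\<gamma> \<otimes>\<^bsub>L.\<Lambda>\<^esub> y = L.dirac c (gp j) \<ominus>\<^bsub>L.\<Lambda>\<^esub> L.dirac c \<one>\<^bsub>G\<^esub>" by blast
  let ?D = "L.dirac \<one>\<^bsub>Z\<^esub> (gp 1)" and ?d = "L.dirac c (gp j)" and ?e = "L.dirac c \<one>\<^bsub>G\<^esub>"
  have cl: "?D \<in> carrier L.\<Lambda>" "?d \<in> carrier L.\<Lambda>" "?e \<in> carrier L.\<Lambda>"
    by (intro L.dirac_closed c gp_closed Z.one_closed G.one_closed)+
  have "L.dirac c (gp (Suc j)) = ?D \<otimes>\<^bsub>L.\<Lambda>\<^esub> ?d"
    unfolding gp_Suc dirac_mult_dirac[OF Z.one_closed c gp_closed gp_closed] using c by (simp only: Z.l_one)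
  moreover have "\<gamma> \<otimes>\<^bsub>L.\<Lambda>\<^esub> (y \<oplus>\<^bsub>L.\<Lambda>\<^esub> ?d) = (?d \<ominus>\<^bsub>L.\<Lambda>\<^esub> ?e) \<oplus>\<^bsub>L.\<Lambda>\<^esub> (?D \<ominus>\<^bsub>L.\<Lambda>\<^esub> \<one>\<^bsub>L.\<Lambda>\<^esub>) \<otimes>\<^bsub>L.\<Lambda>\<^esub> ?d"
    using y cl \<gamma>_def by (simp add: \<Lambda>.r_distr)
  moreover have "\<dots> = ?D \<otimes>\<^bsub>L.\<Lambda>\<^esub> ?d \<ominus>\<^bsub>L.\<Lambda>\<^esub> ?e"
    using cl by algebra
  ultimately show ?case using y cl by (intro bexI[of _ "y \<oplus>\<^bsub>L.\<Lambda>\<^esub> ?d"]) simp_all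
qed

text \<open>A finite combination of powers of the generator is a multiple of \<open>\<gamma>\<close>
  up to its total coefficient. At a finite level every element has the form of such a
  combination.\<close>

lemma gamma_dirac_sum:
  assumes "finite A" "\<And>a. a \<in> A \<Longrightarrow> c a \<in> carrier Z"
  shows "\<exists>y\<in>carrier L.\<Lambda>. \<gamma> \<otimes>\<^bsub>L.\<Lambda>\<^esub> y =
    (\<Oplus>\<^bsub>L.\<Lambda>\<^esub>a\<in>A. L.dirac (c a) (gp (j a))) \<ominus>\<^bsub>L.\<Lambda>\<^esub> L.dirac (\<Oplus>\<^bsub>Z\<^esub>a\<in>A. c a) \<one>\<^bsub>G\<^esub>"
  using assms
proof (induction A)
  case empty
  show ?case unfolding \<Lambda>.finsum_empty Z.finsum_empty dirac_zero[OF G.one_closed]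
    by (intro bexI[of _ "\<zero>\<^bsub>L.\<Lambda>\<^esub>"]) (simp_all add: a_minus_def)
next
  case (insert a A)
  then obtain y where y: "y \<in> carrier L.\<Lambda>" "\<gamma> \<otimes>\<^bsub>L.\<Lambda>\<^esub> y =
      (\<Oplus>\<^bsub>L.\<Lambda>\<^esub>a\<in>A. L.dirac (c a) (gp (j a))) \<ominus>\<^bsub>L.\<Lambda>\<^esub> L.dirac (\<Oplus>\<^bsub>Z\<^esub>a\<in>A. c a) \<one>\<^bsub>G\<^esub>" by blast
  have ca: "c a \<in> carrier Z" using insert by simp
  obtain w where w: "w \<in> carrier L.\<Lambda>" "\<gamma> \<otimes>\<^bsub>L.\<Lambda>\<^esub> w = L.dirac (c a) (gp (j a)) \<ominus>\<^bsub>L.\<Lambda>\<^esub> L.dirac (c a) \<one>\<^bsub>G\<^esub>"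
    using gamma_dirac[OF ca] by blast
  let ?S = "\<Oplus>\<^bsub>L.\<Lambda>\<^esub>a\<in>A. L.dirac (c a) (gp (j a))" and ?s = "\<Oplus>\<^bsub>Z\<^esub>a\<in>A. c a"
  let ?d = "L.dirac (c a) (gp (j a))" and ?e = "L.dirac (c a) \<one>\<^bsub>G\<^esub>" and ?f = "L.dirac ?s \<one>\<^bsub>G\<^esub>"
  have s: "?s \<in> carrier Z" using insert by (intro Z.finsum_closed) auto
  have dc: "L.dirac (c i) (gp (j i)) \<in> carrier L.\<Lambda>" if "i \<in> insert a A" for i
    by (rule L.dirac_closed[OF insert.prems[OF that] gp_closed])
  have S: "?S \<in> carrier L.\<Lambda>" using dc by (intro \<Lambda>.finsum_closed) auto
  have cl: "?d \<in> carrier L.\<Lambda>" "?e \<in> carrier L.\<Lambda>" "?f \<in> carrier L.\<Lambda>"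
    by (intro L.dirac_closed ca s gp_closed G.one_closed)+
  have 1: "(\<Oplus>\<^bsub>L.\<Lambda>\<^esub>a\<in>insert a A. L.dirac (c a) (gp (j a))) = ?d \<oplus>\<^bsub>L.\<Lambda>\<^esub> ?S"
    using insert.hyps dc by (intro \<Lambda>.finsum_insert) auto
  have "(\<Oplus>\<^bsub>Z\<^esub>a\<in>insert a A. c a) = c a \<oplus>\<^bsub>Z\<^esub> ?s"
    using insert by (intro Z.finsum_insert) auto
  then have 2: "L.dirac (\<Oplus>\<^bsub>Z\<^esub>a\<in>insert a A. c a) \<one>\<^bsub>G\<^esub> = ?e \<oplus>\<^bsub>L.\<Lambda>\<^esub> ?f"
    using dirac_add[OF ca s G.one_closed] by simp
  have "\<gamma> \<otimes>\<^bsub>L.\<Lambda>\<^esub> (w \<oplus>\<^bsub>L.\<Lambda>\<^esub> y) = (?d \<ominus>\<^bsub>L.\<Lambda>\<^esub> ?e) \<oplus>\<^bsub>L.\<Lambda>\<^esub> (?S \<ominus>\<^bsub>L.\<Lambda>\<^esub> ?f)"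
    using y w by (simp add: \<Lambda>.r_distr)
  also have "\<dots> = (?d \<oplus>\<^bsub>L.\<Lambda>\<^esub> ?S) \<ominus>\<^bsub>L.\<Lambda>\<^esub> (?e \<oplus>\<^bsub>L.\<Lambda>\<^esub> ?f)"
    by (rule \<Lambda>.diff_add_diff[OF cl(1,2) S cl(3)])
  finally show ?case unfolding 1 2 using y w by (intro bexI[of _ "w \<oplus>\<^bsub>L.\<Lambda>\<^esub> y"]) simp_all
qed

text \<open>The set of multiples of \<open>\<gamma>\<close> is compact, hence it suffices to solve \<open>x = \<gamma> y\<close> at every finite level.\<close>

lemma augmentation_ideal:
  assumes x: "x \<in> carrier L.\<Lambda>" and 0: "x (V 0) (V 0) = \<zero>\<^bsub>Z\<^esub>"
  shows "\<exists>y\<in>carrier L.\<Lambda>. x = \<gamma> \<otimes>\<^bsub>L.\<Lambda>\<^esub> y"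
proof -
  \<comment> \<open>Solutions of the equation at level \<open>n\<close>. These sets are nonempty,
    closed and decreasing, so compactness yields a common element.\<close>
  define C where "C n = {y \<in> topspace (rtop L.\<Lambda>). \<forall>b\<in>carrier (G Mod V n). (\<gamma> \<otimes>\<^bsub>L.\<Lambda>\<^esub> y) (V n) b = x (V n) b}" for n
  have ev: "\<exists>j. b = V n #>\<^bsub>G\<^esub> gp j" if "b \<in> carrier (G Mod V n)" for n b using coset_gp[OF that] .
  have ne: "C n \<noteq> {}" for n
  proof -
    let ?A = "carrier (G Mod V n)"
    \<comment> \<open>One power of the generator in each coset lifts \<open>x (V n)\<close> to a
      finite combination of group elements.\<close>
    obtain j where j: "\<And>b. b \<in> ?A \<Longrightarrow> b = V n #>\<^bsub>G\<^esub> gp (j b)" using coset_gp[of _ n] by metis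
    have xc: "x (V n) b \<in> carrier Z" if "b \<in> ?A" for b by (rule L.LambdaD(4)[OF x V_in_N that])
    have fin: "finite ?A" by (rule L.finite_quotient[OF V_in_N])
    obtain y where y: "y \<in> carrier L.\<Lambda>" "\<gamma> \<otimes>\<^bsub>L.\<Lambda>\<^esub> y =
        (\<Oplus>\<^bsub>L.\<Lambda>\<^esub>b\<in>?A. L.dirac (x (V n) b) (gp (j b))) \<ominus>\<^bsub>L.\<Lambda>\<^esub> L.dirac (\<Oplus>\<^bsub>Z\<^esub>b\<in>?A. x (V n) b) \<one>\<^bsub>G\<^esub>"
      using gamma_dirac_sum[where c = "x (V n)" and j = j, OF fin xc] by blast
    have dc: "L.dirac (x (V n) b) (gp (j b)) \<in> carrier L.\<Lambda>" if "b \<in> ?A" for b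
      by (rule L.dirac_closed[OF xc[OF that] gp_closed])
    have "(\<Oplus>\<^bsub>L.\<Lambda>\<^esub>b\<in>?A. L.dirac (x (V n) b) (gp (j b))) \<in> carrier L.\<Lambda>"
      using dc by (intro \<Lambda>.finsum_closed) auto
    \<comment> \<open>The subtracted term is the total of \<open>x\<close>, which is zero by
      assumption.\<close>
    then have gy: "\<gamma> \<otimes>\<^bsub>L.\<Lambda>\<^esub> y = (\<Oplus>\<^bsub>L.\<Lambda>\<^esub>b\<in>?A. L.dirac (x (V n) b) (gp (j b)))"
      using y(2) Lambda_total[OF x, of n] 0 dirac_zero[OF G.one_closed] by (simp add: a_minus_def)
    have "(\<gamma> \<otimes>\<^bsub>L.\<Lambda>\<^esub> y) (V n) b = x (V n) b" if b: "b \<in> ?A" for b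
    proof -
      have "(\<gamma> \<otimes>\<^bsub>L.\<Lambda>\<^esub> y) (V n) b = (\<Oplus>\<^bsub>Z\<^esub>a\<in>?A. L.dirac (x (V n) a) (gp (j a)) (V n) b)"
        unfolding gy by (rule Lambda_finsum_apply[OF fin dc V_in_N b])
      also have "\<dots> = (\<Oplus>\<^bsub>Z\<^esub>a\<in>?A. if a = b then x (V n) b else \<zero>\<^bsub>Z\<^esub>)"
      proof (rule Z.finsum_cong'[OF refl])
        fix a assume a: "a \<in> ?A"
        show "L.dirac (x (V n) a) (gp (j a)) (V n) b = (if a = b then x (V n) b else \<zero>\<^bsub>Z\<^esub>)"
          unfolding L.dirac_apply[OF V_in_N b] j[OF a, symmetric] by auto
      qed (use xc b in auto)
      also have "\<dots> = x (V n) b" by (rule Z.finsum_delta[OF fin b xc[OF b]])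
      finally show ?thesis .
    qed
    then have "y \<in> C n" using y(1) by (simp add: C_def L.topspace_Lambda)
    then show ?thesis by blast
  qed
  have mult_cont: "continuous_map (rtop L.\<Lambda>) (rtop L.\<Lambda>) (\<lambda>y. \<gamma> \<otimes>\<^bsub>L.\<Lambda>\<^esub> y)"
    using \<Lambda>.continuous_smult[OF \<Lambda>.profinite, of "rtop L.\<Lambda>" "\<lambda>_. \<gamma>" "\<lambda>y. y"] by simp
  have closed: "closedin (rtop L.\<Lambda>) (C n)" for n
    unfolding C_def
  proof (rule closedin_all_eq[OF Z.top_facts(4)])
    fix b assume b: "b \<in> carrier (G Mod V n)"
    show "continuous_map (rtop L.\<Lambda>) (rtop Z) (\<lambda>y. (\<gamma> \<otimes>\<^bsub>L.\<Lambda>\<^esub> y) (V n) b)"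
      using continuous_map_compose[OF mult_cont L.continuous_eval[OF V_in_N b]] by (simp add: o_def)
    show "continuous_map (rtop L.\<Lambda>) (rtop Z) (\<lambda>y. x (V n) b)"
      using L.LambdaD(4)[OF x V_in_N b] by simp
  qed
  have "decseq C"
    unfolding decseq_def
  proof (intro allI impI subsetI)
    fix m n y assume mn: "m \<le> n" and "y \<in> C n"
    then have y: "y \<in> carrier L.\<Lambda>" "\<And>b. b \<in> carrier (G Mod V n) \<Longrightarrow> (\<gamma> \<otimes>\<^bsub>L.\<Lambda>\<^esub> y) (V n) b = x (V n) b"
      by (auto simp: C_def L.topspace_Lambda)
    have gy: "\<gamma> \<otimes>\<^bsub>L.\<Lambda>\<^esub> y \<in> carrier L.\<Lambda>" using y(1) by simp
    have "(\<gamma> \<otimes>\<^bsub>L.\<Lambda>\<^esub> y) (V n) = x (V n)"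
      by (rule PiE_ext[OF L.LambdaD(2)[OF gy V_in_N] L.LambdaD(2)[OF x V_in_N] y(2)])
    then have "(\<gamma> \<otimes>\<^bsub>L.\<Lambda>\<^esub> y) (V m) = x (V m)"
      using L.LambdaD(3)[OF gy V_in_N V_in_N V_decseq[OF mn]] L.LambdaD(3)[OF x V_in_N V_in_N V_decseq[OF mn]] by simp
    then show "y \<in> C m" using y(1) by (simp add: C_def L.topspace_Lambda)
  qed
  then have "(\<Inter>n. C n) \<noteq> {}"
    by (rule compact_space_imp_nest[OF L.Lambda_compact closed ne])
  then obtain y where y: "\<And>n. y \<in> C n" by blast
  have yc: "y \<in> carrier L.\<Lambda>" using y[of 0] by (simp add: C_def L.topspace_Lambda)
  have "x = \<gamma> \<otimes>\<^bsub>L.\<Lambda>\<^esub> y"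
    by (rule Lambda_eqI_V[OF x]) (use y yc in \<open>auto simp: C_def\<close>)
  then show ?thesis using yc by blast
qed

end

section \<open>The coefficient modules\<close>

context padic begin

lemma E1_part_simps:
  "\<zero>\<^bsub>E1_part p t\<^esub> = (\<lambda>k. \<zero>\<^bsub>Z\<^esub>)"
  "f \<oplus>\<^bsub>E1_part p t\<^esub> h = (\<lambda>k. f k \<oplus>\<^bsub>Z\<^esub> h k)"
  "c \<odot>\<^bsub>E1_part p t\<^esub> f = (\<lambda>k. c \<otimes>\<^bsub>Z\<^esub> f k)"
  "mtop (E1_part p t) = subtopology (product_topology (\<lambda>_. rtop Z) UNIV) (carrier (E1_part p t))"
  by (simp_all add: E1_part_def E1_def Let_def)

lemma E1_part_carrier:
  "f \<in> carrier (E1_part p t) \<longleftrightarrow> (\<forall>k. f k \<in> carrier Z) \<and> (\<forall>k. f k \<noteq> \<zero>\<^bsub>Z\<^esub> \<longrightarrow> - 2 * k = t)"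
proof -
  have "finite {k. f k \<noteq> \<zero>\<^bsub>Z\<^esub>}" if "\<forall>k. f k \<noteq> \<zero>\<^bsub>Z\<^esub> \<longrightarrow> - 2 * k = t"
    by (rule finite_subset[of _ "{(- t) div 2}"]) (use that in auto)
  then show ?thesis by (auto simp: E1_part_def E1_def Let_def)
qed

text \<open>Exhibits the part as a product of compact factors, of which at most one is nonzero, and
  none when t is odd.\<close>

lemma E1_part_PiE:
  "carrier (E1_part p t) = PiE UNIV (\<lambda>k. if - 2 * k = t then carrier Z else {\<zero>\<^bsub>Z\<^esub>})"
proof (intro equalityI subsetI)
  fix f assume "f \<in> carrier (E1_part p t)"
  then show "f \<in> PiE UNIV (\<lambda>k. if - 2 * k = t then carrier Z else {\<zero>\<^bsub>Z\<^esub>})"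
    unfolding E1_part_carrier by auto
next
  fix f assume f: "f \<in> PiE UNIV (\<lambda>k. if - 2 * k = t then carrier Z else {\<zero>\<^bsub>Z\<^esub>})"
  have "f k \<in> carrier Z \<and> (f k \<noteq> \<zero>\<^bsub>Z\<^esub> \<longrightarrow> - 2 * k = t)" for k
    using PiE_mem[OF f, of k] by (cases "- 2 * k = t") auto
  then show "f \<in> carrier (E1_part p t)" unfolding E1_part_carrier by blast
qed

lemma E1_part_ext:
  assumes "f \<in> carrier (E1_part p t)" "h \<in> carrier (E1_part p t)"
    and "\<And>k. - 2 * k = t \<Longrightarrow> f k = h k"
  shows "f = h"
  using assms unfolding E1_part_carrier by (intro ext) metis

lemma E1_part_profinite: "profinite_module Z (E1_part p t)"
proof -
  let ?M = "E1_part p t" and ?X = "product_topology (\<lambda>_::int. rtop Z) UNIV"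
  have C: "f k \<in> carrier Z" if "f \<in> carrier ?M" for f k using that by (simp add: E1_part_carrier)
  have add: "f \<oplus>\<^bsub>?M\<^esub> h \<in> carrier ?M" if "f \<in> carrier ?M" "h \<in> carrier ?M" for f h
    using that unfolding E1_part_carrier E1_part_simps by (metis Z.a_closed Z.l_zero Z.zero_closed)
  have smult: "c \<odot>\<^bsub>?M\<^esub> f \<in> carrier ?M" if "c \<in> carrier Z" "f \<in> carrier ?M" for c f
    using that unfolding E1_part_carrier E1_part_simps by (metis Z.m_closed Z.r_null)
  have zero: "\<zero>\<^bsub>?M\<^esub> \<in> carrier ?M" unfolding E1_part_carrier E1_part_simps by simp
  have ab: "abelian_group ?M"
  proof (rule abelian_groupI)
    fix f assume f: "f \<in> carrier ?M"
    show "\<exists>h\<in>carrier ?M. h \<oplus>\<^bsub>?M\<^esub> f = \<zero>\<^bsub>?M\<^esub>"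
    proof (rule bexI)
      show "(\<ominus>\<^bsub>Z\<^esub> \<one>\<^bsub>Z\<^esub>) \<odot>\<^bsub>?M\<^esub> f \<in> carrier ?M" using f by (intro smult) auto
      show "(\<ominus>\<^bsub>Z\<^esub> \<one>\<^bsub>Z\<^esub>) \<odot>\<^bsub>?M\<^esub> f \<oplus>\<^bsub>?M\<^esub> f = \<zero>\<^bsub>?M\<^esub>"
        using C[OF f] by (simp add: E1_part_simps Z.l_minus Z.l_neg)
    qed
    show "\<zero>\<^bsub>?M\<^esub> \<oplus>\<^bsub>?M\<^esub> f = f" using C[OF f] by (simp add: E1_part_simps)
    fix h assume h: "h \<in> carrier ?M"
    show "f \<oplus>\<^bsub>?M\<^esub> h = h \<oplus>\<^bsub>?M\<^esub> f" using C[OF f] C[OF h] by (simp add: E1_part_simps Z.a_comm)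
    fix k assume k: "k \<in> carrier ?M"
    show "f \<oplus>\<^bsub>?M\<^esub> h \<oplus>\<^bsub>?M\<^esub> k = f \<oplus>\<^bsub>?M\<^esub> (h \<oplus>\<^bsub>?M\<^esub> k)"
      using C[OF f] C[OF h] C[OF k] by (simp add: E1_part_simps Z.a_assoc)
  qed (auto intro: add zero)
  have ts: "topspace (mtop ?M) = carrier ?M"
    unfolding E1_part_simps using C by (auto simp: topspace_Z)
  have into: "continuous_map W (mtop ?M) F"
    if "\<And>w. w \<in> topspace W \<Longrightarrow> F w \<in> carrier ?M" "\<And>k. continuous_map W (rtop Z) (\<lambda>w. F w k)" for W and F
    unfolding E1_part_simps using that by (auto simp: continuous_map_in_subtopology continuous_map_componentwise)
  have ev: "continuous_map (mtop ?M) (rtop Z) (\<lambda>f. f k)" for k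
    unfolding E1_part_simps by (intro continuous_map_from_subtopology continuous_map_product_projection) simp
  have pr: "continuous_map (prod_topology Y (mtop ?M)) (rtop Z) (\<lambda>z. snd z k)"
    "continuous_map (prod_topology (mtop ?M) Y) (rtop Z) (\<lambda>z. fst z k)" for Y k
    using continuous_map_compose[OF continuous_map_snd ev] continuous_map_compose[OF continuous_map_fst ev]
    by (simp_all add: o_def)
  show ?thesis
    unfolding profinite_module_def
  proof (intro conjI ts)
    show "module Z ?M"
    proof (rule moduleI[OF Z_cring ab])
      fix a f assume a: "a \<in> carrier Z" and f: "f \<in> carrier ?M"
      show "a \<odot>\<^bsub>?M\<^esub> f \<in> carrier ?M" by (rule smult[OF a f])
      fix b assume b: "b \<in> carrier Z"
      show "(a \<oplus>\<^bsub>Z\<^esub> b) \<odot>\<^bsub>?M\<^esub> f = a \<odot>\<^bsub>?M\<^esub> f \<oplus>\<^bsub>?M\<^esub> b \<odot>\<^bsub>?M\<^esub> f"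
        using a b C[OF f] by (simp add: E1_part_simps Z.l_distr)
      show "(a \<otimes>\<^bsub>Z\<^esub> b) \<odot>\<^bsub>?M\<^esub> f = a \<odot>\<^bsub>?M\<^esub> (b \<odot>\<^bsub>?M\<^esub> f)"
        using a b C[OF f] by (simp add: E1_part_simps Z.m_assoc)
    next
      fix a f h assume "a \<in> carrier Z" "f \<in> carrier ?M" "h \<in> carrier ?M"
      then show "a \<odot>\<^bsub>?M\<^esub> (f \<oplus>\<^bsub>?M\<^esub> h) = a \<odot>\<^bsub>?M\<^esub> f \<oplus>\<^bsub>?M\<^esub> a \<odot>\<^bsub>?M\<^esub> h"
        using C[of f] C[of h] by (simp add: E1_part_simps Z.r_distr)
    next
      fix f assume "f \<in> carrier ?M"
      then show "\<one>\<^bsub>Z\<^esub> \<odot>\<^bsub>?M\<^esub> f = f" using C[of f] by (simp add: E1_part_simps)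
    qed
    have "compactin ?X (carrier ?M)"
      unfolding E1_part_PiE compactin_PiE using Z_compact
      by (auto simp: compact_space_def topspace_Z intro!: finite_imp_compactin)
    then show "compact_space (mtop ?M)" unfolding E1_part_simps by (rule compact_space_subtopology)
    show "Hausdorff_space (mtop ?M)"
      unfolding E1_part_simps
      by (intro Hausdorff_space_subtopology) (simp add: Hausdorff_space_product_topology Z.top_facts)
    show "totally_disconnected_space (mtop ?M)"
      unfolding E1_part_simps
      by (intro totally_disconnected_space_subtopology totally_disconnected_space_product Z.top_facts)
    show "continuous_map (prod_topology (mtop ?M) (mtop ?M)) (mtop ?M) (\<lambda>(f, h). f \<oplus>\<^bsub>?M\<^esub> h)"
      unfolding case_prod_unfold
    proof (rule into)
      fix k
      show "continuous_map (prod_topology (mtop ?M) (mtop ?M)) (rtop Z) (\<lambda>z. (fst z \<oplus>\<^bsub>?M\<^esub> snd z) k)"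
        unfolding E1_part_simps(2) by (rule Z.continuous_add[OF Z.profinite, simplified]) (rule pr)+
    qed (use ts add in auto)
    show "continuous_map (prod_topology (rtop Z) (mtop ?M)) (mtop ?M) (\<lambda>(c, f). c \<odot>\<^bsub>?M\<^esub> f)"
      unfolding case_prod_unfold
    proof (rule into)
      fix k
      show "continuous_map (prod_topology (rtop Z) (mtop ?M)) (rtop Z) (\<lambda>z. (fst z \<odot>\<^bsub>?M\<^esub> snd z) k)"
        unfolding E1_part_simps(3)
        by (rule Z.continuous_smult[OF Z.profinite, simplified]) (rule continuous_map_fst pr)+
    qed (use ts smult topspace_Z in auto)
  qed
qed

text \<open>If u and w agree modulo \<open>q n\<close>, then u = v w with v in \<open>V n\<close>,
  and the power of v stays in this subgroup. Working with subgroups treats negative exponents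
  alike.\<close>

lemma power_character: "padic_character p (\<lambda>u. u [^]\<^bsub>G\<^esub> (k :: int))"
proof
  fix u w n assume u: "u \<in> carrier G" and w: "w \<in> carrier G" and eq: "u n = w n"
  note uk = G.int_pow_closed[OF u, of k] and wk = G.int_pow_closed[OF w, of k]
  obtain v where v: "v \<in> V n" "u = v \<otimes>\<^bsub>G\<^esub> w"
    using V_coset_iff[OF u w] eq unfolding r_coset_def by blast
  have vG: "v \<in> carrier G" using v(1) subgroup.subset[OF V_subgroup] by blast
  have "u [^]\<^bsub>G\<^esub> k = v [^]\<^bsub>G\<^esub> k \<otimes>\<^bsub>G\<^esub> w [^]\<^bsub>G\<^esub> k"
    unfolding v(2) by (rule G.int_pow_distrib[OF vG w])
  then have "u [^]\<^bsub>G\<^esub> k \<in> V n #>\<^bsub>G\<^esub> w [^]\<^bsub>G\<^esub> k"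
    using G.subgroup_int_pow_closed[OF V_subgroup v(1), of k] unfolding r_coset_def by blast
  then show "(u [^]\<^bsub>G\<^esub> k) n = (w [^]\<^bsub>G\<^esub> k) n" using V_coset_iff[OF uk wk] by blast
qed (rule G.int_pow_closed G.int_pow_distrib, assumption+)+

lemma trivial_character: "padic_character p (\<lambda>u. \<one>\<^bsub>Z\<^esub>)"
  by standard simp_all

sublocale T: padic_character p "\<lambda>u. \<one>\<^bsub>Zp p\<^esub>" by (rule trivial_character)

text \<open>Only the coefficient of u^k with t = -2k can be nonzero, and g acts on it by g^k. For
  odd t the part is zero, so the rounding in the exponent is harmless.\<close>

lemma act_eq_power:
  assumes f: "f \<in> carrier (E1_part p t)" and g: "g \<in> carrier G"
  shows "E1_act p g f = (g [^]\<^bsub>G\<^esub> ((- t) div 2)) \<odot>\<^bsub>E1_part p t\<^esub> f"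
proof
  fix i
  have P: "g [^]\<^bsub>G\<^esub> j \<in> carrier Z" for j :: int using G.int_pow_closed[OF g, of j] Z.Units_closed by simp
  show "E1_act p g f i = ((g [^]\<^bsub>G\<^esub> ((- t) div 2)) \<odot>\<^bsub>E1_part p t\<^esub> f) i"
  proof (cases "f i = \<zero>\<^bsub>Z\<^esub>")
    case True
    then show ?thesis using P by (simp add: E1_act_def E1_part_simps del: G_simps)
  next
    case False
    then have "- 2 * i = t" using f by (simp add: E1_part_carrier)
    then have "(- t) div 2 = i" by presburger
    then show ?thesis by (simp add: E1_act_def E1_part_simps)
  qed
qed

lemma trivial_module_smult:
  assumes "x \<in> carrier L.\<Lambda>" "m \<in> carrier Z"
  shows "x \<odot>\<^bsub>trivial_module Z G\<^esub> m = T.\<xi> x \<otimes>\<^bsub>Z\<^esub> m"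
  using T.completed_smult_eq[OF Z.profinite assms(1), of m "\<lambda>g a. a"] assms(2)
  by (simp add: trivial_module_def completed_module_def)

lemma trivial_module_simps:
  "carrier (trivial_module Z G) = carrier Z" "\<zero>\<^bsub>trivial_module Z G\<^esub> = \<zero>\<^bsub>Z\<^esub>"
  "add (trivial_module Z G) = add Z" "mtop (trivial_module Z G) = rtop Z"
  by (simp_all add: trivial_module_def completed_module_def)

lemma trivial_module_profinite: "profinite_module L.\<Lambda> (trivial_module Z G)"
  unfolding trivial_module_def by (rule T.completed_module_profinite[OF Z.profinite]) simp

text \<open>For the trivial character \<open>\<xi>\<close> adds up all coefficients, and by
  \<open>Lambda_total\<close> the sum is the coefficient at the trivial quotient.\<close>

lemma trivial_xi:
  assumes x: "x \<in> carrier L.\<Lambda>" shows "T.\<xi> x = x (V 0) (V 0)"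
proof
  fix n
  have "x (V 0) (V 0) n = (\<Sum>b\<in>carrier (G Mod V n). x (V n) b n) mod q n"
    unfolding Lambda_total[OF x, of n]
    by (rule Z_finsum[OF L.finite_quotient[OF V_in_N]]) (rule L.LambdaD(4)[OF x V_in_N])
  moreover have "[(\<Sum>b\<in>carrier (G Mod V n). x (V n) b n * \<one>\<^bsub>Z\<^esub> n) = (\<Sum>b\<in>carrier (G Mod V n). x (V n) b n * 1)] (mod q n)"
    by (intro cong_sum cong_mult cong_refl) (simp add: Z_simps cong_def)
  ultimately show "T.\<xi> x n = x (V 0) (V 0) n" by (simp add: T.\<xi>_def cong_def)
qed

lemma of_Z_minus_one: "of_Z (a - 1) = of_Z a \<ominus>\<^bsub>Z\<^esub> \<one>\<^bsub>Z\<^esub>"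
proof -
  have "of_Z a = of_Z (a - 1) \<oplus>\<^bsub>Z\<^esub> \<one>\<^bsub>Z\<^esub>" by (simp add: of_Z_def Z_simps mod_add_eq)
  then show ?thesis
    using of_Z_closed[of "a - 1"] by (simp add: a_minus_def Z.a_assoc Z.r_neg)
qed

end

context odd_padic begin

text \<open>\<open>\<gamma>\<close> plus one is the group element of the generator, and
  \<open>\<xi>\<close> is additive and extends \<open>\<theta>\<close>. This is the scalar by which
  \<open>\<gamma>\<close> acts on a module with character \<open>\<theta>\<close>.\<close>

lemma xi_gamma:
  assumes "padic_character p \<theta>"
  shows "padic_character.\<xi> p \<theta> \<gamma> = \<theta> (gp 1) \<ominus>\<^bsub>Z\<^esub> \<one>\<^bsub>Z\<^esub>"
proof -
  interpret X: padic_character p \<theta> by fact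
  have cl: "\<gamma> \<in> carrier L.\<Lambda>" "X.\<xi> \<gamma> \<in> carrier Z" "\<theta> (gp 1) \<in> carrier Z"
    using X.xi_closed[OF gamma_closed] X.theta_closed[OF gp_closed] Z.Units_closed by auto
  have "\<gamma> \<oplus>\<^bsub>L.\<Lambda>\<^esub> \<one>\<^bsub>L.\<Lambda>\<^esub> = L.dirac \<one>\<^bsub>Z\<^esub> (gp 1)"
    unfolding \<gamma>_def using L.dirac_closed[OF Z.one_closed gp_closed, of 1]
    by (simp add: a_minus_def \<Lambda>.a_assoc \<Lambda>.l_neg)
  then have e: "X.\<xi> \<gamma> \<oplus>\<^bsub>Z\<^esub> \<one>\<^bsub>Z\<^esub> = \<theta> (gp 1)"
    using X.xi_add[of \<gamma> "\<one>\<^bsub>L.\<Lambda>\<^esub>"] X.xi_one X.xi_dirac[OF Z.one_closed gp_closed, of 1] cl by simp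
  show ?thesis unfolding e[symmetric] using cl(2) by (simp add: a_minus_def Z.a_assoc Z.r_neg)
qed

definition aug :: "((nat \<Rightarrow> int) set \<Rightarrow> (nat \<Rightarrow> int) set \<Rightarrow> nat \<Rightarrow> int) \<Rightarrow> nat \<Rightarrow> int" where
  "aug = (\<lambda>x\<in>carrier L.\<Lambda>. T.\<xi> x)"

text \<open>Scalars show that \<open>aug\<close> is onto. An element of its kernel has coefficient
  zero at \<open>V 0\<close>, so \<open>augmentation_ideal\<close> applies; conversely the trivial
  character sends \<open>\<gamma>\<close> to 1 - 1.\<close>

lemma augmentation: "cyclic_resolution L.\<Lambda> \<gamma> (trivial_module Z G) aug"
proof (intro cyclic_resolution.intro cyclic_resolution_axioms.intro L.Lambda_profinite
    trivial_module_profinite gamma_closed)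
  show "aug \<in> cont_hom L.\<Lambda> (ring_as_topmod L.\<Lambda>) (trivial_module Z G)"
    unfolding aug_def
    using cont_homI_restrict[of "ring_as_topmod L.\<Lambda>" L.\<Lambda> "trivial_module Z G" T.\<xi>] T.xi_continuous
    by (simp add: trivial_module_simps trivial_module_smult L.topspace_Lambda
        T.xi_add T.xi_mult profinite_moduleD(1)[OF \<Lambda>.profinite])
  show "aug ` carrier L.\<Lambda> = carrier (trivial_module Z G)"
  proof
    show "carrier (trivial_module Z G) \<subseteq> aug ` carrier L.\<Lambda>"
    proof
      fix c assume "c \<in> carrier (trivial_module Z G)"
      then have c: "c \<in> carrier Z" by (simp add: trivial_module_simps)
      have "scalar_embedding Z G c \<in> carrier L.\<Lambda>"
        unfolding L.scalar_embedding_dirac by (rule L.dirac_closed[OF c G.one_closed])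
      moreover from this have "c = aug (scalar_embedding Z G c)" using T.xi_scalar[OF c] by (simp add: aug_def)
      ultimately show "c \<in> aug ` carrier L.\<Lambda>" by blast
    qed
  qed (auto simp: aug_def trivial_module_simps)
  fix x assume x: "x \<in> carrier L.\<Lambda>"
  show "x = \<zero>\<^bsub>L.\<Lambda>\<^esub>" if "\<gamma> \<otimes>\<^bsub>L.\<Lambda>\<^esub> x = \<zero>\<^bsub>L.\<Lambda>\<^esub>" by (rule gamma_injective[OF x that])
  show "aug x = \<zero>\<^bsub>trivial_module Z G\<^esub> \<longleftrightarrow> (\<exists>y\<in>carrier L.\<Lambda>. x = \<gamma> \<otimes>\<^bsub>L.\<Lambda>\<^esub> y)"
  proof
    assume "aug x = \<zero>\<^bsub>trivial_module Z G\<^esub>"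
    then have "x (V 0) (V 0) = \<zero>\<^bsub>Z\<^esub>" using x trivial_xi[OF x] by (simp add: aug_def trivial_module_simps)
    then show "\<exists>y\<in>carrier L.\<Lambda>. x = \<gamma> \<otimes>\<^bsub>L.\<Lambda>\<^esub> y" by (rule augmentation_ideal[OF x])
  next
    assume "\<exists>y\<in>carrier L.\<Lambda>. x = \<gamma> \<otimes>\<^bsub>L.\<Lambda>\<^esub> y"
    then obtain y where y: "y \<in> carrier L.\<Lambda>" "x = \<gamma> \<otimes>\<^bsub>L.\<Lambda>\<^esub> y" by blast
    have "T.\<xi> \<gamma> = \<zero>\<^bsub>Z\<^esub>" using xi_gamma[OF trivial_character] by (simp add: a_minus_def Z.r_neg)
    then show "aug x = \<zero>\<^bsub>trivial_module Z G\<^esub>"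
      using x y T.xi_mult[OF gamma_closed y(1)] T.xi_closed[OF y(1)] by (simp add: aug_def trivial_module_simps)
  qed
qed

section \<open>The divisor \<open>g\<^sup>k - 1\<close>\<close>

definition twist :: "int \<Rightarrow> nat \<Rightarrow> int" where
  "twist k = gp 1 [^]\<^bsub>G\<^esub> k \<ominus>\<^bsub>Z\<^esub> \<one>\<^bsub>Z\<^esub>"

text \<open>The p-adic valuation of \<open>g^k - 1\<close> for nonzero \<open>k\<close>. The summand
  one appears because g^(p-1) - 1 is already divisible by p; dividing out p - 1 makes the index t'
  of the theorem visible.\<close>

definition val :: "int \<Rightarrow> nat" where
  "val k = (if int p - 1 dvd k then multiplicity (int p) (k div (int p - 1)) + 1 else 0)"

lemma twist_closed [simp]: "twist k \<in> carrier Z"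
  unfolding twist_def using G.int_pow_closed[OF gp_closed, of 1 k] Z.Units_closed by simp

text \<open>The order of a primitive root modulo \<open>p ^ Suc n\<close> is the totient
  \<open>p ^ n * (p - 1)\<close>, whence the shift by one between the two sides.\<close>

lemma power_dvd_iff:
  "q (Suc n) dvd int g0 ^ m - 1 \<longleftrightarrow> q n * (int p - 1) dvd int m"
proof -
  have "q (Suc n) dvd int g0 ^ m - 1 \<longleftrightarrow> [int g0 ^ m = 1] (mod q (Suc n))"
    by (simp add: cong_iff_dvd_diff)
  also have "\<dots> \<longleftrightarrow> [int (g0 ^ m) = int 1] (mod int (p ^ Suc n))" by simp
  also have "\<dots> \<longleftrightarrow> [g0 ^ m = 1] (mod p ^ Suc n)" by (rule cong_int_iff)
  also have "\<dots> \<longleftrightarrow> p ^ n * (p - 1) dvd m"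
    using g0[of "Suc n"] totient_prime_power[OF prime_p, of "Suc n"]
    by (simp only: ord_divides residue_primroot_def) simp
  also have "\<dots> \<longleftrightarrow> int (p ^ n * (p - 1)) dvd int m" by (simp only: int_dvd_int_iff)
  also have "int (p ^ n * (p - 1)) = q n * (int p - 1)" using p_gt_1 by (simp add: of_nat_diff)
  finally show ?thesis .
qed

lemma power_minus_one_factor:
  assumes k: "k \<noteq> 0" and m: "m = nat \<bar>k\<bar>"
  obtains a where "int g0 ^ m - 1 = a * q (val k)" "coprime a (int p)"
proof -
  \<comment> \<open>Divisibility ignores the sign, so \<open>k\<close> may replace its absolute
    value.\<close>
  have dvd: "q (Suc n) dvd int g0 ^ m - 1 \<longleftrightarrow> q n * (int p - 1) dvd k" for n
    unfolding power_dvd_iff m by simp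
  have "q (val k) dvd int g0 ^ m - 1 \<and> \<not> q (Suc (val k)) dvd int g0 ^ m - 1"
  proof (cases "int p - 1 dvd k")
    case True
    then obtain s where s: "k = (int p - 1) * s" by blast
    have pn: "int p - 1 \<noteq> 0" using p_gt_1 by simp
    have s0: "s \<noteq> 0" using k s by auto
    have v: "val k = Suc (multiplicity (int p) s)" using True pn by (simp add: val_def s)
    have d: "q n * (int p - 1) dvd k \<longleftrightarrow> n \<le> multiplicity (int p) s" for n
    proof -
      have "q n * (int p - 1) dvd k \<longleftrightarrow> q n dvd s" unfolding s using pn by (simp add: mult.commute)
      also have "\<dots> \<longleftrightarrow> n \<le> multiplicity (int p) s"
        using s0 p_gt_1 by (intro power_dvd_iff_le_multiplicity) auto
      finally show ?thesis .
    qed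
    show ?thesis unfolding v dvd d by simp
  next
    case False
    then have "val k = 0" by (simp add: val_def)
    then show ?thesis using dvd[of 0] False by simp
  qed
  then obtain a where a: "int g0 ^ m - 1 = a * q (val k)" "\<not> q (Suc (val k)) dvd a * q (val k)"
    by (metis dvdE mult.commute)
  have "\<not> int p dvd a"
  proof
    assume "int p dvd a"
    then have "int p * q (val k) dvd a * q (val k)" by (rule mult_dvd_mono) simp
    then show False using a(2) by simp
  qed
  have "prime (int p)" using prime_p by simp
  then have "coprime a (int p)" using \<open>\<not> int p dvd a\<close> prime_imp_coprime coprime_commute by blast
  then show ?thesis using that a(1) by blast
qed

text \<open>For positive \<open>k\<close> this is the integer factorisation; for negative
  \<open>k\<close> it follows from g^(-m) - 1 = -g^(-m) (g^m - 1).\<close>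

lemma twist_factor:
  assumes k: "k \<noteq> 0"
  obtains u where "u \<in> Units Z" "twist k = u \<otimes>\<^bsub>Z\<^esub> of_Z (q (val k))"
proof -
  define m where "m = nat \<bar>k\<bar>"
  obtain a where a: "int g0 ^ m - 1 = a * q (val k)" "coprime a (int p)"
    by (rule power_minus_one_factor[OF k m_def])
  have u: "of_Z a \<in> Units Z" by (rule of_Z_Unit[OF a(2)])
  have gm: "gp m \<ominus>\<^bsub>Z\<^esub> \<one>\<^bsub>Z\<^esub> = of_Z a \<otimes>\<^bsub>Z\<^esub> of_Z (q (val k))"
    unfolding gp_def of_Z_minus_one[symmetric] a(1) of_Z_mult ..
  have pw: "gp 1 [^]\<^bsub>G\<^esub> int m = gp m" unfolding int_pow_int gp_pow[symmetric] ..
  show ?thesis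
  proof (cases "k > 0")
    case True
    then have "twist k = gp m \<ominus>\<^bsub>Z\<^esub> \<one>\<^bsub>Z\<^esub>" using pw by (simp add: twist_def m_def)
    then show ?thesis using that[OF u] gm by simp
  next
    case False
    then have km: "k = - int m" by (simp add: m_def)
    define i where "i = inv\<^bsub>G\<^esub> gp m"
    have i: "i \<in> Units Z" "i \<otimes>\<^bsub>Z\<^esub> gp m = \<one>\<^bsub>Z\<^esub>"
      using G.inv_closed[OF gp_closed[of m]] G.l_inv[OF gp_closed[of m]] by (simp_all add: i_def)
    have gmZ: "gp m \<in> carrier Z" "i \<in> carrier Z" using gp_closed[of m] i(1) Z.Units_closed by auto
    have "twist k = i \<ominus>\<^bsub>Z\<^esub> \<one>\<^bsub>Z\<^esub>"
      unfolding twist_def km G.int_pow_neg[OF gp_closed] pw i_def ..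
    \<comment> \<open>Minus one is written as 0 - 1 so that \<open>of_Z_minus_one\<close> turns it
      into the image of an integer, which \<open>of_Z_Unit\<close> recognises as a unit.\<close>
    also have "\<dots> = (of_Z 0 \<ominus>\<^bsub>Z\<^esub> \<one>\<^bsub>Z\<^esub>) \<otimes>\<^bsub>Z\<^esub> i \<otimes>\<^bsub>Z\<^esub> (gp m \<ominus>\<^bsub>Z\<^esub> \<one>\<^bsub>Z\<^esub>)"
    proof -
      have "of_Z 0 = \<zero>\<^bsub>Z\<^esub>" by (simp add: of_Z_def Z_simps)
      then show ?thesis
        using gmZ i(2) by (simp add: a_minus_def Z.r_distr Z.l_minus Z.r_minus Z.m_assoc Z.minus_add Z.a_comm)
    qed
    also have "\<dots> = (of_Z (- 1) \<otimes>\<^bsub>Z\<^esub> i \<otimes>\<^bsub>Z\<^esub> of_Z a) \<otimes>\<^bsub>Z\<^esub> of_Z (q (val k))"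
      unfolding gm using gmZ of_Z_minus_one[of 0] by (simp add: Z.m_assoc)
    finally show ?thesis
      using that[of "of_Z (- 1) \<otimes>\<^bsub>Z\<^esub> i \<otimes>\<^bsub>Z\<^esub> of_Z a"] of_Z_Unit[of "- 1"] i(1) u by simp
  qed
qed

lemma twist_injective:
  assumes k: "k \<noteq> 0" and z: "z \<in> carrier Z" and 0: "twist k \<otimes>\<^bsub>Z\<^esub> z = \<zero>\<^bsub>Z\<^esub>"
  shows "z = \<zero>\<^bsub>Z\<^esub>"
proof -
  obtain u where u: "u \<in> Units Z" "twist k = u \<otimes>\<^bsub>Z\<^esub> of_Z (q (val k))" by (rule twist_factor[OF k])
  have "u \<otimes>\<^bsub>Z\<^esub> (of_Z (q (val k)) \<otimes>\<^bsub>Z\<^esub> z) = u \<otimes>\<^bsub>Z\<^esub> \<zero>\<^bsub>Z\<^esub>"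
    using 0 u z Z.Units_closed[OF u(1)] by (simp add: Z.m_assoc)
  then have "of_Z (q (val k)) \<otimes>\<^bsub>Z\<^esub> z = \<zero>\<^bsub>Z\<^esub>" using u z by (simp only: Z.Units_l_cancel Z.m_closed of_Z_closed Z.zero_closed)
  then show ?thesis by (rule Z_power_torsion_free[OF z])
qed

text \<open>Up to a unit \<open>twist k\<close> is \<open>q (val k)\<close>, and divisibility by
  this power of p shows as a zero residue. A single residue thus reads off the quotient by
  \<open>twist k\<close>.\<close>

lemma twist_image:
  assumes k: "k \<noteq> 0" and z: "z \<in> carrier Z"
  shows "z (val k) = 0 \<longleftrightarrow> (\<exists>y\<in>carrier Z. z = twist k \<otimes>\<^bsub>Z\<^esub> y)"
proof
  obtain u where u: "u \<in> Units Z" "twist k = u \<otimes>\<^bsub>Z\<^esub> of_Z (q (val k))" by (rule twist_factor[OF k])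
  note uc = Z.Units_closed[OF u(1)] and ui = Z.Units_inv_closed[OF u(1)]
  {
    assume "z (val k) = 0"
    then obtain y where y: "y \<in> carrier Z" "z = of_Z (q (val k)) \<otimes>\<^bsub>Z\<^esub> y" by (rule Z_divide_power[OF z])
    have "twist k \<otimes>\<^bsub>Z\<^esub> (inv\<^bsub>Z\<^esub> u \<otimes>\<^bsub>Z\<^esub> y) = (u \<otimes>\<^bsub>Z\<^esub> inv\<^bsub>Z\<^esub> u) \<otimes>\<^bsub>Z\<^esub> (of_Z (q (val k)) \<otimes>\<^bsub>Z\<^esub> y)"
      unfolding u(2) using uc ui y(1) of_Z_closed[of "q (val k)"] by (simp add: Z.m_ac)
    also have "\<dots> = z" using u(1) z by (simp add: y(2)[symmetric])
    finally show "\<exists>y\<in>carrier Z. z = twist k \<otimes>\<^bsub>Z\<^esub> y" using ui y(1) by (intro bexI[of _ "inv\<^bsub>Z\<^esub> u \<otimes>\<^bsub>Z\<^esub> y"]) auto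
  }
  assume "\<exists>y\<in>carrier Z. z = twist k \<otimes>\<^bsub>Z\<^esub> y"
  then obtain y where y: "z = twist k \<otimes>\<^bsub>Z\<^esub> y" by blast
  show "z (val k) = 0" unfolding y u(2) by (simp add: Z_simps of_Z_def)
qed

end

section \<open>Cardinality of the completed group algebra\<close>

context odd_padic begin

text \<open>Base-p expansions with digits 0 and 1. Sets of naturals are the bridge by which
  \<open>\<Lambda>\<close> is embedded into the p-adic integers.\<close>

lemma nat_sets_embed_Z: "\<exists>f :: nat set \<Rightarrow> nat \<Rightarrow> int. inj f \<and> range f \<subseteq> carrier Z"
proof -
  define f :: "nat set \<Rightarrow> nat \<Rightarrow> int" where "f S n = (\<Sum>i<n. if i \<in> S then q i else 0)" for S n
  have step: "f S (Suc n) = f S n + (if n \<in> S then q n else 0)" for S n by (simp add: f_def)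
  have bound: "0 \<le> f S n \<and> f S n < q n" for S n
  proof (induction n)
    case (Suc n)
    have "2 * q n \<le> int p * q n" using p_gt_1 by (intro mult_right_mono) auto
    moreover have "(if n \<in> S then q n else 0) \<le> q n" "0 \<le> (if n \<in> S then q n else 0)" by auto
    ultimately show ?case using Suc unfolding step power_Suc by linarith
  qed (simp add: f_def)
  have "f S \<in> carrier Z" for S
    unfolding Z_carrier
  proof (intro allI conjI)
    fix n
    show "f S (Suc n) mod q n = f S n" using bound[of S n] by (simp add: step)
  qed (use bound in auto)
  moreover have "inj f"
  proof (rule injI)
    fix S T assume eq: "f S = f T"
    have "n \<in> S \<longleftrightarrow> n \<in> T" for n
      using step[of S n] step[of T n] q_pos[of n] unfolding eq by (auto split: if_splits)
    then show "S = T" by blast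
  qed
  ultimately show ?thesis by blast
qed

text \<open>Powers of the generator enumerate the cosets of each \<open>V n\<close>, so an element
  of \<open>\<Lambda>\<close> amounts to a function on triples of naturals; its graph, coded as a
  set of naturals, determines it.\<close>

lemma Lambda_embeds_Z:
  "\<exists>j. inj_on j (carrier L.\<Lambda>) \<and> j ` carrier L.\<Lambda> \<subseteq> carrier Z"
proof -
  obtain f :: "nat set \<Rightarrow> nat \<Rightarrow> int" where f: "inj f" "range f \<subseteq> carrier Z" using nat_sets_embed_Z by blast
  define code where "code x = (\<lambda>(n, j, l). prod_encode (prod_encode (n, prod_encode (j, l)),
      nat (x (V n) (V n #>\<^bsub>G\<^esub> gp j) l))) ` UNIV" for x :: "(nat \<Rightarrow> int) set \<Rightarrow> (nat \<Rightarrow> int) set \<Rightarrow> nat \<Rightarrow> int"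
  have "inj_on code (carrier L.\<Lambda>)"
  proof (rule inj_onI)
    fix x y assume x: "x \<in> carrier L.\<Lambda>" and y: "y \<in> carrier L.\<Lambda>" and eq: "code x = code y"
    show "x = y"
    proof (rule Lambda_eqI_V[OF x y])
      fix n b assume b: "b \<in> carrier (G Mod V n)"
      then obtain j where j: "b = V n #>\<^bsub>G\<^esub> gp j" using coset_gp by blast
      show "x (V n) b = y (V n) b"
      proof
        fix l
        have "prod_encode (prod_encode (n, prod_encode (j, l)), nat (x (V n) b l)) \<in> code x"
          unfolding code_def j by (rule image_eqI[of _ _ "(n, j, l)"]) auto
        then have "prod_encode (prod_encode (n, prod_encode (j, l)), nat (x (V n) b l)) \<in> code y"
          by (simp only: eq)
        then have "nat (x (V n) b l) = nat (y (V n) b l)" unfolding code_def j by auto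
        moreover have "0 \<le> x (V n) b l" "0 \<le> y (V n) b l"
          using Z_bounds(1) L.LambdaD(4)[OF x V_in_N b] L.LambdaD(4)[OF y V_in_N b] by blast+
        ultimately show "x (V n) b l = y (V n) b l" by simp
      qed
    qed
  qed
  then have "inj_on (f \<circ> code) (carrier L.\<Lambda>)"
    by (rule comp_inj_on) (rule inj_on_subset[OF f(1)], simp)
  moreover have "(f \<circ> code) ` carrier L.\<Lambda> \<subseteq> carrier Z" using f(2) by auto
  ultimately show ?thesis by blast
qed

section \<open>Cohomology\<close>

abbreviation "B t \<equiv> completed_module G (E1_part p t) (E1_act p)"
abbreviation "weight t \<equiv> (- t) div (2 :: int)"

lemma B_profinite: "profinite_module L.\<Lambda> (B t)"
  by (rule padic_character.completed_module_profinite[OF power_character E1_part_profinite act_eq_power])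

lemma B_simps:
  "carrier (B t) = carrier (E1_part p t)" "\<zero>\<^bsub>B t\<^esub> = (\<lambda>k. \<zero>\<^bsub>Z\<^esub>)" "f \<oplus>\<^bsub>B t\<^esub> h = (\<lambda>k. f k \<oplus>\<^bsub>Z\<^esub> h k)"
  by (simp_all add: completed_module_def E1_part_simps)

lemma B_smult:
  assumes "x \<in> carrier L.\<Lambda>" "f \<in> carrier (E1_part p t)"
  shows "x \<odot>\<^bsub>B t\<^esub> f = (\<lambda>i. padic_character.\<xi> p (\<lambda>u. u [^]\<^bsub>G\<^esub> weight t) x \<otimes>\<^bsub>Z\<^esub> f i)"
  using padic_character.completed_smult_eq[OF power_character[of "weight t"] E1_part_profinite assms, of "E1_act p"]
    act_eq_power[OF assms(2)]
  by (simp add: completed_module_def E1_part_simps del: G_simps)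

lemma B_gamma:
  "f \<in> carrier (E1_part p t) \<Longrightarrow> \<gamma> \<odot>\<^bsub>B t\<^esub> f = (\<lambda>i. twist (weight t) \<otimes>\<^bsub>Z\<^esub> f i)"
  using B_smult[OF gamma_closed] xi_gamma[OF power_character[of "weight t"]] by (simp add: twist_def)

lemma scalar_closed: "c \<in> carrier Z \<Longrightarrow> scalar_embedding Z G c \<in> carrier L.\<Lambda>"
  unfolding L.scalar_embedding_dirac using L.dirac_closed[OF _ G.one_closed] .

lemma B_scalar:
  "c \<in> carrier Z \<Longrightarrow> f \<in> carrier (E1_part p t) \<Longrightarrow> scalar_embedding Z G c \<odot>\<^bsub>B t\<^esub> f = (\<lambda>i. c \<otimes>\<^bsub>Z\<^esub> f i)"
  using B_smult[OF scalar_closed] padic_character.xi_scalar[OF power_character[of "weight t"]] by simp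

lemma B_mdiff:
  assumes f: "f \<in> carrier (E1_part p t)" and h: "h \<in> carrier (E1_part p t)"
  shows "mdiff L.\<Lambda> (B t) f h i \<oplus>\<^bsub>Z\<^esub> h i = f i" "mdiff L.\<Lambda> (B t) f h \<in> carrier (E1_part p t)"
proof -
  interpret B: module L.\<Lambda> "B t" by (rule profinite_moduleD[OF B_profinite])
  have fh: "f \<in> carrier (B t)" "h \<in> carrier (B t)" using f h by (simp_all add: B_simps)
  show "mdiff L.\<Lambda> (B t) f h i \<oplus>\<^bsub>Z\<^esub> h i = f i"
    using fun_cong[OF B.mdiff_add_cancel[OF fh], of i] by (simp add: B_simps)
  show "mdiff L.\<Lambda> (B t) f h \<in> carrier (E1_part p t)" using B.mdiff_closed[OF fh] by (simp add: B_simps)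
qed

lemma single_closed: "z \<in> carrier Z \<Longrightarrow> (\<lambda>i. if i = k then z else \<zero>\<^bsub>Z\<^esub>) \<in> carrier (E1_part p (- 2 * k))"
  by (simp add: E1_part_carrier)

lemma E1_apply: "f \<in> carrier (E1_part p t) \<Longrightarrow> f i \<in> carrier Z"
  by (simp add: E1_part_carrier)

lemma E1_part_eq_iff:
  "f \<in> carrier (E1_part p (- 2 * k)) \<Longrightarrow> h \<in> carrier (E1_part p (- 2 * k)) \<Longrightarrow> f = h \<longleftrightarrow> f k = h k"
  using E1_part_ext[of f "- 2 * k" h] by auto

text \<open>The augmentation of \<open>P\<close> is onto the p-adic integers, so choosing preimages
  embeds them, and with them \<open>\<Lambda>\<close>, into the element type of
  \<open>P\<close>.\<close>

lemma ext_setup: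
  fixes P :: "nat \<Rightarrow> ((nat \<Rightarrow> int) set \<Rightarrow> (nat \<Rightarrow> int) set \<Rightarrow> nat \<Rightarrow> int, 'u) topmod"
  assumes res: "projective_resolution TYPE('u) L.\<Lambda> (trivial_module Z G) P d \<epsilon>"
  shows "\<exists>\<iota>. ext_computation L.\<Lambda> \<gamma> (trivial_module Z G) aug P d \<epsilon> (B t) \<iota>"
proof -
  obtain j where j: "inj_on j (carrier L.\<Lambda>)" "j ` carrier L.\<Lambda> \<subseteq> carrier Z" using Lambda_embeds_Z by blast
  have "\<epsilon> ` carrier (P 0) = carrier (trivial_module Z G)"
    using res unfolding projective_resolution_def by blast
  then have surj: "\<epsilon> ` carrier (P 0) = carrier Z" by (simp only: trivial_module_simps)
  have "inj_on (inv_into (carrier (P 0)) \<epsilon> \<circ> j) (carrier L.\<Lambda>)"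
    by (rule comp_inj_on[OF j(1)]) (rule inj_on_inv_into, use j(2) surj in blast)
  then show ?thesis
    using ext_computation.intro[OF augmentation ext_computation_axioms.intro[OF res B_profinite]] by blast
qed

text \<open>\<open>\<gamma>\<close> acts by \<open>twist k\<close> on the single coefficient, so by
  \<open>twist_image\<close> the quotient is detected by the residue of that coefficient at level
  \<open>val k\<close>.\<close>

lemma ext_1_weight:
  assumes X: "ext_computation L.\<Lambda> \<gamma> (trivial_module Z G) aug P d \<epsilon> (B (- 2 * k)) \<iota>" and k: "k \<noteq> 0"
  shows "module_iso Z (restrict_scalars (scalar_embedding Z G) (ext L.\<Lambda> P d (B (- 2 * k)) 1)) (Zmod p (val k))"
proof (rule ext_computation.ext_1_iso[OF X, where \<pi> = "\<lambda>f. f k (val k)"])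
  let ?t = "- 2 * k"
  have w: "weight ?t = k" by simp
  fix f h assume f: "f \<in> carrier (B ?t)" and h: "h \<in> carrier (B ?t)"
  then have fh: "f \<in> carrier (E1_part p ?t)" "h \<in> carrier (E1_part p ?t)" by (simp_all only: B_simps)
  show "(f \<oplus>\<^bsub>B ?t\<^esub> h) k (val k) = f k (val k) \<oplus>\<^bsub>Zmod p (val k)\<^esub> h k (val k)"
    unfolding B_simps by (simp add: Z_simps Zmod_def)
  let ?c = "mdiff L.\<Lambda> (B ?t) f h"
  note c = B_mdiff[OF fh]
  have cZ: "?c k \<in> carrier Z" by (rule E1_apply[OF c(2)])
  have eq: "f k (val k) = (?c k (val k) + h k (val k)) mod q (val k)"
    using arg_cong[OF c(1)[of k], of "\<lambda>x. x (val k)"] by (simp add: Z_simps)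
  have hb: "h k (val k) mod q (val k) = h k (val k)" by (rule Z_mod[OF E1_apply[OF fh(2)]])
  have "f k (val k) = h k (val k) \<longleftrightarrow> [?c k (val k) + h k (val k) = 0 + h k (val k)] (mod q (val k))"
    unfolding cong_def using eq hb by simp
  also have "\<dots> \<longleftrightarrow> ?c k (val k) = 0"
    unfolding cong_add_rcancel using Z_mod[OF cZ, of "val k"] by (simp add: cong_def)
  also have "\<dots> \<longleftrightarrow> (\<exists>y\<in>carrier Z. ?c k = twist k \<otimes>\<^bsub>Z\<^esub> y)" by (rule twist_image[OF k cZ])
  also have "\<dots> \<longleftrightarrow> (\<exists>b\<in>carrier (B ?t). ?c = \<gamma> \<odot>\<^bsub>B ?t\<^esub> b)"
  proof
    assume "\<exists>y\<in>carrier Z. ?c k = twist k \<otimes>\<^bsub>Z\<^esub> y"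
    then obtain y where y: "y \<in> carrier Z" "?c k = twist k \<otimes>\<^bsub>Z\<^esub> y" by blast
    let ?b = "\<lambda>i. if i = k then y else \<zero>\<^bsub>Z\<^esub>"
    note b = single_closed[OF y(1), of k]
    have "?c = \<gamma> \<odot>\<^bsub>B ?t\<^esub> ?b"
    proof (rule E1_part_ext[OF c(2)])
      show "\<gamma> \<odot>\<^bsub>B ?t\<^esub> ?b \<in> carrier (E1_part p ?t)"
        using module.smult_closed[OF profinite_moduleD(1)[OF B_profinite] gamma_closed, of ?b ?t] b
        by (simp only: B_simps)
      fix i assume "- 2 * i = ?t"
      then show "?c i = (\<gamma> \<odot>\<^bsub>B ?t\<^esub> ?b) i" using y(2) unfolding B_gamma[OF b] w by simp
    qed
    then show "\<exists>b\<in>carrier (B ?t). ?c = \<gamma> \<odot>\<^bsub>B ?t\<^esub> b" using b unfolding B_simps by blast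
  next
    assume "\<exists>b\<in>carrier (B ?t). ?c = \<gamma> \<odot>\<^bsub>B ?t\<^esub> b"
    then obtain b where b: "b \<in> carrier (E1_part p ?t)" "?c = \<gamma> \<odot>\<^bsub>B ?t\<^esub> b" unfolding B_simps by blast
    have "?c k = twist k \<otimes>\<^bsub>Z\<^esub> b k" unfolding b(2) B_gamma[OF b(1)] w ..
    then show "\<exists>y\<in>carrier Z. ?c k = twist k \<otimes>\<^bsub>Z\<^esub> y" using E1_apply[OF b(1)] by blast
  qed
  finally show "f k (val k) = h k (val k) \<longleftrightarrow> (\<exists>b\<in>carrier (B ?t). ?c = \<gamma> \<odot>\<^bsub>B ?t\<^esub> b)" .
next
  fix a f assume a: "a \<in> carrier Z" and "f \<in> carrier (B (- 2 * k))"
  then have f: "f \<in> carrier (E1_part p (- 2 * k))" by (simp only: B_simps)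
  show "(scalar_embedding Z G a \<odot>\<^bsub>B (- 2 * k)\<^esub> f) k (val k) = a \<odot>\<^bsub>Zmod p (val k)\<^esub> f k (val k)"
    unfolding B_scalar[OF a f] by (simp add: Z_simps Zmod_def)
next
  show "(\<lambda>f. f k (val k)) ` carrier (B (- 2 * k)) = carrier (Zmod p (val k))"
  proof (intro equalityI subsetI)
    fix r assume "r \<in> (\<lambda>f. f k (val k)) ` carrier (B (- 2 * k))"
    then obtain f where "f \<in> carrier (E1_part p (- 2 * k))" "r = f k (val k)" unfolding B_simps by blast
    then show "r \<in> carrier (Zmod p (val k))" using Z_bounds[OF E1_apply, of f] by (simp add: Zmod_def)
  next
    fix r assume "r \<in> carrier (Zmod p (val k))"
    then have r: "of_Z r (val k) = r" by (simp add: of_Z_def Zmod_def)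
    show "r \<in> (\<lambda>f. f k (val k)) ` carrier (B (- 2 * k))"
      unfolding B_simps
      using single_closed[OF of_Z_closed[of r], of k] r
      by (intro image_eqI[where x = "\<lambda>i. if i = k then of_Z r else \<zero>\<^bsub>Z\<^esub>"]) simp_all
  qed
qed (rule scalar_closed)

text \<open>In weight zero \<open>\<gamma>\<close> acts as zero, so its kernel and cokernel are both
  the whole module, identified with the p-adic integers by the constant coefficient.\<close>

lemma ext_weight_0:
  assumes X: "ext_computation L.\<Lambda> \<gamma> (trivial_module Z G) aug P d \<epsilon> (B 0) \<iota>" and s: "s = 0 \<or> s = 1"
  shows "module_iso Z (restrict_scalars (scalar_embedding Z G) (ext L.\<Lambda> P d (B 0) s)) (ring_as_topmod Z)"
proof -
  interpret B: module L.\<Lambda> "B 0" by (rule profinite_moduleD[OF B_profinite])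
  have "twist 0 = \<zero>\<^bsub>Z\<^esub>" by (simp add: twist_def a_minus_def Z.r_neg)
  then have g: "\<gamma> \<odot>\<^bsub>B 0\<^esub> f = \<zero>\<^bsub>B 0\<^esub>" if "f \<in> carrier (B 0)" for f
    using that B_gamma[of f 0] E1_apply[of f 0] by (simp add: B_simps)
  have add: "(f \<oplus>\<^bsub>B 0\<^esub> h) 0 = f 0 \<oplus>\<^bsub>ring_as_topmod Z\<^esub> h 0" for f h by (simp add: B_simps)
  have smult: "(scalar_embedding Z G a \<odot>\<^bsub>B 0\<^esub> f) 0 = a \<odot>\<^bsub>ring_as_topmod Z\<^esub> f 0"
    if "a \<in> carrier Z" "f \<in> carrier (B 0)" for a f
    using that B_scalar[of a f 0] by (simp add: B_simps)
  have inj: "f = h \<longleftrightarrow> f 0 = h 0" if "f \<in> carrier (B 0)" "h \<in> carrier (B 0)" for f h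
    using E1_part_eq_iff[of f 0 h] that by (simp add: B_simps)
  have surj: "(\<lambda>f. f 0) ` carrier (B 0) = carrier (ring_as_topmod Z)"
  proof (intro equalityI subsetI)
    fix z assume "z \<in> carrier (ring_as_topmod Z)"
    then have "(\<lambda>i. if i = 0 then z else \<zero>\<^bsub>Z\<^esub>) \<in> carrier (B 0)" using single_closed[of z 0] by (simp add: B_simps)
    then show "z \<in> (\<lambda>f. f 0) ` carrier (B 0)" by (rule image_eqI[rotated]) simp
  qed (auto simp: B_simps E1_apply)
  from s show ?thesis
  proof
    assume s: "s = 0"
    show ?thesis
      unfolding s
    proof (rule ext_computation.ext_0_iso[where \<pi> = "\<lambda>f. f 0" and T = "ring_as_topmod Z" and S = Z and \<phi> = "scalar_embedding Z G", OF X])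
      have "{b \<in> carrier (B 0). \<gamma> \<odot>\<^bsub>B 0\<^esub> b = \<zero>\<^bsub>B 0\<^esub>} = carrier (B 0)" using g by blast
      then show "bij_betw (\<lambda>f. f 0) {b \<in> carrier (B 0). \<gamma> \<odot>\<^bsub>B 0\<^esub> b = \<zero>\<^bsub>B 0\<^esub>} (carrier (ring_as_topmod Z))"
        using surj inj by (simp only: bij_betw_def inj_on_def) blast
    qed (use add smult scalar_closed in auto)
  next
    assume s: "s = 1"
    show ?thesis
      unfolding s
    proof (rule ext_computation.ext_1_iso[where \<pi> = "\<lambda>f. f 0" and T = "ring_as_topmod Z" and S = Z and \<phi> = "scalar_embedding Z G", OF X _ _ _ surj])
      fix f h assume fh: "f \<in> carrier (B 0)" "h \<in> carrier (B 0)"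
      have "(\<exists>b\<in>carrier (B 0). mdiff L.\<Lambda> (B 0) f h = \<gamma> \<odot>\<^bsub>B 0\<^esub> b) \<longleftrightarrow> mdiff L.\<Lambda> (B 0) f h = \<zero>\<^bsub>B 0\<^esub>"
        using g B.M.zero_closed by metis
      also have "\<dots> \<longleftrightarrow> f = h" by (rule B.mdiff_eq_zero_iff[OF fh])
      finally show "f 0 = h 0 \<longleftrightarrow> (\<exists>b\<in>carrier (B 0). mdiff L.\<Lambda> (B 0) f h = \<gamma> \<odot>\<^bsub>B 0\<^esub> b)"
        using inj[OF fh] by blast
    qed (use add smult scalar_closed in auto)
  qed
qed

text \<open>A nonzero coefficient would sit at a nonzero weight k, where \<open>g^k - 1\<close> is
  not a zero divisor.\<close>

lemma ext_0_weight:
  assumes X: "ext_computation L.\<Lambda> \<gamma> (trivial_module Z G) aug P d \<epsilon> (B t) \<iota>" and t: "t \<noteq> 0"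
  shows "carrier (restrict_scalars \<phi> (ext L.\<Lambda> P d (B t) 0)) = {\<zero>\<^bsub>restrict_scalars \<phi> (ext L.\<Lambda> P d (B t) 0)\<^esub>}"
proof (rule ext_computation.ext_0_trivial[OF X])
  fix b assume "b \<in> carrier (B t)" and 0: "\<gamma> \<odot>\<^bsub>B t\<^esub> b = \<zero>\<^bsub>B t\<^esub>"
  then have b: "b \<in> carrier (E1_part p t)" by (simp only: B_simps)
  show "b = \<zero>\<^bsub>B t\<^esub>"
    unfolding B_simps
  proof
    fix i
    show "b i = \<zero>\<^bsub>Z\<^esub>"
    proof (rule ccontr)
      assume nz: "b i \<noteq> \<zero>\<^bsub>Z\<^esub>"
      then have "- 2 * i = t" using b by (simp add: E1_part_carrier)
      then have "weight t \<noteq> 0" using t by presburger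
      moreover have "twist (weight t) \<otimes>\<^bsub>Z\<^esub> b i = \<zero>\<^bsub>Z\<^esub>"
        using fun_cong[OF 0, of i] unfolding B_gamma[OF b] B_simps .
      ultimately show False using twist_injective[OF _ E1_apply[OF b]] nz by blast
    qed
  qed
qed

text \<open>For even t the condition says that p - 1 does not divide the weight k, so
  \<open>g^k - 1\<close> is a unit; for odd t the module is zero.\<close>

lemma ext_1_other:
  assumes X: "ext_computation L.\<Lambda> \<gamma> (trivial_module Z G) aug P d \<epsilon> (B t) \<iota>" and t: "t \<noteq> 0"
    and n: "\<And>t'. t \<noteq> 2 * (int p - 1) * t'"
  shows "carrier (restrict_scalars \<phi> (ext L.\<Lambda> P d (B t) 1)) = {\<zero>\<^bsub>restrict_scalars \<phi> (ext L.\<Lambda> P d (B t) 1)\<^esub>}"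
proof (rule ext_computation.ext_1_trivial[OF X])
  fix b assume "b \<in> carrier (B t)"
  then have b: "b \<in> carrier (E1_part p t)" by (simp only: B_simps)
  show "\<exists>c\<in>carrier (B t). b = \<gamma> \<odot>\<^bsub>B t\<^esub> c"
  proof (cases "even t")
    case True
    define k where "k = weight t"
    have tk: "t = - 2 * k" using True by (auto simp: k_def)
    have k0: "k \<noteq> 0" using t tk by simp
    have "\<not> int p - 1 dvd k"
    proof
      assume "int p - 1 dvd k"
      then obtain r where "k = (int p - 1) * r" by blast
      then have "t = 2 * (int p - 1) * (- r)" using tk by simp
      then show False using n by blast
    qed
    then have v: "val k = 0" by (simp add: val_def)
    \<comment> \<open>With \<open>val k = 0\<close>, \<open>twist_image\<close> asks for a residue
      modulo one, which is always zero.\<close>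
    have "b k 0 = 0" using Z_bounds[OF E1_apply[OF b], of k 0] by simp
    then obtain y where y: "y \<in> carrier Z" "b k = twist k \<otimes>\<^bsub>Z\<^esub> y"
      using twist_image[OF k0 E1_apply[OF b, of k]] unfolding v by blast
    let ?c = "\<lambda>i. if i = k then y else \<zero>\<^bsub>Z\<^esub>"
    have c: "?c \<in> carrier (E1_part p t)" unfolding tk by (rule single_closed[OF y(1)])
    have "b = \<gamma> \<odot>\<^bsub>B t\<^esub> ?c"
    proof (rule E1_part_ext[OF b])
      show "\<gamma> \<odot>\<^bsub>B t\<^esub> ?c \<in> carrier (E1_part p t)"
        using module.smult_closed[OF profinite_moduleD(1)[OF B_profinite] gamma_closed, of ?c t] c
        by (simp only: B_simps)
      fix i assume "- 2 * i = t"
      then have "i = k" using tk by simp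
      then show "b i = (\<gamma> \<odot>\<^bsub>B t\<^esub> ?c) i" using y(2) unfolding B_gamma[OF c] k_def[symmetric] by simp
    qed
    then show ?thesis using c unfolding B_simps by blast
  next
    case False
    \<comment> \<open>Every coefficient vanishes, so \<open>b\<close> serves as its own
      preimage.\<close>
    have "b i = \<zero>\<^bsub>Z\<^esub>" for i using b False by (auto simp: E1_part_carrier)
    then have "b i = twist (weight t) \<otimes>\<^bsub>Z\<^esub> b i" for i by simp
    then have "b = \<gamma> \<odot>\<^bsub>B t\<^esub> b" unfolding B_gamma[OF b] by (rule ext)
    then show ?thesis using b unfolding B_simps by blast
  qed
qed

end

text \<open>The element type \<open>'u\<close> is arbitrary, and the answer is obtained from every
  projective resolution over it. When \<open>'u\<close> is the element type of the completed
  algebra, the first conjunct supplies such a resolution.\<close>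

theorem theorem6p1:
  fixes p :: nat
  assumes "prime p" and "odd p"
  shows
    "(\<exists>(Q :: nat \<Rightarrow> ((nat \<Rightarrow> int) set \<Rightarrow> (nat \<Rightarrow> int) set \<Rightarrow> nat \<Rightarrow> int,
                    (nat \<Rightarrow> int) set \<Rightarrow> (nat \<Rightarrow> int) set \<Rightarrow> nat \<Rightarrow> int) topmod) \<delta> \<eta>.
        projective_resolution TYPE('u)
            (completed_group_algebra (Zp p) (Zp_units p)) (trivial_module (Zp p) (Zp_units p)) Q \<delta> \<eta>) \<and>
     (\<forall>(P :: nat \<Rightarrow> ((nat \<Rightarrow> int) set \<Rightarrow> (nat \<Rightarrow> int) set \<Rightarrow> nat \<Rightarrow> int, 'u) topmod) d \<epsilon>.
        projective_resolution TYPE('u)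
            (completed_group_algebra (Zp p) (Zp_units p)) (trivial_module (Zp p) (Zp_units p)) P d \<epsilon> \<longrightarrow>
        (\<forall>(s :: nat) (t :: int).
           let H = cohomology (Zp p) (Zp_units p) P d (E1_part p t) (E1_act p) s in
           (t = 0 \<and> s \<in> {0, 1} \<longrightarrow>
              module_iso (Zp p) H (ring_as_topmod (Zp p))) \<and>
           (\<forall>t' :: int. t = 2 * (int p - 1) * t' \<and> t' \<noteq> 0 \<and> s = 1 \<longrightarrow>
              module_iso (Zp p) H (Zmod p (multiplicity (int p) t' + 1))) \<and>
           (\<not> (t = 0 \<and> s \<in> {0, 1}) \<and>
            \<not> (\<exists>t' :: int. t = 2 * (int p - 1) * t' \<and> t' \<noteq> 0 \<and> s = 1) \<longrightarrow>
              carrier H = {\<zero>\<^bsub>H\<^esub>})))"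
proof (intro conjI allI impI)
  interpret odd_padic p by standard (use assms in auto)
  show "\<exists>(Q :: nat \<Rightarrow> ((nat \<Rightarrow> int) set \<Rightarrow> (nat \<Rightarrow> int) set \<Rightarrow> nat \<Rightarrow> int,
                    (nat \<Rightarrow> int) set \<Rightarrow> (nat \<Rightarrow> int) set \<Rightarrow> nat \<Rightarrow> int) topmod) \<delta> \<eta>.
        projective_resolution TYPE('u) L.\<Lambda> (trivial_module Z G) Q \<delta> \<eta>"
    by (rule cyclic_resolution.resolution_exists[OF augmentation])
  fix P :: "nat \<Rightarrow> ((nat \<Rightarrow> int) set \<Rightarrow> (nat \<Rightarrow> int) set \<Rightarrow> nat \<Rightarrow> int, 'u) topmod" and d \<epsilon>
    and s :: nat and t :: int
  assume res: "projective_resolution TYPE('u) L.\<Lambda> (trivial_module Z G) P d \<epsilon>"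
  let ?H = "cohomology Z G P d (E1_part p t) (E1_act p) s"
  obtain \<iota> where X: "ext_computation L.\<Lambda> \<gamma> (trivial_module Z G) aug P d \<epsilon> (B t) \<iota>"
    using ext_setup[OF res] by blast
  have 1: "module_iso Z ?H (ring_as_topmod Z)" if "t = 0 \<and> s \<in> {0, 1}"
    using ext_weight_0[of P d \<epsilon> \<iota> s] X that unfolding cohomology_def by blast
  have 2: "module_iso Z ?H (Zmod p (multiplicity (int p) t' + 1))"
    if t': "t = 2 * (int p - 1) * t' \<and> t' \<noteq> 0 \<and> s = 1" for t'
  proof -
    \<comment> \<open>The minus sign comes from u having degree -2; the multiplicity does not see
      it.\<close>
    define k where "k = (int p - 1) * (- t')"
    have pn: "int p - 1 \<noteq> 0" using p_gt_1 by simp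
    have tk: "t = - 2 * k" using t' by (simp add: k_def)
    have "k \<noteq> 0" using t' pn by (simp add: k_def)
    moreover have "k div (int p - 1) = - t'" using pn unfolding k_def by (rule nonzero_mult_div_cancel_left)
    then have "val k = multiplicity (int p) t' + 1"
      by (auto simp: val_def k_def intro: multiplicity_cong)
    ultimately show ?thesis
      using ext_1_weight[of P d \<epsilon> k \<iota>] X t' unfolding cohomology_def tk by simp
  qed
  have 3: "carrier ?H = {\<zero>\<^bsub>?H\<^esub>}"
    if no: "\<not> (t = 0 \<and> s \<in> {0, 1}) \<and> \<not> (\<exists>t'. t = 2 * (int p - 1) * t' \<and> t' \<noteq> 0 \<and> s = 1)"
  proof -
    consider "s = 0" | "s = 1" | n where "s = Suc (Suc n)" by (metis One_nat_def not0_implies_Suc)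
    then show ?thesis
    proof cases
      case 1
      then have "t \<noteq> 0" using no by simp
      then show ?thesis unfolding cohomology_def 1 by (rule ext_0_weight[OF X])
    next
      case 2
      then have "t \<noteq> 0" using no by simp
      \<comment> \<open>The excluded case concerns nonzero t' only; t' = 0 is ruled out by t being
        nonzero.\<close>
      moreover have "t \<noteq> 2 * (int p - 1) * t'" for t' using no 2 \<open>t \<noteq> 0\<close> by (cases "t' = 0") auto
      ultimately show ?thesis unfolding cohomology_def 2 by (rule ext_1_other[OF X])
    next
      case 3
      show ?thesis unfolding cohomology_def 3 by (rule ext_computation.ext_ge_2_trivial[OF X])
    qed
  qed
  show "let H = ?H in
           (t = 0 \<and> s \<in> {0, 1} \<longrightarrow> module_iso Z H (ring_as_topmod Z)) \<and>
           (\<forall>t' :: int. t = 2 * (int p - 1) * t' \<and> t' \<noteq> 0 \<and> s = 1 \<longrightarrow>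
              module_iso Z H (Zmod p (multiplicity (int p) t' + 1))) \<and>
           (\<not> (t = 0 \<and> s \<in> {0, 1}) \<and>
            \<not> (\<exists>t' :: int. t = 2 * (int p - 1) * t' \<and> t' \<noteq> 0 \<and> s = 1) \<longrightarrow>
              carrier H = {\<zero>\<^bsub>H\<^esub>})"
    unfolding Let_def using 1 2 3 by blast
qed

end
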